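(* Let $(r^{N-1}V,r^{N-1}W)$ be a Bessel pair on $(0,\infty)$ with positive solution $f$ on $(0,\infty)$. Also assume $N\ge5$ and that $V$ satisfies, for $r>0$, $$(N-5)\frac{V(r)}{\sinh^2 r}+3\frac{V_r(r)\cosh r}{\sinh r}-V_{rr}(r)+(N-4)V(r)\ge0.$$ Then for all $u\in C_c^\infty(\mathbb{H}^N\setminus\{x_0\})$ there holds $$\begin{aligned}\int_{\mathbb{H}^N}V(r)|\Delta_{\mathbb{H}^N}u|^2\,dv_{\mathbb{H}^N}\ge{}&\int_{\mathbb{H}^N}W(r)|\nabla_{\mathbb{H}^N}u|^2\,dv_{\mathbb{H}^N}\\&+(N-1)\int_{\mathbb{H}^N}\left(\frac{V(r)}{\sinh^2 r}-\frac{V_r(r)\cosh r}{\sinh r}\right)|\nabla_{\mathbb{H}^N}u|^2\,dv_{\mathbb{H}^N}\\&-(N-1)\int_{\mathbb{H}^N}V(r)\frac{f'(r)}{f(r)}\left(\coth r-\frac1r\right)|\nabla_{\mathbb{H}^N}u|^2\,dv_{\mathbb{H}^N}\\&+\int_{\mathbb{H}^N}V(r)(f(r))^2\left|\nabla_{\mathbb{H}^N}\left(\frac{u_r}{f(r)}\right)\right|^2dv_{\mathbb{H}^N}.\end{aligned}$$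
   Context: $\mathbb{H}^N$ is the $N$-dimensional hyperbolic space (constant curvature $-1$) with Riemannian volume $dv_{\mathbb{H}^N}$, Laplace-Beltrami operator $\Delta_{\mathbb{H}^N}$ and Riemannian gradient $\nabla_{\mathbb{H}^N}$; $x_0\in\mathbb{H}^N$ is a fixed pole, $r=d(x,x_0)$ is the geodesic distance, and $(r,\Theta)\in(0,\infty)\times\mathbb{S}^{N-1}$ are polar coordinates about $x_0$, in which $dv_{\mathbb{H}^N}=(\sinh r)^{N-1}\,dr\,d\Theta$ and $\nabla_{\mathbb{H}^N}u=\left(\frac{\partial u}{\partial r},\frac{1}{\sinh r}\nabla_{\mathbb{S}^{N-1}}u\right)$. Here $u_r=\frac{\partial u}{\partial r}$, and $V_r$, $V_{rr}$ are the first and second derivatives of $V$ with respect to $r$; $f'$ is the derivative of $f$. A pair $(\tilde V,\tilde W)$ of $C^1$ functions is a Bessel pair on $(0,\infty)$ if the ordinary differential equation $(\tilde V y')'+\tilde W y=0$ admits a positive solution on $(0,\infty)$; thus here $f>0$ satisfies $(r^{N-1}Vf')'+r^{N-1}Wf=0$ on $(0,\infty)$.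
   Formalization: The formal theorem additionally assumes V(r) ≥ 0 for all r > 0; without it the claim is false (e.g. f = 1, W = 0, V = -(sinh r)^k with k large, tested on u = d(r)Y_l with l large), and it fails whenever V is negative somewhere. *)

theory Defs
  imports "HOL-Analysis.Analysis"
begin

section \<open>Smooth functions on open sets\<close>

definition partial_deriv :: "'a::euclidean_space \<Rightarrow> ('a \<Rightarrow> real) \<Rightarrow> 'a \<Rightarrow> real" where
  "partial_deriv i u x = frechet_derivative u (at x) i"

fun C_k_on :: "nat \<Rightarrow> 'a::euclidean_space set \<Rightarrow> ('a \<Rightarrow> real) \<Rightarrow> bool" where
  "C_k_on 0 S u \<longleftrightarrow> continuous_on S u"
| "C_k_on (Suc k) S u \<longleftrightarrow>
     (\<forall>x\<in>S. u differentiable (at x)) \<and> (\<forall>i\<in>Basis. C_k_on k S (partial_deriv i u))"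

definition smooth_on :: "'a::euclidean_space set \<Rightarrow> ('a \<Rightarrow> real) \<Rightarrow> bool" where
  "smooth_on S u \<longleftrightarrow> (\<forall>k. C_k_on k S u)"

text \<open>Elements of \<open>C_c^\<infinity>(S)\<close> are represented by their extension by zero to the whole type.\<close>

definition test_functions :: "'a::euclidean_space set \<Rightarrow> ('a \<Rightarrow> real) set" where
  "test_functions S =
     {u. smooth_on S u \<and> compact (closure {x. u x \<noteq> 0}) \<and> closure {x. u x \<noteq> 0} \<subseteq> S}"

section \<open>Hyperbolic space: the Poincare ball model\<close>

text \<open>
  Hyperbolic space of dimension \<open>N = DIM('a)\<close> and curvature \<open>-1\<close> is the open unit ball of a
  Euclidean space with the Riemannian metric \<open>g = \<rho>\<^sup>2 g\<^sub>E\<close>, where \<open>g\<^sub>E\<close> is the Euclidean metric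
  and \<open>\<rho> x = 2 / (1 - |x|\<^sup>2)\<close>.  Tangent vectors are given by their Euclidean components.
\<close>

definition hyp_space :: "'a::euclidean_space set" where
  "hyp_space = ball 0 1"

definition hyp_factor :: "'a::euclidean_space \<Rightarrow> real" where
  "hyp_factor x = 2 / (1 - (norm x)\<^sup>2)"

definition hyp_inner :: "'a::euclidean_space \<Rightarrow> 'a \<Rightarrow> 'a \<Rightarrow> real" where
  "hyp_inner x v w = (hyp_factor x)\<^sup>2 * (v \<bullet> w)"

definition hyp_norm :: "'a::euclidean_space \<Rightarrow> 'a \<Rightarrow> real" where
  "hyp_norm x v = sqrt (hyp_inner x v v)"

text \<open>
  The geodesic distance.  The curves are required to be \<open>C\<^sup>1\<close> on all of \<open>[0,1]\<close>, so that the
  integrand is continuous.  For merely continuous curves that are \<open>C\<^sup>1\<close> off a finite set, the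
  integral could fail to exist and would then be \<open>0\<close> by convention.
\<close>

definition hyp_length :: "(real \<Rightarrow> 'a::euclidean_space) \<Rightarrow> real" where
  "hyp_length \<gamma> = integral {0..1} (\<lambda>t. hyp_norm (\<gamma> t) (vector_derivative \<gamma> (at t)))"

definition hyp_dist :: "'a::euclidean_space \<Rightarrow> 'a \<Rightarrow> real" where
  "hyp_dist x y =
     Inf {hyp_length \<gamma> | \<gamma>. \<gamma> C1_differentiable_on {0..1} \<and> \<gamma> ` {0..1} \<subseteq> hyp_space \<and>
                            \<gamma> 0 = x \<and> \<gamma> 1 = y}"

text \<open>The Riemannian volume has density \<open>sqrt (det g) = \<rho>\<^sup>N\<close> with respect to Lebesgue measure.\<close>

definition hyp_volume :: "'a::euclidean_space measure" where
  "hyp_volume =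
     density lborel (\<lambda>x. indicator hyp_space x * ennreal (hyp_factor x ^ DIM('a)))"

text \<open>The gradient is the vector field with \<open>g(grad u, X) = du(X)\<close>, that is,
  \<open>(grad u)\<^sup>i = g\<^sup>i\<^sup>j \<partial>\<^sub>j u\<close> with \<open>g\<^sup>i\<^sup>j = \<rho>\<^sup>-\<^sup>2 \<delta>\<^sup>i\<^sup>j\<close>.\<close>

definition hyp_grad :: "('a::euclidean_space \<Rightarrow> real) \<Rightarrow> 'a \<Rightarrow> 'a" where
  "hyp_grad u x = (\<Sum>i\<in>Basis. (partial_deriv i u x / (hyp_factor x)\<^sup>2) *\<^sub>R i)"

text \<open>\<open>div X = (det g)\<^sup>-\<^sup>1\<^sup>/\<^sup>2 \<partial>\<^sub>i ((det g)\<^sup>1\<^sup>/\<^sup>2 X\<^sup>i)\<close>, and the Laplace--Beltrami operator is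
  \<open>div grad\<close>.\<close>

definition hyp_div :: "('a::euclidean_space \<Rightarrow> 'a) \<Rightarrow> 'a \<Rightarrow> real" where
  "hyp_div X x =
     (\<Sum>i\<in>Basis. partial_deriv i (\<lambda>y. hyp_factor y ^ DIM('a) * (X y \<bullet> i)) x)
       / hyp_factor x ^ DIM('a)"

definition hyp_laplacian :: "('a::euclidean_space \<Rightarrow> real) \<Rightarrow> 'a \<Rightarrow> real" where
  "hyp_laplacian u = hyp_div (hyp_grad u)"

text \<open>In polar coordinates about the pole \<open>x0\<close>, the coordinate field \<open>\<partial>/\<partial>r\<close> is the gradient of
  \<open>r = d(\<cdot>, x0)\<close>, so \<open>u\<^sub>r = du(grad r) = g(grad r, grad u)\<close>.\<close>

definition hyp_radial_deriv :: "'a::euclidean_space \<Rightarrow> ('a \<Rightarrow> real) \<Rightarrow> 'a \<Rightarrow> real" where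
  "hyp_radial_deriv x0 u x = hyp_inner x (hyp_grad (\<lambda>y. hyp_dist y x0) x) (hyp_grad u x)"

section \<open>Bessel pairs\<close>

text \<open>
  A solution of \<open>(V y')' + W y = 0\<close> on \<open>(0,\<infinity>)\<close> is a \<open>C\<^sup>1\<close> function \<open>y\<close> such that \<open>V y'\<close> is
  differentiable and the equation holds pointwise.  No second derivative of \<open>y\<close> is required; it
  exists automatically wherever the \<open>C\<^sup>1\<close> function \<open>V\<close> does not vanish.
\<close>

definition positive_solution :: "(real \<Rightarrow> real) \<Rightarrow> (real \<Rightarrow> real) \<Rightarrow> (real \<Rightarrow> real) \<Rightarrow> bool" where
  "positive_solution V W y \<longleftrightarrow>
     y C1_differentiable_on {0<..} \<and>
     (\<forall>r>0. y r > 0) \<and>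
     (\<forall>r>0. ((\<lambda>s. V s * deriv y s) has_real_derivative - (W r * y r)) (at r))"

definition bessel_pair :: "(real \<Rightarrow> real) \<Rightarrow> (real \<Rightarrow> real) \<Rightarrow> bool" where
  "bessel_pair V W \<longleftrightarrow>
     V C1_differentiable_on {0<..} \<and> W C1_differentiable_on {0<..} \<and>
     (\<exists>y. positive_solution V W y)"

end

theory Submission
  imports Defs
begin

text \<open>
  The polar coordinates \<open>(r, \<theta>)\<close> about the pole are read off the hyperboloid model: there
  \<open>cosh r\<close> and \<open>sinh r \<cdot> \<theta>\<^sub>j\<close> are linear functions.  With \<open>R = \<partial>/\<partial>r\<close> and \<open>G\<^sub>j\<close> the components of
  the gradient on the unit sphere one has \<open>[R, G\<^sub>j] = 0\<close>, \<open>[G\<^sub>i, G\<^sub>j] = \<theta>\<^sub>i G\<^sub>j - \<theta>\<^sub>j G\<^sub>i\<close> and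
  \<open>\<Delta> = R\<^sup>2 + (N - 1) coth r R + \<Sum>\<^sub>j G\<^sub>j\<^sup>2 / sinh\<^sup>2 r\<close>.  No spherical harmonics are needed.  Integration by
  parts in \<open>r\<close> and on the spheres turns \<open>V (\<Delta>u)\<^sup>2\<close> into a quadratic form in \<open>R\<^sup>2 u\<close>, \<open>R u\<close>, \<open>G\<^sub>j R u\<close>,
  \<open>G\<^sub>j u\<close> and \<open>\<Sum>\<^sub>j G\<^sub>j\<^sup>2 u\<close>.  For a solution \<open>f\<close> of the Bessel equation,
  \<open>V (R z)\<^sup>2 = V (R z - (f'/f) z)\<^sup>2 + (W - (N - 1) V (f'/f) (coth r - 1/r)) z\<^sup>2\<close> up to a divergence; this is used
  with \<open>z = R u\<close> and with \<open>z = G\<^sub>j u / sinh r\<close>, the square being kept in the first case and dropped in the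
  second.  The square of the spherical Laplacian is bounded below by the Bochner formula together with
  \<open>(tr A)\<^sup>2 \<le> (N - 1) tr A\<^sup>2\<close>.  What remains is the hypothesis on \<open>V\<close> times \<open>\<Sum>\<^sub>j (G\<^sub>j u)\<^sup>2 / sinh\<^sup>2 r\<close>.

  The function \<open>V''\<close> need not be locally integrable a priori; it only enters through one divergence,
  with a nonnegative factor, and there the hypothesis bounds it from above.
\<close>

section \<open>Calculus with partial derivatives\<close>

text \<open>The factor coth r - 1/r measures a mismatch of weights: the Bessel equation carries
  r^(N-1), the volume (sinh r)^(N-1). For E = V f'/f the equation becomes the Riccati equation E' =
  - W - (N-1)/r E - E f'/f, whereas the divergence of E z^2 times the radial field contributes (N-1)
  coth r E z^2. A sphere need not carry a global frame, so all N projected coordinate fields G_j are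
  used. They are linearly dependent; the relations that the theta_j^2 sum to 1 and the theta_j G_j
  to 0 take the place of orthonormality. The distance is an infimum over curves, and nothing is
  known about its smoothness until it is identified with the arcosh of a Minkowski product. After
  that every coordinate is built from restrictions of linear functions. These are eigenfunctions of
  the Laplacian, which determines the divergence of the polar frame.\<close>

lemma partial_deriv_eqI:
  "(u has_derivative D) (at x) \<Longrightarrow> partial_deriv i u x = D i"
  using frechet_derivative_at[of u D x] by (simp add: partial_deriv_def)

lemma partial_deriv_cong:
  assumes "open S" "x \<in> S" "\<And>y. y \<in> S \<Longrightarrow> u y = v y"
  shows "partial_deriv i u x = partial_deriv i v x"
proof -
  have "(u has_derivative D) (at x) \<longleftrightarrow> (v has_derivative D) (at x)" for D
    using assms has_derivative_transform_within_open[of u D x UNIV S v]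
      has_derivative_transform_within_open[of v D x UNIV S u] by auto
  then show ?thesis by (simp add: partial_deriv_def frechet_derivative_def)
qed

lemma differentiable_cong_open:
  assumes "open S" "x \<in> S" "\<And>y. y \<in> S \<Longrightarrow> u y = v y" "u differentiable (at x)"
  shows "v differentiable (at x)"
  using assms has_derivative_transform_within_open[of u _ x UNIV S v]
  unfolding differentiable_def by blast

lemma frechet_derivative_eq_sum_partial:
  assumes "u differentiable (at x)"
  shows "frechet_derivative u (at x) v = (\<Sum>i\<in>Basis. (v \<bullet> i) * partial_deriv i u x)"
proof -
  interpret linear "frechet_derivative u (at x)"
    using assms by (rule linear_frechet_derivative)
  have "frechet_derivative u (at x) v = frechet_derivative u (at x) (\<Sum>i\<in>Basis. (v \<bullet> i) *\<^sub>R i)"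
    by (simp add: euclidean_representation)
  also have "\<dots> = (\<Sum>i\<in>Basis. (v \<bullet> i) * partial_deriv i u x)"
    by (simp add: sum scale partial_deriv_def)
  finally show ?thesis .
qed

lemma C_k_on_SucD:
  assumes "C_k_on (Suc k) S u"
  shows "x \<in> S \<Longrightarrow> u differentiable (at x)" "i \<in> Basis \<Longrightarrow> C_k_on k S (partial_deriv i u)"
  using assms by auto

lemma C_k_on_SucI:
  assumes "\<And>x. x \<in> S \<Longrightarrow> u differentiable (at x)"
    "\<And>i. i \<in> Basis \<Longrightarrow> C_k_on k S (partial_deriv i u)"
  shows "C_k_on (Suc k) S u"
  using assms by auto

lemma C_k_on_cong:
  assumes "open S" "C_k_on k S u" "\<And>y. y \<in> S \<Longrightarrow> u y = v y"
  shows "C_k_on k S v"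
  using assms(2,3)
proof (induction k arbitrary: u v)
  case 0
  then show ?case by (auto cong: continuous_on_cong)
next
  case (Suc k)
  show ?case
  proof (rule C_k_on_SucI)
    show "v differentiable (at x)" if "x \<in> S" for x
      by (rule differentiable_cong_open[OF assms(1) that Suc.prems(2) C_k_on_SucD(1)[OF Suc.prems(1) that]])
    show "C_k_on k S (partial_deriv i v)" if "i \<in> Basis" for i
      by (rule Suc.IH[OF C_k_on_SucD(2)[OF Suc.prems(1) that]])
        (rule partial_deriv_cong[OF assms(1) _ Suc.prems(2)])
  qed
qed

lemma C_k_on_Suc_imp:
  "C_k_on (Suc k) S u \<Longrightarrow> C_k_on k S u"
proof (induction k arbitrary: u)
  case 0
  then have "\<And>x. x \<in> S \<Longrightarrow> continuous (at x) u"
    by (simp add: differentiable_imp_continuous_within)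
  then show ?case by (simp add: continuous_at_imp_continuous_on)
next
  case (Suc k)
  show ?case
    by (rule C_k_on_SucI) (use Suc in \<open>auto simp del: C_k_on.simps dest: C_k_on_SucD\<close>)
qed

lemma C_k_on_le: "C_k_on m S u \<Longrightarrow> k \<le> m \<Longrightarrow> C_k_on k S u"
  by (induction m) (auto simp del: C_k_on.simps simp: le_Suc_eq dest: C_k_on_Suc_imp)

lemma C_k_on_subset: "C_k_on k T u \<Longrightarrow> S \<subseteq> T \<Longrightarrow> C_k_on k S u"
  by (induction k arbitrary: u) (auto intro: continuous_on_subset)

lemma C_k_on_continuous: "C_k_on k S u \<Longrightarrow> continuous_on S u"
  using C_k_on_le[of k S u 0] by simp

lemma C_k_on_differentiable: "C_k_on (Suc k) S u \<Longrightarrow> x \<in> S \<Longrightarrow> u differentiable (at x)"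
  by simp

text \<open>The closure properties that need a differentiation reduce to this: a formula for the
  derivative suffices, and \<open>partial_deriv\<close> of a composite expression need not be
  rewritten by hand.\<close>

lemma C_k_on_Suc_derivI:
  assumes "open S" "\<And>x. x \<in> S \<Longrightarrow> (u has_derivative D x) (at x)"
    "\<And>i. i \<in> Basis \<Longrightarrow> C_k_on k S (\<lambda>x. D x i)"
  shows "C_k_on (Suc k) S u"
proof (rule C_k_on_SucI)
  show "u differentiable (at x)" if "x \<in> S" for x
    using assms(2)[OF that] differentiableI by blast
  show "C_k_on k S (partial_deriv i u)" if "i \<in> Basis" for i
    by (rule C_k_on_cong[OF assms(1) assms(3)[OF that]]) (simp add: partial_deriv_eqI[OF assms(2)])
qed

lemma C_k_on_const [intro]: "C_k_on k S (\<lambda>x. c)"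
proof (induction k arbitrary: c)
  case (Suc k)
  have "partial_deriv i (\<lambda>x. c) = (\<lambda>x. 0)" for i :: 'a
    by (rule ext) (simp add: partial_deriv_def)
  then show ?case using Suc by auto
qed auto

lemma has_derivative_partial:
  "C_k_on (Suc k) S u \<Longrightarrow> x \<in> S \<Longrightarrow> (u has_derivative frechet_derivative u (at x)) (at x)"
  by (simp add: frechet_derivative_works[symmetric])

lemma C_k_on_add [intro]:
  assumes "open S"
  shows "C_k_on k S u \<Longrightarrow> C_k_on k S v \<Longrightarrow> C_k_on k S (\<lambda>x. u x + v x)"
proof (induction k arbitrary: u v)
  case 0 then show ?case by (auto intro: continuous_on_add)
next
  case (Suc k)
  show ?case
    by (rule C_k_on_Suc_derivI[OF assms has_derivative_add[OF
          has_derivative_partial[OF Suc.prems(1)] has_derivative_partial[OF Suc.prems(2)]]], assumption+)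
      (unfold partial_deriv_def[symmetric], rule Suc.IH[OF C_k_on_SucD(2)[OF Suc.prems(1)] C_k_on_SucD(2)[OF Suc.prems(2)]])
qed

lemma C_k_on_mult [intro]:
  assumes "open S"
  shows "C_k_on k S u \<Longrightarrow> C_k_on k S v \<Longrightarrow> C_k_on k S (\<lambda>x. u x * v x)"
proof (induction k arbitrary: u v)
  case 0 then show ?case by (auto intro: continuous_on_mult)
next
  case (Suc k)
  show ?case
    by (rule C_k_on_Suc_derivI[OF assms has_derivative_mult[OF has_derivative_partial has_derivative_partial]])
      (use Suc in \<open>auto simp del: C_k_on.simps simp: partial_deriv_def[symmetric]
        intro!: C_k_on_add[OF assms] dest: C_k_on_SucD(2) C_k_on_Suc_imp\<close>)
qed

lemma C_k_on_cmult: "open S \<Longrightarrow> C_k_on k S u \<Longrightarrow> C_k_on k S (\<lambda>x. c * u x)"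
  by (auto intro: C_k_on_mult)

lemma C_k_on_uminus: "open S \<Longrightarrow> C_k_on k S u \<Longrightarrow> C_k_on k S (\<lambda>x. - u x)"
  using C_k_on_cmult[of S k u "-1"] by simp

lemma C_k_on_diff [intro]: "open S \<Longrightarrow> C_k_on k S u \<Longrightarrow> C_k_on k S v \<Longrightarrow> C_k_on k S (\<lambda>x. u x - v x)"
  using C_k_on_add[of S k u "\<lambda>x. - v x"] C_k_on_uminus[of S k v] by simp

lemma C_k_on_power: "open S \<Longrightarrow> C_k_on k S u \<Longrightarrow> C_k_on k S (\<lambda>x. u x ^ n)"
  by (induction n) (auto intro: C_k_on_mult)

lemma C_k_on_sum [intro]:
  assumes "open S" "\<And>i. i \<in> I \<Longrightarrow> C_k_on k S (u i)"
  shows "C_k_on k S (\<lambda>x. \<Sum>i\<in>I. u i x)"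
  using assms(2) by (induction I rule: infinite_finite_induct) (auto intro: C_k_on_add[OF assms(1)])

lemma C_k_on_linear:
  assumes "open S" "bounded_linear l"
  shows "C_k_on k S l"
proof (cases k)
  case 0
  then show ?thesis using assms by (auto simp: linear_continuous_on)
next
  case (Suc n)
  show ?thesis unfolding Suc
    by (rule C_k_on_Suc_derivI[OF assms(1) bounded_linear_imp_has_derivative[OF assms(2)]]) auto
qed

lemma C_k_on_inner: "open S \<Longrightarrow> C_k_on k S (\<lambda>x. x \<bullet> v)" "open S \<Longrightarrow> C_k_on k S (\<lambda>x. v \<bullet> x)"
  by (auto intro: C_k_on_linear bounded_linear_inner_left bounded_linear_inner_right)

text \<open>The derivative contains the inverse of \<open>u\<close> again, but only to order
  \<open>k\<close>, where the induction hypothesis provides it.\<close>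

lemma C_k_on_inverse:
  assumes "open S" "\<And>x. x \<in> S \<Longrightarrow> u x \<noteq> 0"
  shows "C_k_on k S u \<Longrightarrow> C_k_on k S (\<lambda>x. inverse (u x))"
proof (induction k)
  case 0 then show ?case using assms by (auto intro!: continuous_on_inverse)
next
  case (Suc k)
  have i: "C_k_on k S (\<lambda>x. inverse (u x))" using Suc C_k_on_Suc_imp by blast
  show ?case
  proof (rule C_k_on_Suc_derivI[OF assms(1)])
    show "((\<lambda>x. inverse (u x)) has_derivative
       (\<lambda>v. - (inverse (u x) * frechet_derivative u (at x) v * inverse (u x)))) (at x)" if "x \<in> S" for x
      by (rule Deriv.has_derivative_inverse[where f=u, OF assms(2)[OF that] has_derivative_partial[OF Suc.prems that]])
    show "C_k_on k S (\<lambda>x. - (inverse (u x) * frechet_derivative u (at x) i * inverse (u x)))" if "i \<in> Basis" for i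
      unfolding partial_deriv_def[symmetric]
      by (intro C_k_on_uminus C_k_on_mult assms i C_k_on_SucD(2)[OF Suc.prems that])
  qed
qed

lemma C_k_on_divide:
  assumes "open S" "\<And>x. x \<in> S \<Longrightarrow> v x \<noteq> 0" "C_k_on k S u" "C_k_on k S v"
  shows "C_k_on k S (\<lambda>x. u x / v x)"
  using C_k_on_mult[OF assms(1,3) C_k_on_inverse[OF assms(1,2,4)]] by (simp add: divide_inverse)

lemma C_k_on_sqrt:
  assumes "open S" "\<And>x. x \<in> S \<Longrightarrow> u x > 0"
  shows "C_k_on k S u \<Longrightarrow> C_k_on k S (\<lambda>x. sqrt (u x))"
proof (induction k)
  case 0 then show ?case using assms by (auto intro!: continuous_on_real_sqrt)
next
  case (Suc k)
  have "C_k_on k S (\<lambda>x. sqrt (u x))" using Suc C_k_on_Suc_imp by blast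
  moreover have "\<And>x. x \<in> S \<Longrightarrow> sqrt (u x) \<noteq> 0" using assms(2) by force
  ultimately have i: "C_k_on k S (\<lambda>x. inverse (sqrt (u x)))"
    by (intro C_k_on_inverse assms) auto
  show ?case
  proof (rule C_k_on_Suc_derivI[OF assms(1)])
    show "((\<lambda>x. sqrt (u x)) has_derivative
       (\<lambda>v. frechet_derivative u (at x) v * (inverse (sqrt (u x)) * (1/2)))) (at x)" if "x \<in> S" for x
      using assms(2)[OF that] has_derivative_partial[OF Suc.prems that]
      by (auto intro!: derivative_eq_intros simp: field_simps)
    show "C_k_on k S (\<lambda>x. frechet_derivative u (at x) i * (inverse (sqrt (u x)) * (1/2)))" if "i \<in> Basis" for i
      unfolding partial_deriv_def[symmetric]
      by (intro C_k_on_mult assms i C_k_on_const C_k_on_SucD(2)[OF Suc.prems that])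
  qed
qed

text \<open>Order one only: the outer functions will be radial weights built from \<open>V\<close>
  and \<open>f\<close>, for which in general no more than a continuous derivative is
  available.\<close>

lemma C_1_on_compose:
  assumes "open S" "C_k_on (Suc 0) S u" "\<And>x. x \<in> S \<Longrightarrow> u x \<in> T" "open T"
    "\<And>t. t \<in> T \<Longrightarrow> (g has_real_derivative g' t) (at t)" "continuous_on T g'"
  shows "C_k_on (Suc 0) S (\<lambda>x. g (u x))"
proof (rule C_k_on_Suc_derivI[OF assms(1)])
  show "((\<lambda>x. g (u x)) has_derivative (\<lambda>v. frechet_derivative u (at x) v * g' (u x))) (at x)"
    if "x \<in> S" for x
    using has_derivative_partial[OF assms(2) that] assms(3)[OF that] assms(5)
    by (auto intro: DERIV_compose_FDERIV)
  have "continuous_on S (\<lambda>x. g' (u x))"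
    by (rule continuous_on_compose2[OF assms(6) C_k_on_continuous[OF assms(2)]]) (use assms(3) in auto)
  moreover have "continuous_on S (partial_deriv i u)" if "i \<in> Basis" for i
    using assms(2) that by auto
  ultimately show "C_k_on 0 S (\<lambda>x. frechet_derivative u (at x) i * g' (u x))" if "i \<in> Basis" for i
    using that by (auto simp: partial_deriv_def[symmetric] intro: continuous_on_mult)
qed

subsection \<open>Symmetry of second derivatives\<close>

lemma line_has_derivative:
  fixes u :: "'a::euclidean_space \<Rightarrow> real"
  assumes "u differentiable (at (x + t *\<^sub>R i))"
  shows "((\<lambda>t. u (x + t *\<^sub>R i)) has_real_derivative partial_deriv i u (x + t *\<^sub>R i)) (at t)"
proof -
  have "((\<lambda>t. x + t *\<^sub>R i) has_derivative (\<lambda>h. h *\<^sub>R i)) (at t)"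
    by (auto intro!: derivative_eq_intros)
  from has_derivative_compose[OF this frechet_derivative_works[THEN iffD1, OF assms]]
  have "((\<lambda>t. u (x + t *\<^sub>R i)) has_derivative (\<lambda>h. frechet_derivative u (at (x + t *\<^sub>R i)) (h *\<^sub>R i))) (at t)" .
  moreover have "frechet_derivative u (at (x + t *\<^sub>R i)) (h *\<^sub>R i) = partial_deriv i u (x + t *\<^sub>R i) * h" for h
    using linear_frechet_derivative[OF assms] by (simp add: linear_scale partial_deriv_def)
  ultimately show ?thesis by (simp add: has_field_derivative_def)
qed

text \<open>The mean value theorem is applied twice: in direction \<open>i\<close> to the increment
  of \<open>u\<close> in direction \<open>j\<close>, then in direction \<open>j\<close> to the
  resulting partial derivative.\<close>

lemma second_difference_mvt:
  fixes u :: "'a::euclidean_space \<Rightarrow> real"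
  assumes u: "C_k_on (Suc (Suc 0)) (ball x e) u" and ij: "i \<in> Basis" "j \<in> Basis"
    and h: "0 < h" "2 * h < e"
  obtains \<xi> \<eta> where "0 < \<xi>" "\<xi> < h" "0 < \<eta>" "\<eta> < h"
    "u (x + h *\<^sub>R i + h *\<^sub>R j) - u (x + h *\<^sub>R i) - u (x + h *\<^sub>R j) + u x
     = h\<^sup>2 * partial_deriv j (partial_deriv i u) (x + \<xi> *\<^sub>R i + \<eta> *\<^sub>R j)"
proof -
  have inb: "x + s *\<^sub>R i + t *\<^sub>R j \<in> ball x e" if "0 \<le> s" "s \<le> h" "0 \<le> t" "t \<le> h" for s t
  proof -
    have "norm (s *\<^sub>R i + t *\<^sub>R j) \<le> s + t"
      using norm_triangle_ineq[of "s *\<^sub>R i" "t *\<^sub>R j"] that ij by simp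
    moreover have "dist x (x + s *\<^sub>R i + t *\<^sub>R j) = norm (s *\<^sub>R i + t *\<^sub>R j)"
      by (simp add: dist_norm norm_minus_commute algebra_simps)
    ultimately show ?thesis using that h by simp
  qed
  let ?g = "\<lambda>s. u ((x + h *\<^sub>R j) + s *\<^sub>R i) - u (x + s *\<^sub>R i)"
  have d: "(?g has_real_derivative partial_deriv i u ((x + h *\<^sub>R j) + s *\<^sub>R i)
         - partial_deriv i u (x + s *\<^sub>R i)) (at s)" if "0 \<le> s" "s \<le> h" for s
  proof -
    have "(x + h *\<^sub>R j) + s *\<^sub>R i \<in> ball x e" "x + s *\<^sub>R i \<in> ball x e"
      using inb[of s h] inb[of s 0] that h by (auto simp: algebra_simps)
    then show ?thesis
      by (intro DERIV_diff line_has_derivative C_k_on_differentiable[OF u])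
  qed
  obtain \<xi> where \<xi>: "0 < \<xi>" "\<xi> < h"
    "?g h - ?g 0 = (h - 0) * (partial_deriv i u ((x + h *\<^sub>R j) + \<xi> *\<^sub>R i) - partial_deriv i u (x + \<xi> *\<^sub>R i))"
    using MVT2[of 0 h ?g, OF h(1) d] by blast
  let ?k = "\<lambda>t. partial_deriv i u ((x + \<xi> *\<^sub>R i) + t *\<^sub>R j)"
  have ui: "C_k_on (Suc 0) (ball x e) (partial_deriv i u)" using u ij by auto
  have "(?k has_real_derivative partial_deriv j (partial_deriv i u) ((x + \<xi> *\<^sub>R i) + t *\<^sub>R j)) (at t)"
    if "0 \<le> t" "t \<le> h" for t
    using that \<xi> inb[of \<xi> t] by (intro line_has_derivative C_k_on_differentiable[OF ui]) auto
  from MVT2[of 0 h ?k, OF h(1) this]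
  obtain \<eta> where \<eta>: "0 < \<eta>" "\<eta> < h"
    "?k h - ?k 0 = (h - 0) * partial_deriv j (partial_deriv i u) ((x + \<xi> *\<^sub>R i) + \<eta> *\<^sub>R j)" by blast
  have "u (x + h *\<^sub>R i + h *\<^sub>R j) - u (x + h *\<^sub>R i) - u (x + h *\<^sub>R j) + u x = ?g h - ?g 0"
    by (simp add: algebra_simps)
  also have "\<dots> = h * (?k h - ?k 0)"
    using \<xi>(3) by (simp add: algebra_simps)
  also have "\<dots> = h\<^sup>2 * partial_deriv j (partial_deriv i u) (x + \<xi> *\<^sub>R i + \<eta> *\<^sub>R j)"
    using \<eta>(3) by (simp add: power2_eq_square)
  finally show ?thesis using that[OF \<xi>(1,2) \<eta>(1,2)] by blast
qed

text \<open>The second difference is symmetric in \<open>i\<close> and \<open>j\<close>; divided by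
  the square of the step it tends to either mixed derivative, by continuity at
  \<open>x\<close>.\<close>

lemma partial_deriv_commute:
  fixes u :: "'a::euclidean_space \<Rightarrow> real"
  assumes "open S" "x \<in> S" and u: "C_k_on (Suc (Suc 0)) S u" and ij: "i \<in> Basis" "j \<in> Basis"
  shows "partial_deriv j (partial_deriv i u) x = partial_deriv i (partial_deriv j u) x"
proof -
  obtain e where e: "e > 0" "ball x e \<subseteq> S" using assms openE by blast
  have ub: "C_k_on (Suc (Suc 0)) (ball x e) u" using u e C_k_on_subset by blast
  \<comment> \<open>The factor 1/4 makes \<open>2 * h n < e\<close> hold already for n = 0.\<close>
  define h where "h n = e / 4 / real (Suc n)" for n
  have h: "0 < h n" "2 * h n < e" for n
  proof -
    have "e / 4 / real (Suc n) \<le> e / 4"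
      using e by (simp add: field_simps)
    then show "2 * h n < e" using e unfolding h_def by linarith
  qed (use e in \<open>simp add: h_def\<close>)
  have h0: "h \<longlonglongrightarrow> 0"
    unfolding h_def using LIMSEQ_Suc[OF lim_const_over_n[of "e/4"]] by simp
  have main: "\<exists>X. (\<forall>n. u (x + h n *\<^sub>R i + h n *\<^sub>R j) - u (x + h n *\<^sub>R i) - u (x + h n *\<^sub>R j) + u x
         = (h n)\<^sup>2 * X n) \<and> X \<longlonglongrightarrow> partial_deriv j (partial_deriv i u) x"
    if ij: "i \<in> Basis" "j \<in> Basis" for i j
  proof -
    have "\<forall>n. \<exists>\<xi> \<eta>. 0 < \<xi> \<and> \<xi> < h n \<and> 0 < \<eta> \<and> \<eta> < h n \<and>
      u (x + h n *\<^sub>R i + h n *\<^sub>R j) - u (x + h n *\<^sub>R i) - u (x + h n *\<^sub>R j) + u x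
      = (h n)\<^sup>2 * partial_deriv j (partial_deriv i u) (x + \<xi> *\<^sub>R i + \<eta> *\<^sub>R j)"
      using second_difference_mvt[OF ub ij h] by metis
    then obtain \<xi> \<eta> where \<xi>: "\<And>n. 0 < \<xi> n" "\<And>n. \<xi> n < h n" "\<And>n. 0 < \<eta> n" "\<And>n. \<eta> n < h n"
      "\<And>n. u (x + h n *\<^sub>R i + h n *\<^sub>R j) - u (x + h n *\<^sub>R i) - u (x + h n *\<^sub>R j) + u x
      = (h n)\<^sup>2 * partial_deriv j (partial_deriv i u) (x + \<xi> n *\<^sub>R i + \<eta> n *\<^sub>R j)"
      by metis
    have "\<xi> \<longlonglongrightarrow> 0" "\<eta> \<longlonglongrightarrow> 0"
      by (rule tendsto_sandwich[OF _ _ tendsto_const h0];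
          rule always_eventually; simp add: \<xi>(1-4) less_imp_le)+
    then have "(\<lambda>n. x + \<xi> n *\<^sub>R i + \<eta> n *\<^sub>R j) \<longlonglongrightarrow> x + 0 *\<^sub>R i + 0 *\<^sub>R j"
      by (intro tendsto_intros)
    moreover have "continuous_on S (partial_deriv j (partial_deriv i u))"
      using u ij by simp
    then have "isCont (partial_deriv j (partial_deriv i u)) x"
      using assms(1,2) continuous_on_eq_continuous_at by blast
    ultimately have "(\<lambda>n. partial_deriv j (partial_deriv i u) (x + \<xi> n *\<^sub>R i + \<eta> n *\<^sub>R j))
       \<longlonglongrightarrow> partial_deriv j (partial_deriv i u) x"
      using isCont_tendsto_compose[of x "partial_deriv j (partial_deriv i u)"] by simp
    then show ?thesis
      by (intro exI[of _ "\<lambda>n. partial_deriv j (partial_deriv i u) (x + \<xi> n *\<^sub>R i + \<eta> n *\<^sub>R j)"])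
        (simp add: \<xi>(5))
  qed
  obtain X where X: "\<And>n. u (x + h n *\<^sub>R i + h n *\<^sub>R j) - u (x + h n *\<^sub>R i) - u (x + h n *\<^sub>R j) + u x
         = (h n)\<^sup>2 * X n" "X \<longlonglongrightarrow> partial_deriv j (partial_deriv i u) x" using main[OF ij] by blast
  obtain Y where Y: "\<And>n. u (x + h n *\<^sub>R j + h n *\<^sub>R i) - u (x + h n *\<^sub>R j) - u (x + h n *\<^sub>R i) + u x
         = (h n)\<^sup>2 * Y n" "Y \<longlonglongrightarrow> partial_deriv i (partial_deriv j u) x" using main[OF ij(2,1)] by blast
  have "X n = Y n" for n
  proof -
    have "(h n)\<^sup>2 * X n = (h n)\<^sup>2 * Y n"
      using X(1)[of n] Y(1)[of n] by (simp add: algebra_simps)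
    then show ?thesis using h(1)[of n] by simp
  qed
  then have "X = Y" by (rule ext)
  then show ?thesis using X(2) Y(2) LIMSEQ_unique by blast
qed

subsection \<open>Derivatives along vector fields\<close>

text \<open>A coordinate sum instead of \<open>frechet_derivative\<close>, so that iterated
  derivatives along fields inherit \<open>C_k_on\<close> from sums and products.\<close>

definition dd :: "('a::euclidean_space \<Rightarrow> 'a) \<Rightarrow> ('a \<Rightarrow> real) \<Rightarrow> 'a \<Rightarrow> real" where
  "dd A h x = (\<Sum>i\<in>Basis. (A x \<bullet> i) * partial_deriv i h x)"

lemma dd_frechet: "h differentiable (at x) \<Longrightarrow> frechet_derivative h (at x) (A x) = dd A h x"
  by (simp add: frechet_derivative_eq_sum_partial dd_def)

lemma dd_eqI:
  assumes "(h has_derivative D) (at x)" shows "dd A h x = D (A x)"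
  using dd_frechet[OF differentiableI[OF assms], of A] unfolding frechet_derivative_at[OF assms, symmetric] by simp

lemma dd_cong:
  assumes "open S" "x \<in> S" "\<And>y. y \<in> S \<Longrightarrow> g y = h y"
  shows "dd A g x = dd A h x"
  using partial_deriv_cong[OF assms] by (simp add: dd_def)

lemma dd_const [simp]: "dd A (\<lambda>x. c) x = 0"
  using dd_eqI[OF has_derivative_const] .

lemma dd_add:
  assumes "g differentiable (at x)" "h differentiable (at x)"
  shows "dd A (\<lambda>y. g y + h y) x = dd A g x + dd A h x"
  using dd_eqI[OF has_derivative_add[OF assms[unfolded frechet_derivative_works]], of A]
  by (simp add: dd_frechet assms)

lemma dd_diff:
  assumes "g differentiable (at x)" "h differentiable (at x)"
  shows "dd A (\<lambda>y. g y - h y) x = dd A g x - dd A h x"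
  using dd_eqI[OF has_derivative_diff[OF assms[unfolded frechet_derivative_works]], of A]
  by (simp add: dd_frechet assms)

lemma dd_mult:
  assumes "g differentiable (at x)" "h differentiable (at x)"
  shows "dd A (\<lambda>y. g y * h y) x = g x * dd A h x + dd A g x * h x"
  using dd_eqI[OF has_derivative_mult[OF assms[unfolded frechet_derivative_works]], of A]
  by (simp add: dd_frechet assms)

lemma dd_sum:
  assumes "\<And>i. i \<in> I \<Longrightarrow> g i differentiable (at x)"
  shows "dd A (\<lambda>y. \<Sum>i\<in>I. g i y) x = (\<Sum>i\<in>I. dd A (g i) x)"
proof -
  have "((\<lambda>y. \<Sum>i\<in>I. g i y) has_derivative (\<lambda>v. \<Sum>i\<in>I. frechet_derivative (g i) (at x) v)) (at x)"
    by (intro has_derivative_sum) (use assms frechet_derivative_works in blast)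
  from dd_eqI[OF this, of A] show ?thesis
    using assms by (simp add: dd_frechet)
qed

lemma dd_compose:
  assumes "h differentiable (at x)" "(g has_real_derivative g') (at (h x))"
  shows "dd A (\<lambda>y. g (h y)) x = g' * dd A h x"
  using dd_eqI[OF DERIV_compose_FDERIV[OF assms(2) assms(1)[unfolded frechet_derivative_works]], of A]
  by (simp add: dd_frechet assms)

lemma dd_scaleR: "dd (\<lambda>y. c y *\<^sub>R A y) h x = c x * dd A h x"
  by (simp add: dd_def sum_distrib_left mult.assoc)

lemma partial_deriv_dd: "i \<in> Basis \<Longrightarrow> partial_deriv i h x = dd (\<lambda>_. i) h x"
  by (simp add: dd_def inner_Basis if_distrib[of "\<lambda>c. c * _"] cong: if_cong)

lemma partial_deriv_outside:
  assumes "closed K" "\<And>y. y \<notin> K \<Longrightarrow> g y = 0" "x \<notin> K"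
  shows "partial_deriv i g x = 0"
proof -
  have "partial_deriv i g x = partial_deriv i (\<lambda>_. 0) x"
    by (rule partial_deriv_cong[of "- K"]) (use assms in auto)
  then show ?thesis by (simp add: partial_deriv_def)
qed

lemma dd_outside:
  "closed K \<Longrightarrow> (\<And>y. y \<notin> K \<Longrightarrow> g y = 0) \<Longrightarrow> x \<notin> K \<Longrightarrow> dd A g x = 0"
  by (simp add: dd_def partial_deriv_outside)

lemma C_k_on_dd:
  assumes "open S" "C_k_on (Suc k) S h" "\<And>i. i \<in> Basis \<Longrightarrow> C_k_on k S (\<lambda>x. A x \<bullet> i)"
  shows "C_k_on k S (dd A h)"
  unfolding dd_def[abs_def] using assms by (auto simp del: C_k_on.simps intro!: C_k_on_sum C_k_on_mult dest: C_k_on_SucD(2))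

text \<open>The second-order parts agree by symmetry of the mixed partials; what remains are the
  coefficients of the Lie bracket of the two fields.\<close>

lemma dd_commutator:
  assumes S: "open S" "x \<in> S" and h: "C_k_on (Suc (Suc 0)) S h"
    and A: "\<And>i. i \<in> Basis \<Longrightarrow> C_k_on (Suc 0) S (\<lambda>x. A x \<bullet> i)"
    and B: "\<And>i. i \<in> Basis \<Longrightarrow> C_k_on (Suc 0) S (\<lambda>x. B x \<bullet> i)"
  shows "dd A (dd B h) x - dd B (dd A h) x =
     (\<Sum>i\<in>Basis. (dd A (\<lambda>y. B y \<bullet> i) x - dd B (\<lambda>y. A y \<bullet> i) x) * partial_deriv i h x)"
proof -
  have ph: "C_k_on (Suc 0) S (partial_deriv i h)" if "i \<in> Basis" for i
    using h that by auto
  have ex: "dd A (dd B h) x = (\<Sum>i\<in>Basis. dd A (\<lambda>y. B y \<bullet> i) x * partial_deriv i h x)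
      + (\<Sum>i\<in>Basis. \<Sum>j\<in>Basis. (B x \<bullet> i) * (A x \<bullet> j) * partial_deriv j (partial_deriv i h) x)"
    if A: "\<And>i. i \<in> Basis \<Longrightarrow> C_k_on (Suc 0) S (\<lambda>x. A x \<bullet> i)"
    and B: "\<And>i. i \<in> Basis \<Longrightarrow> C_k_on (Suc 0) S (\<lambda>x. B x \<bullet> i)" for A B
  proof -
    have "dd A (dd B h) x = (\<Sum>i\<in>Basis. dd A (\<lambda>y. (B y \<bullet> i) * partial_deriv i h y) x)"
      unfolding dd_def[of B, abs_def]
      by (rule dd_sum) (intro C_k_on_differentiable[OF C_k_on_mult[OF S(1) B ph] S(2)])
    also have "\<dots> = (\<Sum>i\<in>Basis. (B x \<bullet> i) * dd A (partial_deriv i h) x + dd A (\<lambda>y. B y \<bullet> i) x * partial_deriv i h x)"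
      by (intro sum.cong refl dd_mult C_k_on_differentiable[OF B S(2)] C_k_on_differentiable[OF ph S(2)])
    finally show ?thesis
      by (simp add: sum.distrib dd_def[of A "partial_deriv _ h"] sum_distrib_left mult.assoc)
  qed
  have "(\<Sum>i\<in>Basis. \<Sum>j\<in>Basis. (B x \<bullet> i) * (A x \<bullet> j) * partial_deriv j (partial_deriv i h) x)
     = (\<Sum>j\<in>Basis. \<Sum>i\<in>Basis. (B x \<bullet> i) * (A x \<bullet> j) * partial_deriv j (partial_deriv i h) x)"
    by (rule sum.swap)
  also have "\<dots> = (\<Sum>i\<in>Basis. \<Sum>j\<in>Basis. (A x \<bullet> i) * (B x \<bullet> j) * partial_deriv j (partial_deriv i h) x)"
    by (intro sum.cong refl) (simp add: partial_deriv_commute[OF S h])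
  finally show ?thesis
    using ex[OF A B] ex[OF B A] by (simp add: sum_subtractf left_diff_distrib)
qed

section \<open>Integrals of divergences\<close>

lemma continuous_compact_support_integrable:
  fixes X :: "'a::euclidean_space \<Rightarrow> real"
  assumes "compact K" "continuous_on K X" "\<And>x. x \<notin> K \<Longrightarrow> X x = 0"
  shows "integrable lborel X"
proof -
  have "integrable lborel (\<lambda>x. indicator K x *\<^sub>R X x)"
    by (rule borel_integrable_compact) fact+
  also have "(\<lambda>x. indicator K x *\<^sub>R X x) = X"
    using assms(3) by (auto simp: indicator_def fun_eq_iff)
  finally show ?thesis .
qed

text \<open>Translation invariance makes the integral of every difference quotient vanish; Fatou's lemma
  then only needs the derivative to be bounded on one side.\<close>

lemma integral_partial_deriv_nonneg:
  fixes X :: "'a::euclidean_space \<Rightarrow> real"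
  assumes i: "i \<in> Basis" and X: "\<And>x. X differentiable (at x)"
    and K: "compact K" "\<And>x. x \<notin> K \<Longrightarrow> X x = 0" and M: "\<And>x. partial_deriv i X x \<le> M"
  shows "integrable lborel (partial_deriv i X)" "0 \<le> (LINT x|lborel. partial_deriv i X x)"
proof -
  define D where "D = partial_deriv i X"
  define h :: "nat \<Rightarrow> real" where "h n = inverse (real (Suc n))" for n
  have h: "h n > 0" "h n \<le> 1" for n by (auto simp: h_def inverse_le_1_iff)
  have h0: "h \<longlonglongrightarrow> 0" unfolding h_def by (rule LIMSEQ_inverse_real_of_nat)
  define q where "q n x = (X (x + h n *\<^sub>R i) - X x) / h n" for n x
  have cX: "continuous_on A X" for A
    using X differentiable_imp_continuous_within continuous_at_imp_continuous_on by blast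
  have line: "((\<lambda>t. X (x + t *\<^sub>R i)) has_real_derivative D (x + t *\<^sub>R i)) (at t)" for x t
    unfolding D_def by (rule line_has_derivative[OF X])
  have q_lim: "(\<lambda>n. q n x) \<longlonglongrightarrow> D x" for x
  proof -
    have "((\<lambda>t. (X (x + t *\<^sub>R i) - X x) / t) \<longlongrightarrow> D x) (at 0)"
      using line[of x 0] by (simp add: DERIV_def)
    moreover have "filterlim h (at 0) sequentially"
      using h0 h by (auto simp: filterlim_at less_imp_neq[symmetric])
    ultimately show ?thesis
      unfolding q_def by (rule filterlim_compose)
  qed
  obtain b where b: "b > 0" "\<And>x. x \<in> K \<Longrightarrow> norm x \<le> b"
    using compact_imp_bounded[OF K(1)] bounded_pos by blast
  \<comment> \<open>The steps \<open>h n\<close> are at most 1, so a margin of 1 around the support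
    contains the supports of all difference quotients.\<close>
  define B where "B = cball (0::'a) (b + 1)"
  have out: "X x = 0" if "norm x > b" for x
    using K(2) b(2) that by force
  have qB: "q n x = 0" if "x \<notin> B" for n x
  proof -
    have "norm (x + h n *\<^sub>R i) \<ge> norm x - norm (h n *\<^sub>R i)"
      by (metis norm_diff_ineq)
    moreover have "norm (h n *\<^sub>R i) \<le> 1" using h[of n] i by simp
    moreover have "norm x > b + 1" using that by (simp add: B_def)
    ultimately have "norm (x + h n *\<^sub>R i) > b" "norm x > b" by linarith+
    then show ?thesis by (simp add: q_def out)
  qed
  have DB: "D x = 0" if "x \<notin> B" for x
    using q_lim[of x] qB[OF that] LIMSEQ_unique[OF tendsto_const] by (simp add: LIMSEQ_const_iff)
  define M' where "M' = max M 0"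
  have q_le: "q n x \<le> M'" for n x
  proof -
    obtain z where "z > 0" "z < h n" "X (x + h n *\<^sub>R i) - X (x + 0 *\<^sub>R i) = (h n - 0) * D (x + z *\<^sub>R i)"
      using MVT2[of 0 "h n" "\<lambda>t. X (x + t *\<^sub>R i)" "\<lambda>t. D (x + t *\<^sub>R i)"] h line by blast
    then have "q n x = D (x + z *\<^sub>R i)" using h[of n] by (simp add: q_def)
    also have "\<dots> \<le> M" using M by (simp add: D_def)
    finally show ?thesis by (simp add: M'_def)
  qed
  have D_le: "D x \<le> M'" for x using M by (simp add: D_def M'_def le_max_iff_disj)
  have [measurable]: "X \<in> borel_measurable borel"
    using cX borel_measurable_continuous_onI by blast
  have [measurable]: "q n \<in> borel_measurable borel" for n
    unfolding q_def by measurable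
  have [measurable]: "D \<in> borel_measurable borel"
    by (rule borel_measurable_LIMSEQ_real[OF q_lim]) auto
  have iX: "integrable lborel X"
    by (rule continuous_compact_support_integrable[OF K(1) cX K(2)])
  have [simp]: "distr lborel borel (\<lambda>x. x + c) = (lborel :: 'a measure)" for c
    using lborel_distr_plus[of c] by (simp add: add.commute[of _ c])
  have iXh: "integrable lborel (\<lambda>x. X (x + c))" "(LINT x|lborel. X (x + c)) = (LINT x|lborel. X x)" for c
    using integrable_distr_eq[of "\<lambda>x. x + c" lborel borel X] integral_distr[of "\<lambda>x. x + c" lborel borel X] iX
    by simp_all
  have iq: "integrable lborel (q n)" "(LINT x|lborel. q n x) = 0" for n
    unfolding q_def using iX iXh by auto
  \<comment> \<open>An integrable majorant of every \<open>q n\<close> and of \<open>D\<close>: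
    \<open>M'\<close> is nonnegative and both functions vanish off \<open>B\<close>. Fatou is
    applied to the nonnegative differences.\<close>
  define \<phi> where "\<phi> = (\<lambda>x::'a. M' * indicator B x)"
  have i\<phi>: "integrable lborel \<phi>"
    unfolding \<phi>_def B_def by (intro integrable_mult_right integrable_real_indicator emeasure_lborel_cball_finite) auto
  then have [measurable]: "\<phi> \<in> borel_measurable borel"
    using borel_measurable_integrable by fastforce
  have pos: "0 \<le> \<phi> x - q n x" "0 \<le> \<phi> x - D x" for n x
    using q_le[of n x] D_le[of x] qB[of x n] DB[of x] by (auto simp: \<phi>_def indicator_def)
  have nnq: "(\<integral>\<^sup>+x. ennreal (\<phi> x - q n x) \<partial>lborel) = ennreal (LINT x|lborel. \<phi> x)" for n
    using pos iq[of n] i\<phi> by (subst nn_integral_eq_integral) auto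
  have "(\<integral>\<^sup>+x. ennreal (\<phi> x - D x) \<partial>lborel) = (\<integral>\<^sup>+x. liminf (\<lambda>n. ennreal (\<phi> x - q n x)) \<partial>lborel)"
  proof (intro nn_integral_cong)
    fix x
    have "(\<lambda>n. ennreal (\<phi> x - q n x)) \<longlonglongrightarrow> ennreal (\<phi> x - D x)"
      by (intro tendsto_intros q_lim)
    then show "ennreal (\<phi> x - D x) = liminf (\<lambda>n. ennreal (\<phi> x - q n x))"
      by (simp add: lim_imp_Liminf)
  qed
  also have "\<dots> \<le> liminf (\<lambda>n. \<integral>\<^sup>+x. ennreal (\<phi> x - q n x) \<partial>lborel)"
    by (rule nn_integral_liminf) measurable
  also have "\<dots> = ennreal (LINT x|lborel. \<phi> x)"
    unfolding nnq by (simp add: Liminf_const)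
  finally have le: "(\<integral>\<^sup>+x. ennreal (\<phi> x - D x) \<partial>lborel) \<le> ennreal (LINT x|lborel. \<phi> x)" .
  have i1: "integrable lborel (\<lambda>x. \<phi> x - D x)"
  proof (rule integrableI_nonneg)
    show "(\<integral>\<^sup>+x. ennreal (\<phi> x - D x) \<partial>lborel) < \<infinity>"
      using le by (rule le_less_trans) simp
  qed (use pos in auto)
  \<comment> \<open>Integrability of the derivative is a result, not an assumption: it comes from
    the finite bound that Fatou gives for the integral of \<open>\<phi> x - D x\<close>.\<close>
  have "integrable lborel (\<lambda>x. \<phi> x - (\<phi> x - D x))"
    by (rule Bochner_Integration.integrable_diff[OF i\<phi> i1])
  then have iD: "integrable lborel D" by simp
  then show "integrable lborel (partial_deriv i X)" by (simp add: D_def)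
  have "ennreal (LINT x|lborel. \<phi> x - D x) \<le> ennreal (LINT x|lborel. \<phi> x)"
    using le pos i1 by (subst (asm) nn_integral_eq_integral) auto
  moreover have "0 \<le> (LINT x|lborel. \<phi> x)"
    by (intro integral_nonneg_AE AE_I2) (auto simp: \<phi>_def M'_def)
  ultimately have "(LINT x|lborel. \<phi> x - D x) \<le> (LINT x|lborel. \<phi> x)"
    by simp
  then show "0 \<le> (LINT x|lborel. partial_deriv i X x)"
    using i\<phi> iD by (simp add: D_def)
qed

lemma continuous_bounded_above:
  fixes g :: "'b \<Rightarrow> 'a::topological_space \<Rightarrow> real"
  assumes "compact K" "finite I" "\<And>i. i \<in> I \<Longrightarrow> continuous_on K (g i)"
  shows "\<exists>M. \<forall>i\<in>I. \<forall>x\<in>K. g i x \<le> M"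
proof -
  have "\<forall>i\<in>I. \<exists>M. \<forall>x\<in>K. g i x \<le> M"
  proof
    fix i assume "i \<in> I"
    then have "bounded (g i ` K)"
      using assms compact_continuous_image compact_imp_bounded by blast
    then show "\<exists>M. \<forall>x\<in>K. g i x \<le> M"
      unfolding bounded_iff by (metis abs_le_D1 imageI real_norm_def)
  qed
  then obtain M where M: "\<And>i x. i \<in> I \<Longrightarrow> x \<in> K \<Longrightarrow> g i x \<le> M i" by metis
  show ?thesis
  proof (intro exI ballI)
    fix i x assume "i \<in> I" "x \<in> K"
    then have "g i x \<le> M i" by (rule M)
    also have "M i \<le> (\<Sum>i\<in>I. \<bar>M i\<bar>)"
      using member_le_sum[of i I "\<lambda>i. \<bar>M i\<bar>"] \<open>i \<in> I\<close> assms(2) by auto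
    finally show "g i x \<le> (\<Sum>i\<in>I. \<bar>M i\<bar>)" .
  qed
qed

text \<open>The components vanish off \<open>K\<close>, hence are differentiable on the whole space
  with derivative zero there, although regularity is given on \<open>U\<close> only.\<close>

lemma integral_divergence_nonneg:
  fixes Z :: "'a::euclidean_space \<Rightarrow> 'a \<Rightarrow> real"
  assumes U: "open U" "K \<subseteq> U" "compact K"
    and Z: "\<And>i x. i \<in> Basis \<Longrightarrow> x \<in> U \<Longrightarrow> Z i differentiable (at x)"
    and Z0: "\<And>i x. i \<in> Basis \<Longrightarrow> x \<notin> K \<Longrightarrow> Z i x = 0"
    and M: "\<And>i x. i \<in> Basis \<Longrightarrow> x \<in> K \<Longrightarrow> partial_deriv i (Z i) x \<le> M"
  shows "integrable lborel (\<lambda>x. \<Sum>i\<in>Basis. partial_deriv i (Z i) x)"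
    "0 \<le> (LINT x|lborel. (\<Sum>i\<in>Basis. partial_deriv i (Z i) x))"
proof -
  have cl: "open (- K)" using U(3) by (simp add: compact_imp_closed open_Compl)
  have d: "Z i differentiable (at x)" if "i \<in> Basis" for i x
  proof (cases "x \<in> K")
    case True then show ?thesis using Z U that by blast
  next
    case False
    show ?thesis
      by (rule differentiable_cong_open[OF cl, of x "\<lambda>_. 0"]) (use False Z0 that in auto)
  qed
  have le: "partial_deriv i (Z i) x \<le> max M 0" if "i \<in> Basis" for i x
  proof (cases "x \<in> K")
    case True then show ?thesis using M that by (simp add: le_max_iff_disj)
  next
    case False
    have "partial_deriv i (Z i) x = partial_deriv i (\<lambda>_. 0) x"
      by (rule partial_deriv_cong[OF cl]) (use False Z0 that in auto)
    also have "\<dots> = 0" by (simp add: partial_deriv_def)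
    finally show ?thesis by simp
  qed
  note * = integral_partial_deriv_nonneg[OF _ d U(3) Z0 le]
  show "integrable lborel (\<lambda>x. \<Sum>i\<in>Basis. partial_deriv i (Z i) x)"
    by (intro Bochner_Integration.integrable_sum *(1)) auto
  have "(LINT x|lborel. (\<Sum>i\<in>Basis. partial_deriv i (Z i) x)) = (\<Sum>i\<in>Basis. (LINT x|lborel. partial_deriv i (Z i) x))"
    by (intro Bochner_Integration.integral_sum *(1)) auto
  also have "\<dots> \<ge> 0" by (intro sum_nonneg *(2)) auto
  finally show "0 \<le> (LINT x|lborel. (\<Sum>i\<in>Basis. partial_deriv i (Z i) x))" .
qed

section \<open>Hyperboloid coordinates on the ball\<close>

lemma hyp_space_iff: "x \<in> hyp_space \<longleftrightarrow> norm x < 1"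
  by (simp add: hyp_space_def)

lemma open_hyp_space: "open hyp_space"
  by (simp add: hyp_space_def)

lemma hyp_space_norm_sq: "x \<in> hyp_space \<Longrightarrow> x \<bullet> x < 1"
  by (simp add: hyp_space_iff norm_lt_square)

lemma hyp_factor_inner: "hyp_factor x = 2 / (1 - x \<bullet> x)"
  by (simp add: hyp_factor_def power2_norm_eq_inner)

lemma hyp_factor_ge: "x \<in> hyp_space \<Longrightarrow> hyp_factor x \<ge> 2"
  using hyp_space_norm_sq[of x] inner_ge_zero[of x] by (simp add: hyp_factor_inner field_simps)

lemma hyp_factor_pos: "x \<in> hyp_space \<Longrightarrow> hyp_factor x > 0"
  using hyp_factor_ge[of x] by simp

lemma hyp_factor_mult_sq: "x \<in> hyp_space \<Longrightarrow> hyp_factor x * (x \<bullet> x) = hyp_factor x - 2"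
  using hyp_space_norm_sq[of x] by (simp add: hyp_factor_inner field_simps)

lemma hyp_factor_has_derivative:
  assumes "x \<in> hyp_space"
  shows "(hyp_factor has_derivative (\<lambda>v. (hyp_factor x)\<^sup>2 * (x \<bullet> v))) (at x)"
proof -
  have "((\<lambda>x. 2 / (1 - x \<bullet> x)) has_derivative (\<lambda>v. (2 / (1 - x \<bullet> x))\<^sup>2 * (x \<bullet> v))) (at x)"
    using hyp_space_norm_sq[OF assms]
    by (auto intro!: derivative_eq_intros simp: inner_commute field_simps power2_eq_square)
  then show ?thesis by (simp add: hyp_factor_inner[abs_def])
qed

lemma C_k_on_hyp_factor: "C_k_on k hyp_space hyp_factor"
  unfolding hyp_factor_inner[abs_def]
proof (rule C_k_on_divide[OF open_hyp_space])
  have "C_k_on k hyp_space (\<lambda>x::'a. 1 - (\<Sum>b\<in>Basis. (x \<bullet> b) * (x \<bullet> b)))"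
    by (intro C_k_on_diff C_k_on_const C_k_on_sum C_k_on_mult C_k_on_inner open_hyp_space)
  then show "C_k_on k hyp_space (\<lambda>x::'a. 1 - x \<bullet> x)"
    by (simp add: euclidean_inner[symmetric])
qed (use hyp_space_norm_sq in force)+

text \<open>The hyperboloid model is \<open>x \<mapsto> (T, Y) = (\<rho> - 1, \<rho> x)\<close>; these are the restrictions to it of the
  linear functions \<open>Y \<bullet> p - T q\<close> of Minkowski space.\<close>

definition lorentz_coord :: "'a::euclidean_space \<Rightarrow> real \<Rightarrow> 'a \<Rightarrow> real" where
  "lorentz_coord p q x = hyp_factor x * (x \<bullet> p) - (hyp_factor x - 1) * q"

text \<open>The Euclidean gradient of \<open>lorentz_coord p q\<close>, from d rho = rho^2 (x . dx);
  the Riemannian gradient is this vector divided by rho^2.\<close>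

definition lorentz_grad :: "'a::euclidean_space \<Rightarrow> real \<Rightarrow> 'a \<Rightarrow> 'a" where
  "lorentz_grad p q x = hyp_factor x *\<^sub>R (p + (hyp_factor x * (x \<bullet> p - q)) *\<^sub>R x)"

lemma lorentz_coord_has_derivative:
  assumes "x \<in> hyp_space"
  shows "(lorentz_coord p q has_derivative (\<lambda>v. lorentz_grad p q x \<bullet> v)) (at x)"
proof -
  have "(lorentz_coord p q has_derivative
     (\<lambda>v. (hyp_factor x * (v \<bullet> p) + (hyp_factor x)\<^sup>2 * (x \<bullet> v) * (x \<bullet> p)) - (hyp_factor x)\<^sup>2 * (x \<bullet> v) * q)) (at x)"
    unfolding lorentz_coord_def[abs_def]
    by (auto intro!: derivative_eq_intros hyp_factor_has_derivative[OF assms])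
  also have "(\<lambda>v. (hyp_factor x * (v \<bullet> p) + (hyp_factor x)\<^sup>2 * (x \<bullet> v) * (x \<bullet> p)) - (hyp_factor x)\<^sup>2 * (x \<bullet> v) * q)
     = (\<lambda>v. lorentz_grad p q x \<bullet> v)"
    by (simp add: fun_eq_iff lorentz_grad_def inner_simps power2_eq_square algebra_simps inner_commute)
  finally show ?thesis .
qed

lemma partial_deriv_lorentz_coord:
  "x \<in> hyp_space \<Longrightarrow> partial_deriv i (lorentz_coord p q) x = lorentz_grad p q x \<bullet> i"
  by (rule partial_deriv_eqI[OF lorentz_coord_has_derivative])

lemma C_k_on_lorentz_coord: "C_k_on k hyp_space (lorentz_coord p q)"
  unfolding lorentz_coord_def[abs_def]
  by (intro C_k_on_diff C_k_on_mult C_k_on_inner C_k_on_const C_k_on_hyp_factor open_hyp_space)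

text \<open>The Riemannian gradient of a linear function on the hyperboloid is the tangential part
  of a Minkowski vector. The normal is timelike with square -1, so removing the normal parts adds
  the product of the two coordinates.\<close>

lemma lorentz_grad_inner:
  assumes "x \<in> hyp_space"
  shows "lorentz_grad p q x \<bullet> lorentz_grad p' q' x
     = (hyp_factor x)\<^sup>2 * (p \<bullet> p' - q * q' + lorentz_coord p q x * lorentz_coord p' q' x)"
proof -
  define \<rho> where "\<rho> = hyp_factor x"
  define A where "A = x \<bullet> p"
  define B where "B = x \<bullet> p'"
  have n: "\<rho> * (x \<bullet> x) = \<rho> - 2" unfolding \<rho>_def by (rule hyp_factor_mult_sq[OF assms])
  have "(p + (\<rho> * (A - q)) *\<^sub>R x) \<bullet> (p' + (\<rho> * (B - q')) *\<^sub>R x)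
     = p \<bullet> p' + \<rho> * (B - q') * A + \<rho> * (A - q) * B + \<rho> * (A - q) * (B - q') * (\<rho> * (x \<bullet> x))"
    by (simp add: inner_simps A_def B_def inner_commute algebra_simps)
  also have "\<dots> = p \<bullet> p' - q * q' + (\<rho> * A - (\<rho> - 1) * q) * (\<rho> * B - (\<rho> - 1) * q')"
    unfolding n by (simp add: algebra_simps)
  finally show ?thesis
    unfolding lorentz_grad_def lorentz_coord_def
    by (simp add: \<rho>_def A_def B_def power2_eq_square)
qed

text \<open>The Riemannian product of two gradients. It is symmetric and at the same time the
  derivative of \<open>h\<close> along \<open>hyp_grad g\<close>; the frame computations rest on
  this double reading.\<close>

definition hyp_gg :: "('a::euclidean_space \<Rightarrow> real) \<Rightarrow> ('a \<Rightarrow> real) \<Rightarrow> 'a \<Rightarrow> real" where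
  "hyp_gg g h x = (\<Sum>i\<in>Basis. partial_deriv i g x * partial_deriv i h x) / (hyp_factor x)\<^sup>2"

lemma hyp_grad_inner_Basis: "i \<in> Basis \<Longrightarrow> hyp_grad u x \<bullet> i = partial_deriv i u x / (hyp_factor x)\<^sup>2"
  unfolding hyp_grad_def by (subst inner_sum_left_Basis) auto

lemma hyp_inner_grad:
  "x \<in> hyp_space \<Longrightarrow> hyp_inner x (hyp_grad g x) (hyp_grad h x) = hyp_gg g h x"
  using hyp_factor_pos[of x]
  by (simp add: hyp_inner_def euclidean_inner[of "hyp_grad g x" "hyp_grad h x"] hyp_grad_inner_Basis hyp_gg_def
      sum_divide_distrib sum_distrib_left power2_eq_square)

lemma dd_hyp_grad: "dd (hyp_grad g) h x = hyp_gg g h x"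
  by (simp add: dd_def hyp_grad_inner_Basis hyp_gg_def sum_divide_distrib)

lemma hyp_gg_sym: "hyp_gg g h x = hyp_gg h g x"
  by (simp add: hyp_gg_def mult.commute)

lemma hyp_gg_lorentz:
  assumes "x \<in> hyp_space"
  shows "hyp_gg (lorentz_coord p q) (lorentz_coord p' q') x
    = p \<bullet> p' - q * q' + lorentz_coord p q x * lorentz_coord p' q' x"
  using hyp_factor_pos[OF assms] lorentz_grad_inner[OF assms, of p q p' q']
  by (simp add: hyp_gg_def partial_deriv_lorentz_coord[OF assms] euclidean_inner[symmetric])

text \<open>The weight under the divergence is rho^N / rho^2 = rho^(N-2); differentiating it with d
  rho = rho^2 (x . dx) yields the first-order term.\<close>

lemma hyp_laplacian_eq:
  fixes u :: "'a::euclidean_space \<Rightarrow> real"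
  assumes "x \<in> hyp_space" and u: "\<And>i. i \<in> Basis \<Longrightarrow> partial_deriv i u differentiable (at x)"
  shows "hyp_laplacian u x = (\<Sum>i\<in>Basis. partial_deriv i (partial_deriv i u) x) / (hyp_factor x)\<^sup>2
      + (real DIM('a) - 2) * (\<Sum>i\<in>Basis. (x \<bullet> i) * partial_deriv i u x) / hyp_factor x"
proof -
  let ?N = "DIM('a)"
  define \<rho> where "\<rho> = hyp_factor x"
  have \<rho>: "\<rho> > 0" using hyp_factor_pos[OF assms(1)] by (simp add: \<rho>_def)
  have p: "partial_deriv i (\<lambda>y. hyp_factor y ^ ?N * (hyp_grad u y \<bullet> i)) x
     = \<rho> ^ ?N / \<rho>\<^sup>2 * partial_deriv i (partial_deriv i u) x
       + (real ?N - 2) * \<rho> ^ ?N / \<rho> * (x \<bullet> i) * partial_deriv i u x"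
    if i: "i \<in> Basis" for i
  proof -
    have "((\<lambda>y. hyp_factor y ^ ?N * (partial_deriv i u y / (hyp_factor y)\<^sup>2)) has_derivative
       (\<lambda>v. \<rho> ^ ?N / \<rho>\<^sup>2 * frechet_derivative (partial_deriv i u) (at x) v
       + (real ?N - 2) * \<rho> ^ ?N / \<rho> * (x \<bullet> v) * partial_deriv i u x)) (at x)"
      using \<rho> unfolding \<rho>_def
      apply (auto intro!: derivative_eq_intros hyp_factor_has_derivative[OF assms(1)]
          u[OF i, unfolded frechet_derivative_works])
      apply (rule ext)
      \<comment> \<open>The power rule leaves truncated exponents such as N - 1, which are resolved
        by writing N as a successor.\<close>
      apply (cases ?N)
      by (auto simp: field_simps power2_eq_square power4_eq_xxxx)
    from partial_deriv_eqI[OF this] show ?thesis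
      by (simp add: hyp_grad_inner_Basis[OF i] partial_deriv_def[of i "partial_deriv i u"])
  qed
  have "hyp_laplacian u x = (\<Sum>i\<in>Basis. \<rho> ^ ?N / \<rho>\<^sup>2 * partial_deriv i (partial_deriv i u) x
       + (real ?N - 2) * \<rho> ^ ?N / \<rho> * (x \<bullet> i) * partial_deriv i u x) / \<rho> ^ ?N"
    unfolding hyp_laplacian_def hyp_div_def by (simp add: p \<rho>_def)
  also have "\<dots> = (\<Sum>i\<in>Basis. \<rho> ^ ?N * (partial_deriv i (partial_deriv i u) x / \<rho>\<^sup>2
       + (real ?N - 2) * ((x \<bullet> i) * partial_deriv i u x) / \<rho>)) / \<rho> ^ ?N"
    by (simp add: algebra_simps)
  also have "\<dots> = (\<Sum>i\<in>Basis. (partial_deriv i (partial_deriv i u) x / \<rho>\<^sup>2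
       + (real ?N - 2) * ((x \<bullet> i) * partial_deriv i u x) / \<rho>))"
    using \<rho> by (simp add: sum_distrib_left[symmetric])
  finally show ?thesis
    by (simp add: sum.distrib sum_divide_distrib sum_distrib_left \<rho>_def)
qed

text \<open>Linear functions on Minkowski space restrict to eigenfunctions on the hyperboloid. No
  other Laplacian is computed in ball coordinates; those of \<open>r\<close> and of the angles
  follow from this one by product rules.\<close>

lemma hyp_laplacian_lorentz:
  fixes x :: "'a::euclidean_space"
  assumes "x \<in> hyp_space"
  shows "hyp_laplacian (lorentz_coord p q) x = real DIM('a) * lorentz_coord p q x"
proof -
  define \<rho> where "\<rho> = hyp_factor x"
  define A where "A = x \<bullet> p"
  have \<rho>: "\<rho> > 0" using hyp_factor_pos[OF assms(1)] by (simp add: \<rho>_def)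
  have n: "\<rho> * (x \<bullet> x) = \<rho> - 2" unfolding \<rho>_def by (rule hyp_factor_mult_sq[OF assms])
  have d: "partial_deriv i (lorentz_coord p q) differentiable (at x)" if "i \<in> Basis" for i
    using C_k_on_SucD(2)[OF C_k_on_lorentz_coord[of "Suc (Suc 0)"] that] assms by simp
  have pp: "partial_deriv i (partial_deriv i (lorentz_coord p q)) x
     = \<rho>\<^sup>2 * (x \<bullet> i) * (i \<bullet> p) + 2 * \<rho> ^ 3 * (x \<bullet> i)\<^sup>2 * (A - q) + \<rho>\<^sup>2 * (i \<bullet> p) * (x \<bullet> i)
       + \<rho>\<^sup>2 * (A - q)"
    if i: "i \<in> Basis" for i
  proof -
    have "partial_deriv i (partial_deriv i (lorentz_coord p q)) x
       = partial_deriv i (\<lambda>y. hyp_factor y * (p \<bullet> i) + (hyp_factor y)\<^sup>2 * (y \<bullet> p - q) * (y \<bullet> i)) x"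
      by (rule partial_deriv_cong[OF open_hyp_space assms])
        (simp add: partial_deriv_lorentz_coord lorentz_grad_def inner_simps power2_eq_square algebra_simps)
    also have "\<dots> = \<rho>\<^sup>2 * (x \<bullet> i) * (i \<bullet> p) + 2 * \<rho> ^ 3 * (x \<bullet> i) * (x \<bullet> i) * (A - q)
       + \<rho>\<^sup>2 * (i \<bullet> p) * (x \<bullet> i) + \<rho>\<^sup>2 * (A - q) * (i \<bullet> i)"
    proof -
      have "((\<lambda>y. hyp_factor y * (p \<bullet> i) + (hyp_factor y)\<^sup>2 * (y \<bullet> p - q) * (y \<bullet> i)) has_derivative
        (\<lambda>v. \<rho>\<^sup>2 * (x \<bullet> v) * (i \<bullet> p) + 2 * \<rho> ^ 3 * (x \<bullet> v) * (x \<bullet> i) * (A - q)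
       + \<rho>\<^sup>2 * (v \<bullet> p) * (x \<bullet> i) + \<rho>\<^sup>2 * (A - q) * (v \<bullet> i))) (at x)"
        unfolding \<rho>_def A_def
        by (auto intro!: derivative_eq_intros hyp_factor_has_derivative[OF assms]
          simp: fun_eq_iff inner_commute power2_eq_square power3_eq_cube algebra_simps)
      from partial_deriv_eqI[OF this] show ?thesis .
    qed
    finally show ?thesis using i by (simp add: power2_eq_square)
  qed
  have s1: "(\<Sum>i\<in>Basis. (x \<bullet> i) * (i \<bullet> p)) = A"
    unfolding A_def euclidean_inner[of x p] by (simp add: inner_commute)
  have s2: "(\<Sum>i\<in>Basis. (x \<bullet> i)\<^sup>2) = x \<bullet> x"
    by (simp add: euclidean_inner[of x x] power2_eq_square)
  have "(\<Sum>i\<in>Basis. partial_deriv i (partial_deriv i (lorentz_coord p q)) x)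
     = 2 * \<rho>\<^sup>2 * (\<Sum>i\<in>Basis. (x \<bullet> i) * (i \<bullet> p)) + 2 * \<rho> ^ 3 * (A - q) * (\<Sum>i\<in>Basis. (x \<bullet> i)\<^sup>2)
       + real DIM('a) * \<rho>\<^sup>2 * (A - q)"
  proof -
    have "(\<Sum>i\<in>Basis. partial_deriv i (partial_deriv i (lorentz_coord p q)) x)
     = (\<Sum>i\<in>Basis. 2 * \<rho>\<^sup>2 * ((x \<bullet> i) * (i \<bullet> p)) + 2 * \<rho> ^ 3 * (A - q) * (x \<bullet> i)\<^sup>2 + \<rho>\<^sup>2 * (A - q))"
      by (intro sum.cong refl) (simp add: pp algebra_simps)
    then show ?thesis by (simp add: sum.distrib sum_distrib_left[symmetric])
  qed
  also have "\<dots> = 2 * \<rho>\<^sup>2 * A + 2 * \<rho>\<^sup>2 * (A - q) * (\<rho> * (x \<bullet> x)) + real DIM('a) * \<rho>\<^sup>2 * (A - q)"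
    unfolding s1 s2 by (simp add: power2_eq_square power3_eq_cube)
  finally have L1: "(\<Sum>i\<in>Basis. partial_deriv i (partial_deriv i (lorentz_coord p q)) x)
      = \<rho>\<^sup>2 * (2 * A + 2 * (A - q) * (\<rho> - 2) + real DIM('a) * (A - q))"
    unfolding n by (simp add: algebra_simps)
  have "(\<Sum>i\<in>Basis. (x \<bullet> i) * partial_deriv i (lorentz_coord p q) x) = lorentz_grad p q x \<bullet> x"
    by (simp add: partial_deriv_lorentz_coord[OF assms] euclidean_inner[of _ x] mult.commute)
  also have "\<dots> = \<rho> * (A + (A - q) * (\<rho> * (x \<bullet> x)))"
    by (simp add: lorentz_grad_def inner_simps \<rho>_def A_def inner_commute algebra_simps)
  finally have L2: "(\<Sum>i\<in>Basis. (x \<bullet> i) * partial_deriv i (lorentz_coord p q) x) = \<rho> * (A + (A - q) * (\<rho> - 2))"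
    unfolding n .
  have "hyp_laplacian (lorentz_coord p q) x
     = \<rho>\<^sup>2 * (2 * A + 2 * (A - q) * (\<rho> - 2) + real DIM('a) * (A - q)) / \<rho>\<^sup>2
       + (real DIM('a) - 2) * (\<rho> * (A + (A - q) * (\<rho> - 2))) / \<rho>"
    using hyp_laplacian_eq[OF assms, of "lorentz_coord p q", OF d] unfolding L1 L2 \<rho>_def by simp
  also have "\<dots> = (2 * A + 2 * (A - q) * (\<rho> - 2) + real DIM('a) * (A - q))
       + (real DIM('a) - 2) * (A + (A - q) * (\<rho> - 2))"
    using \<rho> by simp
  also have "\<dots> = real DIM('a) * lorentz_coord p q x"
    by (simp add: lorentz_coord_def \<rho>_def[symmetric] A_def[symmetric] algebra_simps)
  finally show ?thesis .
qed

section \<open>The geodesic distance\<close>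

text \<open>Minus the Minkowski product with the pole, that is, cosh of the distance to
  \<open>x0\<close>.\<close>

definition hyp_cosh :: "'a::euclidean_space \<Rightarrow> 'a \<Rightarrow> real" where
  "hyp_cosh x0 = lorentz_coord (- (hyp_factor x0 *\<^sub>R x0)) (1 - hyp_factor x0)"

text \<open>The classical formula for cosh of the distance in the ball; it makes visible that the
  value is at least 1, with equality only at the pole.\<close>

lemma hyp_cosh_eq:
  assumes "x0 \<in> hyp_space" "x \<in> hyp_space"
  shows "hyp_cosh x0 x = 1 + hyp_factor x * hyp_factor x0 * ((x - x0) \<bullet> (x - x0)) / 2"
proof -
  have "hyp_factor x * hyp_factor x0 * ((x - x0) \<bullet> (x - x0))
    = hyp_factor x0 * (hyp_factor x * (x \<bullet> x)) + hyp_factor x * (hyp_factor x0 * (x0 \<bullet> x0))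
      - 2 * hyp_factor x * hyp_factor x0 * (x \<bullet> x0)"
    by (simp add: inner_simps inner_commute algebra_simps)
  also have "\<dots> = hyp_factor x0 * (hyp_factor x - 2) + hyp_factor x * (hyp_factor x0 - 2)
      - 2 * hyp_factor x * hyp_factor x0 * (x \<bullet> x0)"
    unfolding hyp_factor_mult_sq[OF assms(1)] hyp_factor_mult_sq[OF assms(2)] ..
  finally have e: "hyp_factor x * hyp_factor x0 * ((x - x0) \<bullet> (x - x0))
     = hyp_factor x0 * (hyp_factor x - 2) + hyp_factor x * (hyp_factor x0 - 2)
      - 2 * hyp_factor x * hyp_factor x0 * (x \<bullet> x0)" .
  show ?thesis
    unfolding e hyp_cosh_def lorentz_coord_def by (simp add: field_simps)
qed

lemma hyp_cosh_gt_1: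
  assumes "x0 \<in> hyp_space" "x \<in> hyp_space" "x \<noteq> x0" shows "hyp_cosh x0 x > 1"
  using assms hyp_factor_pos[of x] hyp_factor_pos[of x0] by (simp add: hyp_cosh_eq)

lemma hyp_cosh_self: "x0 \<in> hyp_space \<Longrightarrow> hyp_cosh x0 x0 = 1"
  by (simp add: hyp_cosh_eq)

lemma hyp_cosh_ge_1:
  assumes "x0 \<in> hyp_space" "x \<in> hyp_space" shows "hyp_cosh x0 x \<ge> 1"
  using hyp_cosh_gt_1[OF assms] hyp_cosh_self[OF assms(1)] by (cases "x = x0") auto

lemma lorentz_norm_pole:
  assumes "x0 \<in> hyp_space"
  shows "(hyp_factor x0 *\<^sub>R x0) \<bullet> (hyp_factor x0 *\<^sub>R x0) = (hyp_factor x0 - 1)\<^sup>2 - 1"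
proof -
  have "(hyp_factor x0 *\<^sub>R x0) \<bullet> (hyp_factor x0 *\<^sub>R x0) = hyp_factor x0 * (hyp_factor x0 * (x0 \<bullet> x0))"
    by simp
  also have "\<dots> = (hyp_factor x0 - 1)\<^sup>2 - 1"
    unfolding hyp_factor_mult_sq[OF assms] by (simp add: power2_eq_square algebra_simps)
  finally show ?thesis .
qed

text \<open>Cauchy-Schwarz for the gradient of cosh r, whose length is sinh r. This is the
  infinitesimal form of r being 1-Lipschitz, kept free of a division by sinh r, which vanishes at
  the pole.\<close>

lemma hyp_cosh_deriv_le:
  assumes "x0 \<in> hyp_space" "x \<in> hyp_space"
  shows "\<bar>lorentz_grad (- (hyp_factor x0 *\<^sub>R x0)) (1 - hyp_factor x0) x \<bullet> v\<bar>
     \<le> sqrt ((hyp_cosh x0 x)\<^sup>2 - 1) * hyp_norm x v"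
proof -
  let ?g = "lorentz_grad (- (hyp_factor x0 *\<^sub>R x0)) (1 - hyp_factor x0) x"
  have "?g \<bullet> ?g = (hyp_factor x)\<^sup>2 * ((hyp_cosh x0 x)\<^sup>2 - 1)"
    unfolding lorentz_grad_inner[OF assms(2)]
    using lorentz_norm_pole[OF assms(1)] by (simp add: hyp_cosh_def power2_eq_square algebra_simps)
  then have "norm ?g = hyp_factor x * sqrt ((hyp_cosh x0 x)\<^sup>2 - 1)"
    using hyp_factor_pos[OF assms(2)] by (simp add: norm_eq_sqrt_inner real_sqrt_mult)
  moreover have "hyp_norm x v = hyp_factor x * norm v"
    using hyp_factor_pos[OF assms(2)] by (simp add: hyp_norm_def hyp_inner_def real_sqrt_mult norm_eq_sqrt_inner)
  ultimately show ?thesis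
    using Cauchy_Schwarz_ineq2[of ?g v] by (simp add: mult_ac)
qed

text \<open>Along a curve, r decreases at most as fast as arclength grows. Since arcosh is not
  differentiable at 1, the curve is cut at its first arrival at the pole; the rest has nonnegative
  length.\<close>

lemma hyp_length_ge:
  assumes x0: "x0 \<in> hyp_space" and \<gamma>: "\<gamma> C1_differentiable_on {0..1}" "\<gamma> ` {0..1} \<subseteq> hyp_space"
    and e: "\<gamma> 0 = x" "\<gamma> 1 = x0"
  shows "arcosh (hyp_cosh x0 x) \<le> hyp_length \<gamma>"
proof -
  define \<gamma>' where "\<gamma>' t = vector_derivative \<gamma> (at t)" for t
  have d: "(\<gamma> has_vector_derivative \<gamma>' t) (at t)" if "t \<in> {0..1}" for t
    using \<gamma>(1) that unfolding C1_differentiable_on_eq \<gamma>'_def by (simp add: vector_derivative_works)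
  have c': "continuous_on {0..1} \<gamma>'"
    using \<gamma>(1) unfolding C1_differentiable_on_eq \<gamma>'_def by simp
  have c: "continuous_on {0..1} \<gamma>"
    using \<gamma>(1) C1_differentiable_imp_continuous_on by blast
  have inH: "\<gamma> t \<in> hyp_space" if "t \<in> {0..1}" for t using \<gamma>(2) that by blast
  define S where "S = {t \<in> {0..1}. \<gamma> t = x0}"
  have "closed S" unfolding S_def
    by (rule continuous_closed_preimage_constant[OF c]) simp
  moreover have "bounded S" by (rule bounded_subset[of "{0..1}"]) (auto simp: S_def)
  ultimately have "compact S" by (simp add: compact_eq_bounded_closed)
  moreover have "1 \<in> S" using e by (simp add: S_def)
  \<comment> \<open>\<open>b\<close> is the first time at which the curve meets the pole.\<close>
  ultimately obtain b where b: "b \<in> S" "\<And>t. t \<in> S \<Longrightarrow> b \<le> t"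
    using compact_attains_inf[of S] by blast
  have b01: "b \<in> {0..1}" "\<gamma> b = x0" using b(1) by (auto simp: S_def)
  have ne: "\<gamma> t \<noteq> x0" if "0 \<le> t" "t < b" for t
    using b(2)[of t] that b01 by (force simp: S_def)
  have sub: "{0..b} \<subseteq> {0..1}" using b01 by auto
  define l where "l t = hyp_norm (\<gamma> t) (\<gamma>' t)" for t
  have cl: "continuous_on {0..1} l"
    unfolding l_def hyp_norm_def hyp_inner_def
    using inH by (intro continuous_intros continuous_on_compose2[OF C_k_on_continuous[OF C_k_on_hyp_factor[of 0]] c] c') auto
  define g where "g t = arcosh (hyp_cosh x0 (\<gamma> t))" for t
  define g' where "g' t = (lorentz_grad (- (hyp_factor x0 *\<^sub>R x0)) (1 - hyp_factor x0) (\<gamma> t) \<bullet> \<gamma>' t)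
       / sqrt ((hyp_cosh x0 (\<gamma> t))\<^sup>2 - 1)" for t
  have cC: "continuous_on {0..1} (\<lambda>t. hyp_cosh x0 (\<gamma> t))"
    unfolding hyp_cosh_def
    by (rule continuous_on_compose2[OF C_k_on_continuous[OF C_k_on_lorentz_coord[of 0]] c]) (use inH in auto)
  \<comment> \<open>This form of the fundamental theorem asks for derivatives in the open interval
    only; at \<open>b\<close> the function \<open>g\<close> need not be differentiable.\<close>
  have "(g' has_integral (g b - g 0)) {0..b}"
  proof (rule fundamental_theorem_of_calculus_interior)
    show "0 \<le> b" using b01 by simp
    show "continuous_on {0..b} g"
      unfolding g_def
      by (intro continuous_on_arcosh' continuous_on_subset[OF cC sub] hyp_cosh_ge_1 x0 inH) (use sub in auto)
    fix t assume t: "t \<in> {0<..<b}"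
    then have t1: "t \<in> {0..1}" using b01 by auto
    have C: "hyp_cosh x0 (\<gamma> t) > 1" using t by (intro hyp_cosh_gt_1 x0 inH t1 ne) auto
    have "((\<lambda>t. hyp_cosh x0 (\<gamma> t)) has_derivative
        (\<lambda>h. lorentz_grad (- (hyp_factor x0 *\<^sub>R x0)) (1 - hyp_factor x0) (\<gamma> t) \<bullet> (h *\<^sub>R \<gamma>' t))) (at t)"
      unfolding hyp_cosh_def
      by (rule has_derivative_compose[OF d[OF t1, unfolded has_vector_derivative_def]
            lorentz_coord_has_derivative[OF inH[OF t1]]])
    then have "((\<lambda>t. hyp_cosh x0 (\<gamma> t)) has_real_derivative
        (lorentz_grad (- (hyp_factor x0 *\<^sub>R x0)) (1 - hyp_factor x0) (\<gamma> t) \<bullet> \<gamma>' t)) (at t)"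
      by (simp add: has_field_derivative_def mult.commute[of _ "_ \<bullet> _"])
    from DERIV_chain2[OF arcosh_real_has_field_derivative[OF C] this]
    have "(g has_real_derivative g' t) (at t)" by (simp add: g_def[abs_def] g'_def)
    then show "(g has_vector_derivative g' t) (at t)"
      by (simp add: has_real_derivative_iff_has_vector_derivative)
  qed
  then have "((\<lambda>t. - g' t) has_integral (g 0 - g b)) {0..b}"
    using has_integral_neg by force
  moreover have il: "(l has_integral integral {0..b} l) {0..b}"
    using continuous_on_subset[OF cl sub] integrable_continuous_interval by blast
  moreover have "- g' t \<le> l t" if t: "t \<in> {0..b}" for t
  proof -
    have t1: "t \<in> {0..1}" using sub t by auto
    define s where "s = sqrt ((hyp_cosh x0 (\<gamma> t))\<^sup>2 - 1)"
    have "s \<ge> 0" using hyp_cosh_ge_1[OF x0 inH[OF t1]] by (simp add: s_def)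
    moreover have "l t \<ge> 0" by (simp add: l_def hyp_norm_def hyp_inner_def)
    moreover have "- (lorentz_grad (- (hyp_factor x0 *\<^sub>R x0)) (1 - hyp_factor x0) (\<gamma> t) \<bullet> \<gamma>' t) \<le> s * l t"
      using hyp_cosh_deriv_le[OF x0 inH[OF t1], of "\<gamma>' t"] by (simp add: s_def l_def)
    \<comment> \<open>At the end point \<open>b\<close> the root is zero and \<open>g' t\<close> is
      0 as a quotient by zero, so nonnegativity of \<open>l\<close> suffices there.\<close>
    ultimately show ?thesis
      unfolding g'_def s_def[symmetric] by (cases "s = 0") (auto simp: field_simps)
  qed
  ultimately have "g 0 - g b \<le> integral {0..b} l"
    by (rule has_integral_le)
  also have "\<dots> \<le> integral {0..1} l"
    by (intro integral_subset_le sub integrable_continuous_interval continuous_on_subset[OF cl sub] cl)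
      (auto simp: l_def hyp_norm_def hyp_inner_def)
  also have "\<dots> = hyp_length \<gamma>" by (simp add: hyp_length_def l_def[abs_def] \<gamma>'_def)
  finally show ?thesis using b01 e by (simp add: g_def hyp_cosh_self[OF x0])
qed

text \<open>The minimising geodesic, written down in the hyperboloid model as
  \<open>cosh \<tau> (a\<^sub>0, a) + sinh \<tau> (b\<^sub>0, b)\<close> with a unit tangent vector \<open>(b\<^sub>0, b)\<close> at the pole \<open>(a\<^sub>0, a)\<close>, and
  projected back to the ball.\<close>

lemma hyp_geodesic_exists:
  assumes x0: "x0 \<in> hyp_space" and x: "x \<in> hyp_space" and ne: "x \<noteq> x0"
  obtains \<gamma> where "\<gamma> C1_differentiable_on {0..1}" "\<gamma> ` {0..1} \<subseteq> hyp_space"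
    "\<gamma> 0 = x" "\<gamma> 1 = x0" "hyp_length \<gamma> = arcosh (hyp_cosh x0 x)"
proof -
  define C where "C = hyp_cosh x0 x"
  have C1: "C > 1" unfolding C_def by (rule hyp_cosh_gt_1[OF x0 x ne])
  define R where "R = arcosh C"
  define s where "s = sqrt (C\<^sup>2 - 1)"
  have R: "R > 0" "cosh R = C" "sinh R = s"
    using C1 by (auto simp: R_def s_def sinh_arcosh_real)
  have s: "s > 0" "s\<^sup>2 = C\<^sup>2 - 1" using C1 by (auto simp: s_def)
  define a0 where "a0 = hyp_factor x0 - 1"
  define a where "a = hyp_factor x0 *\<^sub>R x0"
  define T where "T = hyp_factor x - 1"
  define Y where "Y = hyp_factor x *\<^sub>R x"
  have a0: "a0 \<ge> 1" and T: "T \<ge> 1" using hyp_factor_ge[OF x0] hyp_factor_ge[OF x] by (auto simp: a0_def T_def)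
  have aa: "a \<bullet> a = a0\<^sup>2 - 1" unfolding a_def a0_def by (rule lorentz_norm_pole[OF x0])
  have YY: "Y \<bullet> Y = T\<^sup>2 - 1" unfolding Y_def T_def by (rule lorentz_norm_pole[OF x])
  have aY: "a \<bullet> Y = a0 * T - C"
    by (simp add: C_def hyp_cosh_def lorentz_coord_def a_def Y_def a0_def T_def inner_commute algebra_simps)
  \<comment> \<open>Solves (T, Y) = C (a0, a) + s (b0, b) for the initial velocity at the pole;
    \<open>ab\<close> and \<open>bb\<close> below say that it is a unit vector, Minkowski-orthogonal
    to the pole.\<close>
  define b where "b = (1 / s) *\<^sub>R (Y - C *\<^sub>R a)"
  define b0 where "b0 = (T - C * a0) / s"
  have ab: "a \<bullet> b = a0 * b0"
    using s(1) by (simp add: b_def b0_def inner_simps aY aa power2_eq_square field_simps)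
  have bb: "b \<bullet> b = b0\<^sup>2 + 1"
  proof -
    have "b \<bullet> b = ((Y \<bullet> Y) - 2 * C * (a \<bullet> Y) + C\<^sup>2 * (a \<bullet> a)) / s\<^sup>2"
    proof -
      have "(Y - C *\<^sub>R a) \<bullet> (Y - C *\<^sub>R a) = (Y \<bullet> Y) - 2 * C * (a \<bullet> Y) + C\<^sup>2 * (a \<bullet> a)"
        by (simp add: inner_simps inner_commute power2_eq_square)
      then show ?thesis by (simp add: b_def power2_eq_square)
    qed
    also have "\<dots> = ((T - C * a0)\<^sup>2 + s\<^sup>2) / s\<^sup>2"
      unfolding YY aY aa s(2) by (simp add: power2_eq_square algebra_simps)
    also have "\<dots> = b0\<^sup>2 + 1" using s(1) by (simp add: b0_def power_divide add_divide_distrib)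
    finally show ?thesis .
  qed
  define XT where "XT \<tau> = cosh \<tau> * a0 + sinh \<tau> * b0" for \<tau>
  define XY where "XY \<tau> = cosh \<tau> *\<^sub>R a + sinh \<tau> *\<^sub>R b" for \<tau>
  define XT' where "XT' \<tau> = sinh \<tau> * a0 + cosh \<tau> * b0" for \<tau>
  define XY' where "XY' \<tau> = sinh \<tau> *\<^sub>R a + cosh \<tau> *\<^sub>R b" for \<tau>
  have ch: "(cosh \<tau>)\<^sup>2 = (sinh \<tau>)\<^sup>2 + 1" for \<tau> :: real by (simp add: cosh_square_eq)
  have XX: "XY \<tau> \<bullet> XY \<tau> = (XT \<tau>)\<^sup>2 - 1" for \<tau>
  proof -
    have "XY \<tau> \<bullet> XY \<tau> = (cosh \<tau>)\<^sup>2 * (a \<bullet> a) + 2 * cosh \<tau> * sinh \<tau> * (a \<bullet> b) + (sinh \<tau>)\<^sup>2 * (b \<bullet> b)"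
      by (simp add: XY_def inner_simps inner_commute power2_eq_square algebra_simps)
    also have "\<dots> = (XT \<tau>)\<^sup>2 - (cosh \<tau>)\<^sup>2 + (sinh \<tau>)\<^sup>2"
      unfolding aa ab bb by (simp add: XT_def power2_eq_square algebra_simps)
    finally show ?thesis by (simp add: ch)
  qed
  have XX': "XY \<tau> \<bullet> XY' \<tau> = XT \<tau> * XT' \<tau>" for \<tau>
  proof -
    have "XY \<tau> \<bullet> XY' \<tau> = cosh \<tau> * sinh \<tau> * (a \<bullet> a + b \<bullet> b) + ((cosh \<tau>)\<^sup>2 + (sinh \<tau>)\<^sup>2) * (a \<bullet> b)"
      by (simp add: XY_def XY'_def inner_simps inner_commute power2_eq_square algebra_simps)
    also have "\<dots> = XT \<tau> * XT' \<tau>"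
      unfolding aa ab bb by (simp add: XT_def XT'_def power2_eq_square algebra_simps)
    finally show ?thesis .
  qed
  have X'X': "XY' \<tau> \<bullet> XY' \<tau> = (XT' \<tau>)\<^sup>2 + 1" for \<tau>
  proof -
    have "XY' \<tau> \<bullet> XY' \<tau> = (sinh \<tau>)\<^sup>2 * (a \<bullet> a) + 2 * cosh \<tau> * sinh \<tau> * (a \<bullet> b) + (cosh \<tau>)\<^sup>2 * (b \<bullet> b)"
      by (simp add: XY'_def inner_simps inner_commute power2_eq_square algebra_simps)
    also have "\<dots> = (XT' \<tau>)\<^sup>2 + (cosh \<tau>)\<^sup>2 - (sinh \<tau>)\<^sup>2"
      unfolding aa ab bb by (simp add: XT'_def power2_eq_square algebra_simps)
    finally show ?thesis by (simp add: ch)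
  qed
  have XT_pos: "XT \<tau> > 0" if "0 \<le> \<tau>" "\<tau> \<le> R" for \<tau>
  proof -
    \<comment> \<open>The geodesic is expressed by its two end points with weights sinh tau and sinh
      (R - tau) over sinh R, which are nonnegative and never vanish together.\<close>
    have "XT \<tau> * s = sinh \<tau> * T + sinh (R - \<tau>) * a0"
      using s(1) unfolding XT_def b0_def sinh_diff R by (simp add: field_simps)
    moreover have "sinh \<tau> \<ge> 0" "sinh (R - \<tau>) \<ge> 0" "sinh \<tau> > 0 \<or> sinh (R - \<tau>) > 0"
      using that R(1) by auto
    then have "sinh \<tau> * T + sinh (R - \<tau>) * a0 > 0"
      using T a0 by (auto intro: add_pos_nonneg add_nonneg_pos)
    ultimately show ?thesis using s(1) by (metis zero_less_mult_pos2)
  qed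
  \<comment> \<open>Y / (1 + T) inverts the embedding of the ball, where rho = 1 + T. Time is
    reversed because the curve has to run from \<open>x\<close> to \<open>x0\<close>.\<close>
  define \<gamma> where "\<gamma> t = (1 / (1 + XT ((1 - t) * R))) *\<^sub>R XY ((1 - t) * R)" for t
  define \<gamma>' where "\<gamma>' t = (- R) *\<^sub>R ((1 / (1 + XT ((1 - t) * R))) *\<^sub>R XY' ((1 - t) * R)
      - (XT' ((1 - t) * R) / (1 + XT ((1 - t) * R))\<^sup>2) *\<^sub>R XY ((1 - t) * R))" for t
  have \<tau>: "0 \<le> (1 - t) * R" "(1 - t) * R \<le> R" if "t \<in> {0..1}" for t
    using that R(1) by (auto intro: mult_left_le_one_le)
  have XTt: "XT ((1 - t) * R) > 0" if "t \<in> {0..1}" for t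
    using XT_pos[OF \<tau>[OF that]] .
  have dT: "((\<lambda>t. XT ((1 - t) * R)) has_real_derivative - R * XT' ((1 - t) * R)) (at t)" for t
    unfolding XT_def XT'_def by (auto intro!: derivative_eq_intros simp: algebra_simps)
  have dY: "((\<lambda>t. XY ((1 - t) * R)) has_vector_derivative (- R) *\<^sub>R XY' ((1 - t) * R)) (at t)" for t
  proof -
    have "((\<lambda>t. cosh ((1 - t) * R)) has_real_derivative - R * sinh ((1 - t) * R)) (at t)"
      "((\<lambda>t. sinh ((1 - t) * R)) has_real_derivative - R * cosh ((1 - t) * R)) (at t)"
      by (auto intro!: derivative_eq_intros)
    note has_vector_derivative_add[OF has_vector_derivative_scaleR[OF this(1) has_vector_derivative_const[of a]]
        has_vector_derivative_scaleR[OF this(2) has_vector_derivative_const[of b]]]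
    then show ?thesis by (simp add: XY_def[abs_def] XY'_def algebra_simps)
  qed
  have d\<gamma>: "(\<gamma> has_vector_derivative \<gamma>' t) (at t)" if t: "t \<in> {0..1}" for t
  proof -
    have "((\<lambda>t. 1 / (1 + XT ((1 - t) * R))) has_real_derivative
       R * XT' ((1 - t) * R) / (1 + XT ((1 - t) * R))\<^sup>2) (at t)"
      using XTt[OF t]
      by (auto intro!: derivative_eq_intros dT simp: power2_eq_square)
    from has_vector_derivative_scaleR[OF this dY[of t]]
    show ?thesis by (simp add: \<gamma>_def[abs_def] \<gamma>'_def algebra_simps)
  qed
  have c\<gamma>': "continuous_on {0..1} \<gamma>'"
  proof -
    have nz: "\<forall>t\<in>{0..1}. 1 + XT ((1 - t) * R) \<noteq> 0" using XTt by force
    then have nz2: "\<forall>t\<in>{0..1}. (1 + XT ((1 - t) * R))\<^sup>2 \<noteq> 0" by simp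
    have c: "continuous_on {0..1} (\<lambda>t. XT ((1 - t) * R))" "continuous_on {0..1} (\<lambda>t. XT' ((1 - t) * R))"
      "continuous_on {0..1} (\<lambda>t. XY ((1 - t) * R))" "continuous_on {0..1} (\<lambda>t. XY' ((1 - t) * R))"
      unfolding XT_def XT'_def XY_def XY'_def by (intro continuous_intros)+
    show ?thesis
      unfolding \<gamma>'_def by (intro continuous_intros c nz nz2)
  qed
  show thesis
  proof
    show "\<gamma> C1_differentiable_on {0..1}"
      unfolding C1_differentiable_on_def using d\<gamma> c\<gamma>' by blast
    show "\<gamma> 0 = x"
    proof -
      have "XT R = T" "XY R = Y"
        using s(1) by (auto simp: XT_def XY_def R b0_def b_def scaleR_add_right scaleR_diff_right)
      then show ?thesis using hyp_factor_pos[OF x] by (simp add: \<gamma>_def T_def Y_def)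
    qed
    show "\<gamma> 1 = x0"
      using hyp_factor_pos[OF x0] by (simp add: \<gamma>_def XT_def XY_def a0_def a_def)
    have nn: "\<gamma> t \<bullet> \<gamma> t = (XT ((1 - t) * R) - 1) / (XT ((1 - t) * R) + 1)" if "t \<in> {0..1}" for t
    proof -
      let ?T = "XT ((1 - t) * R)"
      have "\<gamma> t \<bullet> \<gamma> t = (?T\<^sup>2 - 1) / (1 + ?T)\<^sup>2"
        by (simp add: \<gamma>_def XX power2_eq_square)
      also have "\<dots> = (?T - 1) * (?T + 1) / ((?T + 1) * (?T + 1))"
        by (simp add: power2_eq_square algebra_simps)
      finally show ?thesis using XTt[OF that] by simp
    qed
    show "\<gamma> ` {0..1} \<subseteq> hyp_space"
    proof (rule image_subsetI)
      fix t :: real assume t: "t \<in> {0..1}"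
      have "\<gamma> t \<bullet> \<gamma> t < 1" unfolding nn[OF t] using XTt[OF t] by simp
      then show "\<gamma> t \<in> hyp_space"
        by (simp add: hyp_space_iff norm_lt_square)
    qed
    have "hyp_norm (\<gamma> t) (vector_derivative \<gamma> (at t)) = R" if t: "t \<in> {0..1}" for t
    proof -
      let ?\<tau> = "(1 - t) * R"
      let ?T = "XT ?\<tau>"
      have T0: "?T > 0" using XTt[OF t] .
      have \<rho>: "hyp_factor (\<gamma> t) = 1 + ?T"
        using T0 by (simp add: hyp_factor_inner nn[OF t] field_simps)
      have "(1 + ?T) *\<^sub>R \<gamma>' t = (- R) *\<^sub>R (XY' ?\<tau> - (XT' ?\<tau> / (1 + ?T)) *\<^sub>R XY ?\<tau>)"
        using T0 by (simp add: \<gamma>'_def scaleR_diff_right power2_eq_square)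
      define v where "v = XY' ?\<tau> - (XT' ?\<tau> / (1 + ?T)) *\<^sub>R XY ?\<tau>"
      define k where "k = XT' ?\<tau> / (1 + ?T)"
      have k: "XT' ?\<tau> = k * (1 + ?T)" using T0 by (simp add: k_def)
      have "(1 + ?T)\<^sup>2 * (\<gamma>' t \<bullet> \<gamma>' t) = ((1 + ?T) *\<^sub>R \<gamma>' t) \<bullet> ((1 + ?T) *\<^sub>R \<gamma>' t)"
        by (simp add: power2_eq_square)
      also have "\<dots> = R\<^sup>2 * (v \<bullet> v)"
        unfolding \<open>(1 + ?T) *\<^sub>R \<gamma>' t = _\<close> v_def[symmetric] by (simp add: power2_eq_square)
      also have "v \<bullet> v = XY' ?\<tau> \<bullet> XY' ?\<tau> - 2 * k * (XY ?\<tau> \<bullet> XY' ?\<tau>) + k\<^sup>2 * (XY ?\<tau> \<bullet> XY ?\<tau>)"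
        unfolding v_def k_def[symmetric] by (simp add: inner_simps inner_commute power2_eq_square)
      \<comment> \<open>All terms with \<open>k\<close> cancel: (1 + T)^2 - 2 T (1 + T) + T^2 - 1 =
        0.\<close>
      also have "\<dots> = 1"
        unfolding XX XX' X'X' k by (simp add: algebra_simps power2_eq_square)
      finally have "(1 + ?T)\<^sup>2 * (\<gamma>' t \<bullet> \<gamma>' t) = R\<^sup>2" by simp
      then show ?thesis
        using R(1) by (simp add: vector_derivative_at[OF d\<gamma>[OF t]] hyp_norm_def hyp_inner_def \<rho>)
    qed
    then have "hyp_length \<gamma> = integral {0..1} (\<lambda>t::real. R)"
      unfolding hyp_length_def by (rule Henstock_Kurzweil_Integration.integral_cong)
    then show "hyp_length \<gamma> = arcosh (hyp_cosh x0 x)" by (simp add: R_def C_def)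
  qed
qed

theorem hyp_dist_eq:
  assumes x0: "x0 \<in> hyp_space" and x: "x \<in> hyp_space" and ne: "x \<noteq> x0"
  shows "hyp_dist x x0 = arcosh (hyp_cosh x0 x)"
proof -
  obtain \<gamma> where \<gamma>: "\<gamma> C1_differentiable_on {0..1}" "\<gamma> ` {0..1} \<subseteq> hyp_space"
    "\<gamma> 0 = x" "\<gamma> 1 = x0" "hyp_length \<gamma> = arcosh (hyp_cosh x0 x)"
    using hyp_geodesic_exists[OF assms] .
  show ?thesis
    unfolding hyp_dist_def
  proof (rule cInf_eq_minimum)
    show "arcosh (hyp_cosh x0 x) \<in> {hyp_length \<gamma> | \<gamma>. \<gamma> C1_differentiable_on {0..1} \<and>
        \<gamma> ` {0..1} \<subseteq> hyp_space \<and> \<gamma> 0 = x \<and> \<gamma> 1 = x0}"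
      using \<gamma> by (intro CollectI exI[of _ \<gamma>]) simp
  qed (use hyp_length_ge[OF x0] in blast)
qed

section \<open>The polar frame\<close>

locale hyp_pole =
  fixes x0 :: "'a::euclidean_space"
  assumes x0: "x0 \<in> hyp_space"
begin

abbreviation "U \<equiv> hyp_space - {x0}"
abbreviation "C \<equiv> hyp_cosh x0"

definition r :: "'a \<Rightarrow> real" where "r x = hyp_dist x x0"

text \<open>This is sinh r, expressed through cosh r so that its smoothness does not depend on that
  of \<open>r\<close>.\<close>

definition sh :: "'a \<Rightarrow> real" where "sh x = sqrt ((C x)\<^sup>2 - 1)"

text \<open>The spatial Minkowski coordinates with respect to the boosted standard basis at the pole, so that
  \<open>yc j = sinh r \<cdot> th j\<close> where \<open>th\<close> is the angular coordinate on the unit sphere.\<close>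

definition yc :: "'a \<Rightarrow> 'a \<Rightarrow> real" where
  "yc j = lorentz_coord (j + (hyp_factor x0 * (x0 \<bullet> j)) *\<^sub>R x0) (hyp_factor x0 * (x0 \<bullet> j))"

definition th :: "'a \<Rightarrow> 'a \<Rightarrow> real" where "th j x = yc j x / sh x"

text \<open>\<open>RF\<close> is the field \<open>\<partial>/\<partial>r\<close>; \<open>GF j\<close> is the \<open>j\<close>-th component of the gradient on the unit sphere.\<close>

definition RF :: "'a \<Rightarrow> 'a" where "RF = hyp_grad r"
definition GF :: "'a \<Rightarrow> 'a \<Rightarrow> 'a" where "GF j = (\<lambda>x. (sh x)\<^sup>2 *\<^sub>R hyp_grad (th j) x)"

abbreviation "R \<equiv> dd RF"
abbreviation "G \<equiv> (\<lambda>j. dd (GF j))"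

lemma open_U: "open U"
  using open_hyp_space by blast

lemma U_hyp: "x \<in> U \<Longrightarrow> x \<in> hyp_space" by simp

lemma C_gt_1: "x \<in> U \<Longrightarrow> C x > 1"
  using hyp_cosh_gt_1[OF x0] by auto

lemma sh_pos: "x \<in> U \<Longrightarrow> sh x > 0"
  using C_gt_1[of x] by (simp add: sh_def)

lemma sh_sq: "x \<in> U \<Longrightarrow> (sh x)\<^sup>2 = (C x)\<^sup>2 - 1"
  using C_gt_1[of x] by (simp add: sh_def)

lemma r_eq: "x \<in> U \<Longrightarrow> r x = arcosh (C x)"
  using hyp_dist_eq[OF x0] by (auto simp: r_def)

lemma r_pos: "x \<in> U \<Longrightarrow> r x > 0"
  using C_gt_1[of x] by (simp add: r_eq)

lemma cosh_r: "x \<in> U \<Longrightarrow> cosh (r x) = C x"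
  using C_gt_1[of x] by (simp add: r_eq)

lemma sinh_r: "x \<in> U \<Longrightarrow> sinh (r x) = sh x"
  using C_gt_1[of x] by (simp add: r_eq sinh_arcosh_real sh_def)

lemma C_k_on_C: "C_k_on k U C"
  unfolding hyp_cosh_def by (rule C_k_on_subset[OF C_k_on_lorentz_coord]) auto

lemma C_k_on_yc: "C_k_on k U (yc j)"
  unfolding yc_def by (rule C_k_on_subset[OF C_k_on_lorentz_coord]) auto

lemma C_k_on_factor: "C_k_on k U hyp_factor"
  by (rule C_k_on_subset[OF C_k_on_hyp_factor]) auto

lemma C_k_on_sh: "C_k_on k U sh"
  unfolding sh_def[abs_def] power2_eq_square
  by (intro C_k_on_sqrt open_U C_k_on_diff C_k_on_mult C_k_on_C C_k_on_const)
    (use C_gt_1 in \<open>simp add: less_1_mult\<close>)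

lemma C_k_on_th: "C_k_on k U (th j)"
  unfolding th_def[abs_def]
  by (intro C_k_on_divide open_U C_k_on_yc C_k_on_sh) (use sh_pos in force)

lemma r_has_derivative:
  assumes "x \<in> U"
  shows "(r has_derivative (\<lambda>v. frechet_derivative C (at x) v * (1 / sh x))) (at x)"
proof -
  have "(C has_derivative frechet_derivative C (at x)) (at x)"
    by (rule has_derivative_partial[OF C_k_on_C[of "Suc 0"] assms])
  from DERIV_compose_FDERIV[OF arcosh_real_has_field_derivative[OF C_gt_1[OF assms]] this]
  have "((\<lambda>y. arcosh (C y)) has_derivative (\<lambda>v. frechet_derivative C (at x) v * (1 / sh x))) (at x)"
    by (simp add: sh_def)
  then show ?thesis
    by (rule has_derivative_transform_within_open[OF _ open_U assms]) (simp add: r_eq)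
qed

text \<open>One differentiation settles all orders: the derivative of \<open>r\<close> is that of
  \<open>C\<close> divided by \<open>sh\<close> and no longer mentions \<open>r\<close>.\<close>

lemma C_k_on_r: "C_k_on k U r"
proof -
  have "C_k_on (Suc k) U r"
  proof (rule C_k_on_Suc_derivI[OF open_U r_has_derivative])
    fix i :: 'a assume "i \<in> Basis"
    then show "C_k_on k U (\<lambda>x. frechet_derivative C (at x) i * (1 / sh x))"
      unfolding partial_deriv_def[symmetric]
      by (intro C_k_on_mult open_U C_k_on_divide C_k_on_const C_k_on_sh C_k_on_SucD(2)[OF C_k_on_C])
        (use sh_pos in force)+
  qed
  then show ?thesis by (rule C_k_on_Suc_imp)
qed

lemma diff_C: "x \<in> U \<Longrightarrow> C differentiable (at x)"
  by (rule C_k_on_differentiable[OF C_k_on_C])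
lemma diff_sh: "x \<in> U \<Longrightarrow> sh differentiable (at x)"
  by (rule C_k_on_differentiable[OF C_k_on_sh])
lemma diff_th: "x \<in> U \<Longrightarrow> th j differentiable (at x)"
  by (rule C_k_on_differentiable[OF C_k_on_th])
lemma diff_r: "x \<in> U \<Longrightarrow> r differentiable (at x)"
  by (rule C_k_on_differentiable[OF C_k_on_r])

lemma C_k_on_hyp_grad:
  assumes "C_k_on (Suc k) U h" "i \<in> Basis"
  shows "C_k_on k U (\<lambda>x. hyp_grad h x \<bullet> i)"
  unfolding hyp_grad_inner_Basis[OF assms(2)] power2_eq_square
  by (intro C_k_on_divide open_U C_k_on_mult C_k_on_factor C_k_on_SucD(2)[OF assms])
    (use hyp_factor_pos in force)

lemma C_k_on_RF: "i \<in> Basis \<Longrightarrow> C_k_on k U (\<lambda>x. RF x \<bullet> i)"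
  unfolding RF_def by (intro C_k_on_hyp_grad C_k_on_r)

lemma C_k_on_GF: "i \<in> Basis \<Longrightarrow> C_k_on k U (\<lambda>x. GF j x \<bullet> i)"
  unfolding GF_def inner_scaleR_left power2_eq_square
  by (intro C_k_on_mult open_U C_k_on_sh C_k_on_hyp_grad C_k_on_th)

lemma C_k_on_R: "C_k_on (Suc k) U h \<Longrightarrow> C_k_on k U (R h)"
  by (rule C_k_on_dd[OF open_U _ C_k_on_RF])

lemma C_k_on_G: "C_k_on (Suc k) U h \<Longrightarrow> C_k_on k U (G j h)"
  by (rule C_k_on_dd[OF open_U _ C_k_on_GF])

subsection \<open>Derivatives of the coordinates\<close>

lemma dd_r: "x \<in> U \<Longrightarrow> dd A r x = dd A C x / sh x"
  using dd_eqI[OF r_has_derivative, of x A] dd_frechet[OF diff_C, of x A] by simp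

lemma dd_C: "x \<in> U \<Longrightarrow> dd A C x = sh x * dd A r x"
  using sh_pos[of x] by (simp add: dd_r)

lemma dd_sh:
  assumes x: "x \<in> U" shows "dd A sh x = C x * dd A r x"
proof -
  have "2 * sh x * dd A sh x = dd A (\<lambda>y. sh y * sh y) x"
    by (simp add: dd_mult[OF diff_sh[OF x] diff_sh[OF x]])
  also have "\<dots> = dd A (\<lambda>y. C y * C y - 1) x"
    by (rule dd_cong[OF open_U x]) (use sh_sq in \<open>simp add: power2_eq_square\<close>)
  also have "\<dots> = 2 * C x * dd A C x"
    using x by (subst dd_diff) (auto simp: dd_mult diff_C intro!: differentiable_mult)
  finally have "sh x * dd A sh x = sh x * (C x * dd A r x)"
    using dd_C[OF x, of A] by simp
  then show ?thesis using sh_pos[OF x] by simp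
qed

lemma dd_yc:
  assumes x: "x \<in> U"
  shows "dd A (yc j) x = sh x * dd A (th j) x + C x * dd A r x * th j x"
proof -
  have "dd A (yc j) x = dd A (\<lambda>y. sh y * th j y) x"
    by (rule dd_cong[OF open_U x]) (use sh_pos in \<open>force simp: th_def\<close>)
  then show ?thesis
    by (simp add: dd_mult[OF diff_sh[OF x] diff_th[OF x]] dd_sh[OF x])
qed

text \<open>Together with the next two lemmas this is the Gram matrix of the boosted basis and the
  pole: a Minkowski-orthonormal system whose timelike vector is the pole.\<close>

lemma pole_inner:
  "(j + (hyp_factor x0 * (x0 \<bullet> j)) *\<^sub>R x0) \<bullet> (k + (hyp_factor x0 * (x0 \<bullet> k)) *\<^sub>R x0)
    - (hyp_factor x0 * (x0 \<bullet> j)) * (hyp_factor x0 * (x0 \<bullet> k)) = j \<bullet> k"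
proof -
  define \<rho> where "\<rho> = hyp_factor x0"
  have n: "\<rho> * (x0 \<bullet> x0) = \<rho> - 2" unfolding \<rho>_def by (rule hyp_factor_mult_sq[OF x0])
  have "(j + (\<rho> * (x0 \<bullet> j)) *\<^sub>R x0) \<bullet> (k + (\<rho> * (x0 \<bullet> k)) *\<^sub>R x0)
    = j \<bullet> k + 2 * \<rho> * (x0 \<bullet> j) * (x0 \<bullet> k) + \<rho> * (x0 \<bullet> j) * (x0 \<bullet> k) * (\<rho> * (x0 \<bullet> x0))"
    by (simp add: inner_simps inner_commute algebra_simps)
  also have "\<dots> = j \<bullet> k + (\<rho> * (x0 \<bullet> j)) * (\<rho> * (x0 \<bullet> k))"
    unfolding n by (simp add: algebra_simps)
  finally show ?thesis unfolding \<rho>_def by simp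
qed

lemma pole_inner_C:
  "(- (hyp_factor x0 *\<^sub>R x0)) \<bullet> (k + (hyp_factor x0 * (x0 \<bullet> k)) *\<^sub>R x0)
    - (1 - hyp_factor x0) * (hyp_factor x0 * (x0 \<bullet> k)) = 0"
proof -
  define \<rho> where "\<rho> = hyp_factor x0"
  have n: "\<rho> * (x0 \<bullet> x0) = \<rho> - 2" unfolding \<rho>_def by (rule hyp_factor_mult_sq[OF x0])
  have "(- (\<rho> *\<^sub>R x0)) \<bullet> (k + (\<rho> * (x0 \<bullet> k)) *\<^sub>R x0)
    = - (\<rho> * (x0 \<bullet> k)) - \<rho> * (x0 \<bullet> k) * (\<rho> * (x0 \<bullet> x0))"
    by (simp add: inner_simps algebra_simps)
  also have "\<dots> = (1 - \<rho>) * (\<rho> * (x0 \<bullet> k))"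
    unfolding n by (simp add: algebra_simps)
  finally show ?thesis unfolding \<rho>_def by simp
qed

lemma pole_inner_CC:
  "(- (hyp_factor x0 *\<^sub>R x0)) \<bullet> (- (hyp_factor x0 *\<^sub>R x0)) - (1 - hyp_factor x0) * (1 - hyp_factor x0) = -1"
  using lorentz_norm_pole[OF x0] by (simp add: power2_eq_square algebra_simps)

lemma gg_C_C:
  assumes x: "x \<in> U" shows "hyp_gg C C x = (sh x)\<^sup>2"
proof -
  have "hyp_gg C C x = - 1 + C x * C x"
    unfolding hyp_cosh_def hyp_gg_lorentz[OF U_hyp[OF x]] pole_inner_CC ..
  then show ?thesis using sh_sq[OF x] by (simp add: power2_eq_square)
qed

lemma gg_C_yc: "x \<in> U \<Longrightarrow> hyp_gg C (yc j) x = C x * yc j x"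
  unfolding hyp_cosh_def yc_def hyp_gg_lorentz[OF U_hyp] pole_inner_C by simp

lemma gg_yc_yc: "x \<in> U \<Longrightarrow> hyp_gg (yc j) (yc k) x = j \<bullet> k + yc j x * yc k x"
  unfolding yc_def hyp_gg_lorentz[OF U_hyp] pole_inner by simp

lemma yc_eq: "x \<in> U \<Longrightarrow> yc j x = sh x * th j x"
  using sh_pos[of x] by (simp add: th_def)

lemma gg_C_r: "x \<in> U \<Longrightarrow> hyp_gg C r x = sh x"
  using gg_C_C[of x] sh_pos[of x] dd_r[of x "hyp_grad C"] by (simp add: dd_hyp_grad power2_eq_square)

lemma R_C: "x \<in> U \<Longrightarrow> R C x = sh x"
  by (simp add: RF_def dd_hyp_grad hyp_gg_sym[of r] gg_C_r)

lemma R_r: "x \<in> U \<Longrightarrow> R r x = 1"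
  using sh_pos[of x] by (simp add: dd_r R_C)

lemma gg_C_th: "x \<in> U \<Longrightarrow> hyp_gg C (th j) x = 0"
  using gg_C_yc[of x j] dd_yc[of x "hyp_grad C" j] sh_pos[of x]
  by (simp add: dd_hyp_grad gg_C_r yc_eq)

lemma gg_th_r: "x \<in> U \<Longrightarrow> hyp_gg (th j) r x = 0"
  using gg_C_th[of x j] dd_r[of x "hyp_grad (th j)"] by (simp add: dd_hyp_grad hyp_gg_sym)

lemma R_th: "x \<in> U \<Longrightarrow> R (th j) x = 0"
  by (simp add: RF_def dd_hyp_grad hyp_gg_sym[of r] gg_th_r)

text \<open>The square of \<open>sh\<close> undoes the factor 1/sinh^2 r with which the inverse
  metric weights angular derivatives.\<close>

lemma G_eq: "G j h x = (sh x)\<^sup>2 * hyp_gg (th j) h x"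
  by (simp add: GF_def dd_scaleR dd_hyp_grad)

lemma G_r: "x \<in> U \<Longrightarrow> G j r x = 0"
  by (simp add: G_eq gg_th_r)

lemma gg_yc_r: "x \<in> U \<Longrightarrow> hyp_gg (yc j) r x = C x * th j x"
  using dd_r[of x "hyp_grad (yc j)"] gg_C_yc[of x j] sh_pos[of x]
  by (simp add: dd_hyp_grad hyp_gg_sym[of "yc j" C] yc_eq)

text \<open>The right-hand side is the projection onto the tangent space of the unit sphere. It
  comes from the known products of the \<open>yc j\<close> by splitting off their radial
  parts.\<close>

lemma gg_th_th:
  assumes x: "x \<in> U"
  shows "(sh x)\<^sup>2 * hyp_gg (th j) (th k) x = j \<bullet> k - th j x * th k x"
proof -
  have 1: "hyp_gg (yc j) (th k) x = sh x * hyp_gg (th j) (th k) x"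
    using dd_yc[OF x, of "hyp_grad (th k)" j] gg_th_r[OF x]
    by (simp add: dd_hyp_grad hyp_gg_sym[of _ "th k"] hyp_gg_sym[of "th k" r])
  have "hyp_gg (yc j) (yc k) x = sh x * hyp_gg (yc j) (th k) x + C x * (C x * th j x) * th k x"
    using dd_yc[OF x, of "hyp_grad (yc j)" k] by (simp add: dd_hyp_grad gg_yc_r[OF x])
  then have "j \<bullet> k + (sh x)\<^sup>2 * (th j x * th k x) = (sh x)\<^sup>2 * hyp_gg (th j) (th k) x + (C x)\<^sup>2 * (th j x * th k x)"
    unfolding 1 gg_yc_yc[OF x] yc_eq[OF x] by (simp add: power2_eq_square algebra_simps)
  moreover have "(C x)\<^sup>2 = (sh x)\<^sup>2 + 1" using sh_sq[OF x] by simp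
  ultimately show ?thesis by (simp add: algebra_simps)
qed

lemma G_th: "x \<in> U \<Longrightarrow> G j (th k) x = j \<bullet> k - th j x * th k x"
  by (simp add: G_eq gg_th_th)

subsection \<open>Completeness of the frame\<close>

text \<open>Parseval's identity for the system formed by the boosted basis and the pole. For each
  argument the pairings with the basis are the components of one vector, the inverse boost, so that
  the Euclidean identity applies.\<close>

lemma lorentz_complete:
  "(\<Sum>j\<in>Basis. ((j + (hyp_factor x0 * (x0 \<bullet> j)) *\<^sub>R x0) \<bullet> m - hyp_factor x0 * (x0 \<bullet> j) * n)
      * ((j + (hyp_factor x0 * (x0 \<bullet> j)) *\<^sub>R x0) \<bullet> m' - hyp_factor x0 * (x0 \<bullet> j) * n'))
    = m \<bullet> m' - n * n'
      + (- (hyp_factor x0 *\<^sub>R x0) \<bullet> m - (1 - hyp_factor x0) * n)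
        * (- (hyp_factor x0 *\<^sub>R x0) \<bullet> m' - (1 - hyp_factor x0) * n')"
proof -
  define \<rho> where "\<rho> = hyp_factor x0"
  define k where "k = x0 \<bullet> m - n"
  define k' where "k' = x0 \<bullet> m' - n'"
  have n: "\<rho> * (x0 \<bullet> x0) = \<rho> - 2" unfolding \<rho>_def by (rule hyp_factor_mult_sq[OF x0])
  have e: "(j + (\<rho> * (x0 \<bullet> j)) *\<^sub>R x0) \<bullet> m - \<rho> * (x0 \<bullet> j) * n = (m + (\<rho> * k) *\<^sub>R x0) \<bullet> j"
    "(j + (\<rho> * (x0 \<bullet> j)) *\<^sub>R x0) \<bullet> m' - \<rho> * (x0 \<bullet> j) * n' = (m' + (\<rho> * k') *\<^sub>R x0) \<bullet> j" for j
    by (simp_all add: k_def k'_def inner_simps inner_commute algebra_simps)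
  have "(m + (\<rho> * k) *\<^sub>R x0) \<bullet> (m' + (\<rho> * k') *\<^sub>R x0)
     = m \<bullet> m' + \<rho> * k' * (x0 \<bullet> m) + \<rho> * k * (x0 \<bullet> m') + \<rho> * k * k' * (\<rho> * (x0 \<bullet> x0))"
    by (simp add: inner_simps inner_commute algebra_simps)
  also have "\<dots> = m \<bullet> m' - n * n' + (- (\<rho> *\<^sub>R x0) \<bullet> m - (1 - \<rho>) * n) * (- (\<rho> *\<^sub>R x0) \<bullet> m' - (1 - \<rho>) * n')"
    unfolding n by (simp add: k_def k'_def algebra_simps)
  finally show ?thesis
    unfolding \<rho>_def[symmetric] e by (simp add: euclidean_inner[symmetric])
qed

text \<open>Completeness applied to the point itself, which lies on the hyperboloid.\<close>

lemma sum_th_sq: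
  assumes x: "x \<in> U" shows "(\<Sum>j\<in>Basis. th j x * th j x) = 1"
proof -
  let ?\<rho> = "hyp_factor x"
  have n: "?\<rho> * (x \<bullet> x) = ?\<rho> - 2" by (rule hyp_factor_mult_sq[OF U_hyp[OF x]])
  have y: "yc j x = (j + (hyp_factor x0 * (x0 \<bullet> j)) *\<^sub>R x0) \<bullet> (?\<rho> *\<^sub>R x) - hyp_factor x0 * (x0 \<bullet> j) * (?\<rho> - 1)" for j
    by (simp add: yc_def lorentz_coord_def inner_commute algebra_simps)
  have c: "C x = - (hyp_factor x0 *\<^sub>R x0) \<bullet> (?\<rho> *\<^sub>R x) - (1 - hyp_factor x0) * (?\<rho> - 1)"
    by (simp add: hyp_cosh_def lorentz_coord_def inner_commute algebra_simps)
  have "(\<Sum>j\<in>Basis. yc j x * yc j x) = (?\<rho> *\<^sub>R x) \<bullet> (?\<rho> *\<^sub>R x) - (?\<rho> - 1) * (?\<rho> - 1) + C x * C x"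
    unfolding y c by (rule lorentz_complete)
  also have "\<dots> = (sh x)\<^sup>2"
    using lorentz_norm_pole[OF U_hyp[OF x]] sh_sq[OF x] by (simp add: power2_eq_square)
  finally have "(sh x)\<^sup>2 * (\<Sum>j\<in>Basis. th j x * th j x) = (sh x)\<^sup>2"
    by (simp add: yc_eq[OF x] sum_distrib_left power2_eq_square mult_ac)
  then show ?thesis using sh_pos[OF x] by simp
qed

lemma sum_th_dd_th:
  assumes x: "x \<in> U" shows "(\<Sum>j\<in>Basis. th j x * dd A (th j) x) = 0"
proof -
  have "dd A (\<lambda>y. \<Sum>j\<in>Basis. th j y * th j y) x = dd A (\<lambda>y. 1) x"
    by (rule dd_cong[OF open_U x]) (rule sum_th_sq)
  moreover have "dd A (\<lambda>y. \<Sum>j\<in>Basis. th j y * th j y) x = (\<Sum>j\<in>Basis. 2 * (th j x * dd A (th j) x))"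
    using x by (subst dd_sum) (auto intro!: differentiable_mult diff_th sum.cong simp: dd_mult diff_th)
  ultimately show ?thesis by (simp add: sum_distrib_left[symmetric])
qed

lemma sum_th_G: "x \<in> U \<Longrightarrow> (\<Sum>j\<in>Basis. th j x * G j h x) = 0"
  using sum_th_dd_th[of x "hyp_grad h"]
  by (simp add: G_eq dd_hyp_grad hyp_gg_sym[of h] mult.left_commute[of "th _ x"] sum_distrib_left[symmetric])

text \<open>Every direction is resolved into \<open>r\<close> and the \<open>th j\<close>, although
  the \<open>G j\<close> are linearly dependent. The mixed terms vanish because \<open>th\<close> is
  orthogonal to its own derivatives.\<close>

lemma dd_complete:
  assumes x: "x \<in> U"
  shows "dd A h x = R h x * dd A r x + (\<Sum>j\<in>Basis. G j h x * dd A (th j) x)"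
proof -
  let ?\<rho> = "hyp_factor x"
  have \<rho>: "?\<rho> > 0" using hyp_factor_pos[OF U_hyp[OF x]] .
  have xH: "x \<in> hyp_space" using x by simp
  have n: "?\<rho> * (x \<bullet> x) = ?\<rho> - 2" by (rule hyp_factor_mult_sq[OF xH])
  define B where "B = hyp_grad h"
  \<comment> \<open>\<open>m v\<close> is the space component of the differential of the embedding
    into Minkowski space, and rho^2 (x . v) its time component. The identity proved next says that
    the embedding is isometric.\<close>
  define m where "m v = ?\<rho> *\<^sub>R v + (?\<rho>\<^sup>2 * (x \<bullet> v)) *\<^sub>R x" for v
  have L: "dd A (lorentz_coord p q) x = p \<bullet> m (A x) - q * (?\<rho>\<^sup>2 * (x \<bullet> A x))" for p q and A :: "'a \<Rightarrow> 'a"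
    using dd_eqI[OF lorentz_coord_has_derivative[OF xH], of A p q]
    by (simp add: lorentz_grad_def m_def inner_simps inner_commute power2_eq_square algebra_simps)
  have "m v \<bullet> m w - (?\<rho>\<^sup>2 * (x \<bullet> v)) * (?\<rho>\<^sup>2 * (x \<bullet> w)) = ?\<rho>\<^sup>2 * (v \<bullet> w)" for v w
  proof -
    have "m v \<bullet> m w = ?\<rho>\<^sup>2 * (v \<bullet> w) + 2 * ?\<rho> ^ 3 * (x \<bullet> v) * (x \<bullet> w) + ?\<rho> ^ 3 * (x \<bullet> v) * (x \<bullet> w) * (?\<rho> * (x \<bullet> x))"
      by (simp add: m_def inner_simps inner_commute power2_eq_square power3_eq_cube algebra_simps)
    then show ?thesis unfolding n by (simp add: power2_eq_square power3_eq_cube algebra_simps)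
  qed
  then have "(\<Sum>j\<in>Basis. dd A (yc j) x * dd B (yc j) x) = ?\<rho>\<^sup>2 * (A x \<bullet> B x) + dd A C x * dd B C x"
    unfolding yc_def hyp_cosh_def L
    using lorentz_complete[of "m (A x)" "?\<rho>\<^sup>2 * (x \<bullet> A x)" "m (B x)" "?\<rho>\<^sup>2 * (x \<bullet> B x)"]
    by simp
  moreover have "dd A h x = ?\<rho>\<^sup>2 * (A x \<bullet> B x)"
    using \<rho> by (simp add: dd_def B_def euclidean_inner[of "A x" "hyp_grad h x"] hyp_grad_inner_Basis sum_distrib_left)
  ultimately have "dd A h x = (\<Sum>j\<in>Basis. dd A (yc j) x * dd B (yc j) x) - dd A C x * dd B C x"
    by simp
  also have "(\<Sum>j\<in>Basis. dd A (yc j) x * dd B (yc j) x)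
     = (sh x)\<^sup>2 * (\<Sum>j\<in>Basis. dd A (th j) x * dd B (th j) x)
       + sh x * C x * dd B r x * (\<Sum>j\<in>Basis. th j x * dd A (th j) x)
       + sh x * C x * dd A r x * (\<Sum>j\<in>Basis. th j x * dd B (th j) x)
       + (C x)\<^sup>2 * dd A r x * dd B r x * (\<Sum>j\<in>Basis. th j x * th j x)"
    unfolding dd_yc[OF x] sum_distrib_left sum.distrib[symmetric]
    by (intro sum.cong refl) (simp add: power2_eq_square algebra_simps)
  also have "\<dots> - dd A C x * dd B C x
     = (sh x)\<^sup>2 * (\<Sum>j\<in>Basis. dd A (th j) x * dd B (th j) x) + ((C x)\<^sup>2 - (sh x)\<^sup>2) * dd A r x * dd B r x"
    unfolding sum_th_dd_th[OF x] sum_th_sq[OF x] dd_C[OF x] by (simp add: power2_eq_square algebra_simps)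
  also have "dd B r x = R h x"
    by (simp add: B_def RF_def dd_hyp_grad hyp_gg_sym)
  also have "(sh x)\<^sup>2 * (\<Sum>j\<in>Basis. dd A (th j) x * dd B (th j) x) = (\<Sum>j\<in>Basis. G j h x * dd A (th j) x)"
    by (simp add: G_eq B_def dd_hyp_grad hyp_gg_sym[of h] sum_distrib_left mult_ac)
  finally show ?thesis using sh_sq[OF x] by (simp add: mult.commute)
qed

lemma hyp_gg_frame:
  assumes x: "x \<in> U"
  shows "hyp_gg g h x = R g x * R h x + (\<Sum>j\<in>Basis. G j g x * G j h x) / (sh x)\<^sup>2"
proof -
  have "hyp_gg g h x = R h x * hyp_gg g r x + (\<Sum>j\<in>Basis. G j h x * hyp_gg g (th j) x)"
    using dd_complete[OF x, of "hyp_grad g" h] by (simp add: dd_hyp_grad)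
  moreover have "hyp_gg g (th j) x = G j g x / (sh x)\<^sup>2" for j
    using sh_pos[OF x] by (simp add: G_eq hyp_gg_sym[of g])
  ultimately show ?thesis
    by (simp add: RF_def dd_hyp_grad hyp_gg_sym[of r g] sum_divide_distrib mult.commute)
qed

subsection \<open>Commutators\<close>

text \<open>A commutator is again the derivative along a field, and by completeness a field is known
  from its action on \<open>r\<close> and on all \<open>th k\<close>.\<close>

lemma frame_commutator:
  assumes x: "x \<in> U" and h: "C_k_on (Suc (Suc 0)) U h"
    and A: "\<And>i. i \<in> Basis \<Longrightarrow> C_k_on (Suc 0) U (\<lambda>x. A x \<bullet> i)"
    and B: "\<And>i. i \<in> Basis \<Longrightarrow> C_k_on (Suc 0) U (\<lambda>x. B x \<bullet> i)"
  shows "dd A (dd B h) x - dd B (dd A h) x = R h x * (dd A (dd B r) x - dd B (dd A r) x)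
    + (\<Sum>k\<in>Basis. G k h x * (dd A (dd B (th k)) x - dd B (dd A (th k)) x))"
proof -
  define Z where "Z = (\<lambda>y. \<Sum>i\<in>Basis. (dd A (\<lambda>y. B y \<bullet> i) y - dd B (\<lambda>y. A y \<bullet> i) y) *\<^sub>R i)"
  have Z: "dd A (dd B g) x - dd B (dd A g) x = dd Z g x" if "C_k_on (Suc (Suc 0)) U g" for g
  proof -
    have "Z x \<bullet> i = dd A (\<lambda>y. B y \<bullet> i) x - dd B (\<lambda>y. A y \<bullet> i) x" if "i \<in> Basis" for i
      unfolding Z_def by (subst inner_sum_left_Basis[OF that]) simp
    then show ?thesis
      by (simp add: dd_commutator[OF open_U x that A B] dd_def[of Z])
  qed
  show ?thesis
    unfolding Z[OF h] Z[OF C_k_on_r] Z[OF C_k_on_th] by (rule dd_complete[OF x])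
qed

lemma commute_R_G:
  assumes x: "x \<in> U" and h: "C_k_on (Suc (Suc 0)) U h"
  shows "R (G j h) x = G j (R h) x"
proof -
  have "R (G j r) x = 0" using dd_cong[OF open_U x G_r[where j=j], where A=RF] by simp
  moreover have "G j (R r) x = 0" using dd_cong[OF open_U x R_r, where A="GF j"] by simp
  moreover have "R (G j (th k)) x = 0" for k
  proof -
    have "R (G j (th k)) x = R (\<lambda>y. j \<bullet> k - th j y * th k y) x"
      by (rule dd_cong[OF open_U x G_th])
    also have "\<dots> = 0"
      using x by (subst dd_diff) (auto simp: dd_mult diff_th R_th intro!: differentiable_mult)
    finally show ?thesis .
  qed
  moreover have "G j (R (th k)) x = 0" for k using dd_cong[OF open_U x R_th[where j=k], where A="GF j"] by simp
  ultimately show ?thesis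
    using frame_commutator[OF x h C_k_on_RF C_k_on_GF[where j=j]] by simp
qed

text \<open>On each \<open>th k\<close> the commutator is explicit by \<open>G_th\<close>; for basis
  vectors the sum over \<open>k\<close> picks out single components.\<close>

lemma commutator_G_G:
  assumes x: "x \<in> U" and h: "C_k_on (Suc (Suc 0)) U h" and ij: "i \<in> Basis" "j \<in> Basis"
  shows "G i (G j h) x - G j (G i h) x = th i x * G j h x - th j x * G i h x"
proof -
  have gr: "G i (G j r) x = 0" for i j using dd_cong[OF open_U x G_r[where j=j], where A="GF i"] by simp
  have gt: "G i (G j (th k)) x = - (i \<bullet> j - th i x * th j x) * th k x - th j x * (i \<bullet> k - th i x * th k x)" for i j k
  proof -
    have "G i (G j (th k)) x = G i (\<lambda>y. j \<bullet> k - th j y * th k y) x"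
      by (rule dd_cong[OF open_U x G_th])
    also have "\<dots> = - G i (th j) x * th k x - th j x * G i (th k) x"
      using x by (subst dd_diff) (auto simp: dd_mult diff_th intro!: differentiable_mult)
    finally show ?thesis by (simp add: G_th[OF x])
  qed
  have "G i (G j h) x - G j (G i h) x
     = (\<Sum>k\<in>Basis. G k h x * (G i (G j (th k)) x - G j (G i (th k)) x))"
    using frame_commutator[OF x h C_k_on_GF[where j=i] C_k_on_GF[where j=j]] by (simp add: gr)
  also have "\<dots> = (\<Sum>k\<in>Basis. G k h x * (th i x * (j \<bullet> k) - th j x * (i \<bullet> k)))"
    by (intro sum.cong refl) (simp add: gt inner_commute[of j i] algebra_simps)
  also have "\<dots> = th i x * (\<Sum>k\<in>Basis. G k h x * (j \<bullet> k)) - th j x * (\<Sum>k\<in>Basis. G k h x * (i \<bullet> k))"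
    by (simp add: sum_distrib_left sum_subtractf algebra_simps)
  finally show ?thesis using ij by (simp add: inner_Basis if_distrib[of "(*) _"] cong: if_cong)
qed


subsection \<open>Divergence and Laplacian in the polar frame\<close>

text \<open>The volume density without the cut-off to the ball: the integrands below vanish off a
  compact subset of \<open>U\<close>.\<close>

definition w :: "'a \<Rightarrow> real" where "w x = hyp_factor x ^ DIM('a)"

lemma w_pos: "x \<in> U \<Longrightarrow> w x > 0"
  using hyp_factor_pos[of x] by (simp add: w_def)

lemma C_k_on_w: "C_k_on k U w"
  unfolding w_def[abs_def] by (intro C_k_on_power open_U C_k_on_factor)

lemma hyp_div_w: "hyp_div X x = (\<Sum>i\<in>Basis. partial_deriv i (\<lambda>y. w y * (X y \<bullet> i)) x) / w x"
  by (simp add: hyp_div_def w_def)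

lemma hyp_div_cong:
  assumes "x \<in> U" "\<And>y. y \<in> U \<Longrightarrow> X y = Y y"
  shows "hyp_div X x = hyp_div Y x"
  unfolding hyp_div_w
  by (intro arg_cong2[where f="(/)"] sum.cong refl partial_deriv_cong[OF open_U assms(1)]) (simp add: assms)

lemma w_field_differentiable:
  assumes "x \<in> U" "i \<in> Basis" "\<And>i. i \<in> Basis \<Longrightarrow> C_k_on (Suc 0) U (\<lambda>y. X y \<bullet> i)"
  shows "(\<lambda>y. w y * (X y \<bullet> i)) differentiable (at x)"
  by (rule C_k_on_differentiable[OF C_k_on_mult[OF open_U C_k_on_w assms(3)[OF assms(2)]] assms(1)])

lemma hyp_div_add:
  assumes x: "x \<in> U"
    and "\<And>i. i \<in> Basis \<Longrightarrow> C_k_on (Suc 0) U (\<lambda>y. X y \<bullet> i)"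
    and "\<And>i. i \<in> Basis \<Longrightarrow> C_k_on (Suc 0) U (\<lambda>y. Y y \<bullet> i)"
  shows "hyp_div (\<lambda>y. X y + Y y) x = hyp_div X x + hyp_div Y x"
proof -
  have "partial_deriv i (\<lambda>y. w y * ((X y + Y y) \<bullet> i)) x
    = partial_deriv i (\<lambda>y. w y * (X y \<bullet> i)) x + partial_deriv i (\<lambda>y. w y * (Y y \<bullet> i)) x" if i: "i \<in> Basis" for i
    using dd_add[OF w_field_differentiable[OF x i assms(2)] w_field_differentiable[OF x i assms(3)], of "\<lambda>_. i"]
    by (simp add: partial_deriv_dd[OF i] inner_add_left distrib_left)
  then show ?thesis by (simp add: hyp_div_w sum.distrib add_divide_distrib)
qed

lemma hyp_div_sum:
  assumes x: "x \<in> U" and "finite I"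
    and X: "\<And>k i. i \<in> Basis \<Longrightarrow> C_k_on (Suc 0) U (\<lambda>y. X k y \<bullet> i)"
  shows "hyp_div (\<lambda>y. \<Sum>k\<in>I. X k y) x = (\<Sum>k\<in>I. hyp_div (X k) x)"
  using assms(2)
proof (induction I)
  case empty
  show ?case by (simp add: hyp_div_def partial_deriv_def)
next
  case (insert k I)
  have "C_k_on (Suc 0) U (\<lambda>y. (\<Sum>k\<in>I. X k y) \<bullet> i)" if "i \<in> Basis" for i
    unfolding inner_sum_left by (intro C_k_on_sum open_U X that)
  then show ?case using insert hyp_div_add[OF x X] by simp
qed

lemma C_k_on_scaleR_grad:
  "C_k_on k U g \<Longrightarrow> C_k_on (Suc k) U \<phi> \<Longrightarrow> i \<in> Basis \<Longrightarrow> C_k_on k U (\<lambda>y. (g y *\<^sub>R hyp_grad \<phi> y) \<bullet> i)"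
  unfolding inner_scaleR_left by (intro C_k_on_mult open_U C_k_on_hyp_grad)

lemma hyp_div_grad:
  assumes x: "x \<in> U" and g: "g differentiable (at x)" and \<phi>: "C_k_on (Suc (Suc 0)) U \<phi>"
  shows "hyp_div (\<lambda>y. g y *\<^sub>R hyp_grad \<phi> y) x = hyp_gg \<phi> g x + g x * hyp_laplacian \<phi> x"
proof -
  have "partial_deriv i (\<lambda>y. w y * ((g y *\<^sub>R hyp_grad \<phi> y) \<bullet> i)) x
    = g x * partial_deriv i (\<lambda>y. w y * (hyp_grad \<phi> y \<bullet> i)) x + w x * ((hyp_grad \<phi> x \<bullet> i) * partial_deriv i g x)"
    if i: "i \<in> Basis" for i
    using dd_mult[OF g w_field_differentiable[OF x i C_k_on_hyp_grad[OF \<phi>]], of "\<lambda>_. i"]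
    by (simp add: partial_deriv_dd[OF i] mult_ac)
  then show ?thesis
    using w_pos[OF x]
    by (simp add: hyp_div_w hyp_laplacian_def sum.distrib sum_distrib_left[symmetric] add_divide_distrib
      dd_hyp_grad[symmetric] dd_def[of "hyp_grad \<phi>"])
qed

lemma hyp_grad_frame:
  assumes x: "x \<in> U"
  shows "hyp_grad h x = R h x *\<^sub>R hyp_grad r x + (\<Sum>k\<in>Basis. G k h x *\<^sub>R hyp_grad (th k) x)"
proof (rule euclidean_eqI)
  fix i :: 'a assume i: "i \<in> Basis"
  have "partial_deriv i h x = R h x * partial_deriv i r x + (\<Sum>k\<in>Basis. G k h x * partial_deriv i (th k) x)"
    using dd_complete[OF x, of "\<lambda>_. i" h] by (simp add: partial_deriv_dd[OF i])
  then show "hyp_grad h x \<bullet> i = (R h x *\<^sub>R hyp_grad r x + (\<Sum>k\<in>Basis. G k h x *\<^sub>R hyp_grad (th k) x)) \<bullet> i"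
    by (simp add: inner_add_left inner_sum_left hyp_grad_inner_Basis[OF i] add_divide_distrib sum_divide_distrib)
qed

text \<open>Since cosh r is an eigenfunction with gradient sinh r grad r, the product rule leaves a
  linear equation for the Laplacian of \<open>r\<close>.\<close>

lemma laplacian_r:
  assumes x: "x \<in> U"
  shows "hyp_laplacian r x = (real DIM('a) - 1) * C x / sh x"
proof -
  have "hyp_grad C y = sh y *\<^sub>R hyp_grad r y" if "y \<in> U" for y
    by (rule euclidean_eqI) (simp add: hyp_grad_inner_Basis partial_deriv_dd dd_C[OF that])
  then have "hyp_laplacian C x = hyp_div (\<lambda>y. sh y *\<^sub>R hyp_grad r y) x"
    unfolding hyp_laplacian_def by (rule hyp_div_cong[OF x])
  also have "\<dots> = C x + sh x * hyp_laplacian r x"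
    unfolding hyp_div_grad[OF x diff_sh[OF x] C_k_on_r]
    using dd_sh[OF x, of RF] R_r[OF x] by (simp add: RF_def dd_hyp_grad)
  finally have "real DIM('a) * C x = C x + sh x * hyp_laplacian r x"
    using hyp_laplacian_lorentz[OF U_hyp[OF x]] unfolding hyp_cosh_def by metis
  then show ?thesis using sh_pos[OF x] by (simp add: field_simps)
qed

text \<open>The same argument for the eigenfunction \<open>yc j\<close>, which is \<open>sh\<close>
  times \<open>th j\<close>. Up to 1/sinh^2 r this is the eigenvalue N - 1 of the coordinate
  functions on the sphere.\<close>

lemma laplacian_th:
  assumes x: "x \<in> U"
  shows "hyp_laplacian (th j) x = - (real DIM('a) - 1) * th j x / (sh x)\<^sup>2"
proof -
  have "hyp_grad (yc j) y = sh y *\<^sub>R hyp_grad (th j) y + (C y * th j y) *\<^sub>R hyp_grad r y" if "y \<in> U" for y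
    by (rule euclidean_eqI)
      (simp add: hyp_grad_inner_Basis partial_deriv_dd dd_yc[OF that] inner_simps add_divide_distrib)
  then have "hyp_laplacian (yc j) x = hyp_div (\<lambda>y. sh y *\<^sub>R hyp_grad (th j) y + (C y * th j y) *\<^sub>R hyp_grad r y) x"
    unfolding hyp_laplacian_def by (rule hyp_div_cong[OF x])
  also have "\<dots> = hyp_div (\<lambda>y. sh y *\<^sub>R hyp_grad (th j) y) x + hyp_div (\<lambda>y. (C y * th j y) *\<^sub>R hyp_grad r y) x"
    by (intro hyp_div_add x C_k_on_scaleR_grad C_k_on_mult open_U C_k_on_sh C_k_on_th C_k_on_C C_k_on_r)
  also have "hyp_div (\<lambda>y. sh y *\<^sub>R hyp_grad (th j) y) x = sh x * hyp_laplacian (th j) x"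
    unfolding hyp_div_grad[OF x diff_sh[OF x] C_k_on_th]
    using dd_sh[OF x, of "hyp_grad (th j)"] gg_th_r[OF x, of j] by (simp add: dd_hyp_grad)
  also have "hyp_div (\<lambda>y. (C y * th j y) *\<^sub>R hyp_grad r y) x
     = sh x * th j x + C x * th j x * ((real DIM('a) - 1) * C x / sh x)"
    unfolding hyp_div_grad[OF x differentiable_mult[OF diff_C[OF x] diff_th[OF x]] C_k_on_r] laplacian_r[OF x]
    using dd_mult[OF diff_C[OF x] diff_th[OF x], of RF j] R_C[OF x] R_th[OF x, of j]
    by (simp add: RF_def dd_hyp_grad)
  finally have "real DIM('a) * (sh x * th j x) = sh x * hyp_laplacian (th j) x
       + (sh x * th j x + C x * th j x * ((real DIM('a) - 1) * C x / sh x))"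
    using hyp_laplacian_lorentz[OF U_hyp[OF x]] unfolding yc_eq[OF x, symmetric] yc_def by metis
  moreover have "sh x * (C x * th j x * ((real DIM('a) - 1) * C x / sh x)) = (real DIM('a) - 1) * (C x)\<^sup>2 * th j x"
    using sh_pos[OF x] by (simp add: power2_eq_square)
  ultimately have "sh x * (sh x * hyp_laplacian (th j) x)
     = sh x * (real DIM('a) * (sh x * th j x) - sh x * th j x)
       - (real DIM('a) - 1) * (C x)\<^sup>2 * th j x"
    by (simp add: algebra_simps)
  also have "\<dots> = (real DIM('a) - 1) * th j x * ((sh x)\<^sup>2 - (C x)\<^sup>2)"
    by (simp add: algebra_simps power2_eq_square)
  also have "(sh x)\<^sup>2 - (C x)\<^sup>2 = - 1"
    using sh_sq[OF x] by simp
  finally show ?thesis using sh_pos[OF x] by (simp add: field_simps power2_eq_square)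
qed

lemma hyp_div_RF:
  assumes x: "x \<in> U" and g: "g differentiable (at x)"
  shows "hyp_div (\<lambda>y. g y *\<^sub>R RF y) x = R g x + (real DIM('a) - 1) * (C x / sh x) * g x"
  unfolding RF_def hyp_div_grad[OF x g C_k_on_r] laplacian_r[OF x] by (simp add: dd_hyp_grad)

text \<open>The fields \<open>GF j\<close> are not divergence free, because \<open>th j\<close> is a
  spherical eigenfunction. The extra terms cancel when summed over the components of a tangential
  vector.\<close>

lemma hyp_div_GF:
  assumes x: "x \<in> U" and g: "g differentiable (at x)"
  shows "hyp_div (\<lambda>y. g y *\<^sub>R GF j y) x = G j g x - (real DIM('a) - 1) * th j x * g x"
proof -
  have d: "(\<lambda>y. sh y * sh y) differentiable (at x)" by (intro differentiable_mult diff_sh x)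
  have "hyp_div (\<lambda>y. g y *\<^sub>R GF j y) x = hyp_div (\<lambda>y. (g y * (sh y * sh y)) *\<^sub>R hyp_grad (th j) y) x"
    by (simp add: GF_def power2_eq_square)
  also have "\<dots> = G j g x + g x * (sh x)\<^sup>2 * hyp_laplacian (th j) x"
    unfolding hyp_div_grad[OF x differentiable_mult[OF g d] C_k_on_th]
    using dd_mult[OF g d, of "hyp_grad (th j)"] dd_mult[OF diff_sh[OF x] diff_sh[OF x], of "hyp_grad (th j)"]
      dd_sh[OF x, of "hyp_grad (th j)"] gg_th_r[OF x, of j]
    by (simp add: dd_hyp_grad G_eq power2_eq_square mult_ac)
  also have "g x * (sh x)\<^sup>2 * hyp_laplacian (th j) x = - ((real DIM('a) - 1) * th j x * g x)"
    using sh_pos[OF x] by (simp add: laplacian_th[OF x]) (simp add: algebra_simps)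
  finally show ?thesis by simp
qed

lemma laplacian_polar:
  assumes x: "x \<in> U" and h: "C_k_on (Suc (Suc 0)) U h"
  shows "hyp_laplacian h x = R (R h) x + (real DIM('a) - 1) * (C x / sh x) * R h x
     + (\<Sum>k\<in>Basis. G k (G k h) x) / (sh x)\<^sup>2"
proof -
  have "hyp_laplacian h x
     = hyp_div (\<lambda>y. R h y *\<^sub>R hyp_grad r y + (\<Sum>k\<in>Basis. G k h y *\<^sub>R hyp_grad (th k) y)) x"
    unfolding hyp_laplacian_def by (rule hyp_div_cong[OF x hyp_grad_frame])
  also have "\<dots> = hyp_div (\<lambda>y. R h y *\<^sub>R hyp_grad r y) x
     + hyp_div (\<lambda>y. \<Sum>k\<in>Basis. G k h y *\<^sub>R hyp_grad (th k) y) x"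
  proof (rule hyp_div_add[OF x])
    fix i :: 'a assume i: "i \<in> Basis"
    show "C_k_on (Suc 0) U (\<lambda>y. (R h y *\<^sub>R hyp_grad r y) \<bullet> i)"
      by (rule C_k_on_scaleR_grad[OF C_k_on_R[OF h] C_k_on_r i])
    show "C_k_on (Suc 0) U (\<lambda>y. (\<Sum>k\<in>Basis. G k h y *\<^sub>R hyp_grad (th k) y) \<bullet> i)"
      unfolding inner_sum_left
      by (rule C_k_on_sum[OF open_U C_k_on_scaleR_grad[OF C_k_on_G[OF h] C_k_on_th i]])
  qed
  also have "hyp_div (\<lambda>y. \<Sum>k\<in>Basis. G k h y *\<^sub>R hyp_grad (th k) y) x
     = (\<Sum>k\<in>Basis. hyp_div (\<lambda>y. G k h y *\<^sub>R hyp_grad (th k) y) x)"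
    by (intro hyp_div_sum x finite_Basis C_k_on_scaleR_grad C_k_on_G h C_k_on_th)
  also have "\<dots> = (\<Sum>k\<in>Basis. G k (G k h) x / (sh x)\<^sup>2 - (real DIM('a) - 1) / (sh x)\<^sup>2 * (th k x * G k h x))"
  proof (intro sum.cong refl)
    fix k
    have "hyp_gg (th k) (G k h) x = G k (G k h) x / (sh x)\<^sup>2"
      using sh_pos[OF x] by (simp add: G_eq[of k "G k h"])
    moreover have "G k h x * hyp_laplacian (th k) x = - ((real DIM('a) - 1) / (sh x)\<^sup>2 * (th k x * G k h x))"
      using sh_pos[OF x] by (simp add: laplacian_th[OF x] field_simps)
    ultimately show "hyp_div (\<lambda>y. G k h y *\<^sub>R hyp_grad (th k) y) x
       = G k (G k h) x / (sh x)\<^sup>2 - (real DIM('a) - 1) / (sh x)\<^sup>2 * (th k x * G k h x)"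
      using hyp_div_grad[OF x C_k_on_differentiable[OF C_k_on_G[OF h] x] C_k_on_th] by simp
  qed
  also have "\<dots> = (\<Sum>k\<in>Basis. G k (G k h) x) / (sh x)\<^sup>2"
    by (simp add: sum_subtractf sum_divide_distrib[symmetric] sum_distrib_left[symmetric] sum_th_G[OF x])
  finally show ?thesis
    using hyp_div_RF[OF x C_k_on_differentiable[OF C_k_on_R[OF h] x]] by (simp add: RF_def)
qed

subsection \<open>Integration by parts\<close>

lemma hyp_div_integral_nonneg:
  assumes K: "compact K" "K \<subseteq> U"
    and d: "\<And>i x. i \<in> Basis \<Longrightarrow> x \<in> U \<Longrightarrow> (\<lambda>y. w y * (X y \<bullet> i)) differentiable (at x)"
    and X0: "\<And>y. y \<notin> K \<Longrightarrow> X y = 0"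
    and M: "\<And>i x. i \<in> Basis \<Longrightarrow> x \<in> K \<Longrightarrow> partial_deriv i (\<lambda>y. w y * (X y \<bullet> i)) x \<le> M"
  shows "integrable lborel (\<lambda>x. w x * hyp_div X x)" "0 \<le> (LINT x|lborel. w x * hyp_div X x)"
proof -
  have "w x * hyp_div X x = (\<Sum>i\<in>Basis. partial_deriv i (\<lambda>y. w y * (X y \<bullet> i)) x)" for x
  proof (cases "x \<in> K")
    case True
    then show ?thesis using w_pos[of x] K by (force simp: hyp_div_w)
  next
    case False
    then have "partial_deriv i (\<lambda>y. w y * (X y \<bullet> i)) x = 0" for i
      using X0 by (intro partial_deriv_outside[OF compact_imp_closed[OF K(1)]]) auto
    then show ?thesis by (simp add: hyp_div_w)
  qed
  then show "integrable lborel (\<lambda>x. w x * hyp_div X x)" "0 \<le> (LINT x|lborel. w x * hyp_div X x)"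
    using integral_divergence_nonneg[OF open_U K(2,1), of "\<lambda>i y. w y * (X y \<bullet> i)" M] d X0 M by auto
qed

text \<open>The one-sided statement for \<open>X\<close> and for its negative; continuity of the
  partial derivatives on \<open>K\<close> supplies both bounds.\<close>

lemma hyp_div_integral_zero:
  assumes K: "compact K" "K \<subseteq> U"
    and X: "\<And>i. i \<in> Basis \<Longrightarrow> C_k_on (Suc 0) U (\<lambda>y. X y \<bullet> i)"
    and X0: "\<And>y. y \<notin> K \<Longrightarrow> X y = 0"
  shows "integrable lborel (\<lambda>x. w x * hyp_div X x)" "(LINT x|lborel. w x * hyp_div X x) = 0"
proof -
  have *: "integrable lborel (\<lambda>x. w x * hyp_div X x) \<and> 0 \<le> (LINT x|lborel. w x * hyp_div X x)"
    if X: "\<And>i. i \<in> Basis \<Longrightarrow> C_k_on (Suc 0) U (\<lambda>y. X y \<bullet> i)" and X0: "\<And>y. y \<notin> K \<Longrightarrow> X y = 0" for X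
  proof -
    have 1: "C_k_on (Suc 0) U (\<lambda>y. w y * (X y \<bullet> i))" if "i \<in> Basis" for i
      by (intro C_k_on_mult open_U C_k_on_w X that)
    then have "continuous_on K (partial_deriv i (\<lambda>y. w y * (X y \<bullet> i)))" if "i \<in> Basis" for i
      using C_k_on_SucD(2)[OF 1 that] that K(2) by (auto intro: continuous_on_subset)
    then have "\<exists>M. \<forall>i\<in>Basis. \<forall>x\<in>K. partial_deriv i (\<lambda>y. w y * (X y \<bullet> i)) x \<le> M"
      by (rule continuous_bounded_above[OF K(1) finite_Basis])
    then obtain M where M: "\<And>i x. i \<in> Basis \<Longrightarrow> x \<in> K \<Longrightarrow> partial_deriv i (\<lambda>y. w y * (X y \<bullet> i)) x \<le> M"
      by auto
    show ?thesis
      using hyp_div_integral_nonneg[OF K C_k_on_differentiable[OF 1] X0 M] by blast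
  qed
  show i: "integrable lborel (\<lambda>x. w x * hyp_div X x)" using *[OF X X0] by blast
  have neg: "hyp_div (\<lambda>y. - X y) x = - hyp_div X x" if "x \<in> U" for x
  proof -
    have "hyp_div (\<lambda>y. - X y + X y) x = hyp_div (\<lambda>y. - X y) x + hyp_div X x"
      by (intro hyp_div_add that X) (unfold inner_minus_left, intro C_k_on_uminus open_U X)
    then show ?thesis by (simp add: hyp_div_def partial_deriv_def)
  qed
  have "w x * hyp_div (\<lambda>y. - X y) x = - (w x * hyp_div X x)" for x
  proof (cases "x \<in> K")
    case True
    then have "x \<in> U" using K by auto
    then show ?thesis by (simp only: neg)
  next
    case False
    then have "partial_deriv i (\<lambda>y. w y * (X y \<bullet> i)) x = 0" "partial_deriv i (\<lambda>y. w y * (- X y \<bullet> i)) x = 0" for i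
      using X0 by (intro partial_deriv_outside[OF compact_imp_closed[OF K(1)]]; auto)+
    then show ?thesis by (simp add: hyp_div_w)
  qed
  moreover have "0 \<le> (LINT x|lborel. w x * hyp_div (\<lambda>y. - X y) x)"
  proof -
    have "C_k_on (Suc 0) U (\<lambda>y. - X y \<bullet> i)" if "i \<in> Basis" for i
      unfolding inner_minus_left by (intro C_k_on_uminus open_U X that)
    then show ?thesis using *[of "\<lambda>y. - X y"] X0 by simp
  qed
  ultimately have "0 \<le> - (LINT x|lborel. w x * hyp_div X x)" by simp
  then show "(LINT x|lborel. w x * hyp_div X x) = 0" using *[OF X X0] by simp
qed

lemma radial_integral:
  assumes K: "compact K" "K \<subseteq> U" and g: "C_k_on (Suc 0) U g" "\<And>y. y \<notin> K \<Longrightarrow> g y = 0"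
  shows "integrable lborel (\<lambda>x. w x * (R g x + (real DIM('a) - 1) * (C x / sh x) * g x))"
    "(LINT x|lborel. w x * (R g x + (real DIM('a) - 1) * (C x / sh x) * g x)) = 0"
proof -
  have eq: "w x * hyp_div (\<lambda>y. g y *\<^sub>R RF y) x = w x * (R g x + (real DIM('a) - 1) * (C x / sh x) * g x)" for x
  proof (cases "x \<in> K")
    case True
    then have "x \<in> U" using K by auto
    then show ?thesis by (simp only: hyp_div_RF[OF _ C_k_on_differentiable[OF g(1)]])
  next
    case False
    then have "partial_deriv i (\<lambda>y. w y * ((g y *\<^sub>R RF y) \<bullet> i)) x = 0" for i
      using g(2) by (intro partial_deriv_outside[OF compact_imp_closed[OF K(1)]]) auto
    moreover have "R g x = 0" "g x = 0"
      using False g(2) dd_outside[OF compact_imp_closed[OF K(1)] g(2)] by auto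
    ultimately show ?thesis by (simp add: hyp_div_w)
  qed
  have "C_k_on (Suc 0) U (\<lambda>y. (g y *\<^sub>R RF y) \<bullet> i)" if "i \<in> Basis" for i
    unfolding inner_scaleR_left by (intro C_k_on_mult open_U g C_k_on_RF that)
  moreover have "g y *\<^sub>R RF y = 0" if "y \<notin> K" for y using g(2)[OF that] by simp
  ultimately show "integrable lborel (\<lambda>x. w x * (R g x + (real DIM('a) - 1) * (C x / sh x) * g x))"
    "(LINT x|lborel. w x * (R g x + (real DIM('a) - 1) * (C x / sh x) * g x)) = 0"
    using hyp_div_integral_zero[OF K, of "\<lambda>y. g y *\<^sub>R RF y"] g(2) unfolding eq by blast+
qed

lemma tangential_integral:
  assumes K: "compact K" "K \<subseteq> U" and g: "C_k_on (Suc 0) U g" "\<And>y. y \<notin> K \<Longrightarrow> g y = 0"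
  shows "integrable lborel (\<lambda>x. w x * (G j g x - (real DIM('a) - 1) * th j x * g x))"
    "(LINT x|lborel. w x * (G j g x - (real DIM('a) - 1) * th j x * g x)) = 0"
proof -
  have eq: "w x * hyp_div (\<lambda>y. g y *\<^sub>R GF j y) x = w x * (G j g x - (real DIM('a) - 1) * th j x * g x)" for x
  proof (cases "x \<in> K")
    case True
    then have "x \<in> U" using K by auto
    then show ?thesis by (simp only: hyp_div_GF[OF _ C_k_on_differentiable[OF g(1)]])
  next
    case False
    then have "partial_deriv i (\<lambda>y. w y * ((g y *\<^sub>R GF j y) \<bullet> i)) x = 0" for i
      using g(2) by (intro partial_deriv_outside[OF compact_imp_closed[OF K(1)]]) auto
    moreover have "G j g x = 0" "g x = 0"
      using False g(2) dd_outside[OF compact_imp_closed[OF K(1)] g(2)] by auto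
    ultimately show ?thesis by (simp add: hyp_div_w)
  qed
  have "C_k_on (Suc 0) U (\<lambda>y. (g y *\<^sub>R GF j y) \<bullet> i)" if "i \<in> Basis" for i
    unfolding inner_scaleR_left by (intro C_k_on_mult open_U g C_k_on_GF that)
  moreover have "g y *\<^sub>R GF j y = 0" if "y \<notin> K" for y using g(2)[OF that] by simp
  ultimately show "integrable lborel (\<lambda>x. w x * (G j g x - (real DIM('a) - 1) * th j x * g x))"
    "(LINT x|lborel. w x * (G j g x - (real DIM('a) - 1) * th j x * g x)) = 0"
    using hyp_div_integral_zero[OF K, of "\<lambda>y. g y *\<^sub>R GF j y"] g(2) unfolding eq by blast+
qed

text \<open>Serves a weight whose derivative is merely bounded above by a continuous function. In
  each partial derivative \<open>A'\<close> is multiplied by \<open>k\<close> and a square, so its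
  upper bound carries over.\<close>

lemma radial_integral_one_sided:
  assumes K: "compact K" "K \<subseteq> U" and k: "C_k_on (Suc 0) U k" "\<And>y. y \<notin> K \<Longrightarrow> k y = 0" "\<And>y. k y \<ge> 0"
    and A: "\<And>s. s > 0 \<Longrightarrow> (A has_real_derivative A' s) (at s)"
    and B: "\<And>s. s > 0 \<Longrightarrow> A' s \<le> B s" "continuous_on {0<..} B"
  shows "integrable lborel (\<lambda>x. w x * (A' (r x) * k x + A (r x) * R k x + (real DIM('a) - 1) * (C x / sh x) * (A (r x) * k x)))"
    "0 \<le> (LINT x|lborel. w x * (A' (r x) * k x + A (r x) * R k x + (real DIM('a) - 1) * (C x / sh x) * (A (r x) * k x)))"
proof -
  define g where "g y = A (r y) * k y" for y
  define q where "q i y = w y * k y * (RF y \<bullet> i)" for i y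
  have dA: "(\<lambda>y. A (r y)) differentiable (at x)" "dd Z (\<lambda>y. A (r y)) x = A' (r x) * dd Z r x" if "x \<in> U" for x Z
  proof -
    show "dd Z (\<lambda>y. A (r y)) x = A' (r x) * dd Z r x"
      by (rule dd_compose[OF diff_r[OF that] A[OF r_pos[OF that]]])
    show "(\<lambda>y. A (r y)) differentiable (at x)"
      using DERIV_compose_FDERIV[OF A[OF r_pos[OF that]] diff_r[OF that, unfolded frechet_derivative_works]]
      by (rule differentiableI)
  qed
  have dk: "k differentiable (at x)" if "x \<in> U" for x using C_k_on_differentiable[OF k(1) that] .
  have dg: "g differentiable (at x)" if "x \<in> U" for x
    unfolding g_def[abs_def] by (intro differentiable_mult dA dk that)
  have Rg: "R g x = A' (r x) * k x + A (r x) * R k x" if "x \<in> U" for x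
    unfolding g_def[abs_def] dd_mult[OF dA(1)[OF that] dk[OF that]] dA(2)[OF that] R_r[OF that] by simp
  have eq: "w x * hyp_div (\<lambda>y. g y *\<^sub>R RF y) x = w x * (A' (r x) * k x + A (r x) * R k x + (real DIM('a) - 1) * (C x / sh x) * (A (r x) * k x))" for x
  proof (cases "x \<in> K")
    case True
    then have "x \<in> U" using K by auto
    then show ?thesis by (simp only: hyp_div_RF[OF _ dg] Rg) (simp add: g_def)
  next
    case False
    then have "partial_deriv i (\<lambda>y. w y * ((g y *\<^sub>R RF y) \<bullet> i)) x = 0" for i
      using k(2) by (intro partial_deriv_outside[OF compact_imp_closed[OF K(1)]]) (auto simp: g_def)
    moreover have "R k x = 0" "k x = 0"
      using False k(2) dd_outside[OF compact_imp_closed[OF K(1)] k(2)] by auto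
    ultimately show ?thesis by (simp add: hyp_div_w)
  qed
  have Cq: "C_k_on (Suc 0) U (q i)" if "i \<in> Basis" for i
    unfolding q_def[abs_def] by (intro C_k_on_mult open_U C_k_on_w k C_k_on_RF that)
  \<comment> \<open>\<open>A\<close> is kept apart because its derivative need not be continuous,
    whereas the cofactor \<open>q i\<close> is C^1.\<close>
  have split: "(\<lambda>y. w y * ((g y *\<^sub>R RF y) \<bullet> i)) = (\<lambda>y. A (r y) * q i y)" for i
    by (simp add: fun_eq_iff g_def q_def)
  have d: "(\<lambda>y. w y * ((g y *\<^sub>R RF y) \<bullet> i)) differentiable (at x)" if "i \<in> Basis" "x \<in> U" for i x
    unfolding split by (intro differentiable_mult dA that C_k_on_differentiable[OF Cq])
  have rU: "r ` K \<subseteq> {0<..}" using K r_pos by auto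
  have cr: "continuous_on K r" using C_k_on_continuous[OF C_k_on_r[of 0]] K(2) continuous_on_subset by blast
  have "continuous_on {0<..} A" using A DERIV_isCont by (auto intro!: continuous_at_imp_continuous_on)
  then have cA: "continuous_on K (\<lambda>x. A (r x))" by (rule continuous_on_compose2[OF _ cr rU])
  have cB: "continuous_on K (\<lambda>x. B (r x))" by (rule continuous_on_compose2[OF B(2) cr rU])
  have c: "continuous_on K (\<lambda>x. A (r x) * partial_deriv i (q i) x + B (r x) * (partial_deriv i r x * q i x))"
    if "i \<in> Basis" for i
  proof -
    have "continuous_on K (partial_deriv i (q i))" "continuous_on K (partial_deriv i r)" "continuous_on K (q i)"
      using C_k_on_SucD(2)[OF Cq that] C_k_on_SucD(2)[OF C_k_on_r[of "Suc 0"] that]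
        C_k_on_continuous[OF Cq[OF that]] that K(2) by (auto intro: continuous_on_subset)
    then show ?thesis by (intro continuous_intros cA cB)
  qed
  have "\<exists>M. \<forall>i\<in>Basis. \<forall>x\<in>K. A (r x) * partial_deriv i (q i) x + B (r x) * (partial_deriv i r x * q i x) \<le> M"
    by (rule continuous_bounded_above[OF K(1) finite_Basis c])
  then obtain M where M: "\<And>i x. i \<in> Basis \<Longrightarrow> x \<in> K \<Longrightarrow>
      A (r x) * partial_deriv i (q i) x + B (r x) * (partial_deriv i r x * q i x) \<le> M"
    by auto
  have le: "partial_deriv i (\<lambda>y. w y * ((g y *\<^sub>R RF y) \<bullet> i)) x \<le> M" if i: "i \<in> Basis" and "x \<in> K" for i x
  proof -
    have x: "x \<in> U" using that K by auto
    have "partial_deriv i (\<lambda>y. w y * ((g y *\<^sub>R RF y) \<bullet> i)) x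
       = A (r x) * partial_deriv i (q i) x + A' (r x) * (partial_deriv i r x * q i x)"
      unfolding split partial_deriv_dd[OF i]
      by (simp add: dd_mult[OF dA(1)[OF x] C_k_on_differentiable[OF Cq[OF i] x]] dA(2)[OF x])
    also have "\<dots> \<le> A (r x) * partial_deriv i (q i) x + B (r x) * (partial_deriv i r x * q i x)"
    proof (intro add_left_mono mult_right_mono B r_pos x)
      have "partial_deriv i r x * q i x = w x * k x * ((partial_deriv i r x)\<^sup>2 / (hyp_factor x)\<^sup>2)"
        by (simp add: q_def RF_def hyp_grad_inner_Basis[OF i] power2_eq_square)
      also have "\<dots> \<ge> 0"
        using w_pos[OF x] k(3)[of x] by simp
      finally show "0 \<le> partial_deriv i r x * q i x" .
    qed
    also have "\<dots> \<le> M" using M that by blast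
    finally show ?thesis .
  qed
  have X0: "g y *\<^sub>R RF y = 0" if "y \<notin> K" for y using k(2)[OF that] by (simp add: g_def)
  show "integrable lborel (\<lambda>x. w x * (A' (r x) * k x + A (r x) * R k x + (real DIM('a) - 1) * (C x / sh x) * (A (r x) * k x)))"
    "0 \<le> (LINT x|lborel. w x * (A' (r x) * k x + A (r x) * R k x + (real DIM('a) - 1) * (C x / sh x) * (A (r x) * k x)))"
    using hyp_div_integral_nonneg[OF K d X0 le] unfolding eq by blast+
qed

lemma hyp_volume_integral:
  assumes K: "compact K" "K \<subseteq> U" and F: "continuous_on K F" "\<And>y. y \<notin> K \<Longrightarrow> F y = 0"
  shows "(LINT x|hyp_volume. F x) = (LINT x|lborel. w x * F x)"
    "integrable lborel (\<lambda>x. w x * F x)"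
proof -
  have m: "F \<in> borel_measurable borel"
  proof -
    have "(\<lambda>x. indicator K x *\<^sub>R F x) \<in> borel_measurable borel"
      by (rule borel_measurable_continuous_on_indicator) (use K F borel_closed[OF compact_imp_closed] in auto)
    also have "(\<lambda>x. indicator K x *\<^sub>R F x) = F"
      using F(2) by (auto simp: indicator_def fun_eq_iff)
    finally show ?thesis .
  qed
  have h: "hyp_space \<in> sets (borel :: 'a measure)" by (rule borel_open[OF open_hyp_space])
  have e: "(hyp_volume :: 'a measure) = density lborel (\<lambda>x. ennreal (indicator hyp_space x * hyp_factor x ^ DIM('a)))"
    unfolding hyp_volume_def by (intro arg_cong[where f="density lborel"]) (auto simp: indicator_def fun_eq_iff)
  have "(LINT x|hyp_volume. F x) = (LINT x|lborel. (indicator hyp_space x * hyp_factor x ^ DIM('a)) *\<^sub>R F x)"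
    unfolding e
  proof (rule integral_density)
    show "AE x in (lborel :: 'a measure). 0 \<le> indicator hyp_space x * hyp_factor x ^ DIM('a)"
      by (intro AE_I2) (simp add: indicator_def hyp_factor_pos less_imp_le)
    show "(\<lambda>x::'a. indicator hyp_space x * hyp_factor x ^ DIM('a)) \<in> borel_measurable lborel"
      using h unfolding hyp_factor_def by measurable
  qed (use m in simp)
  also have "(\<lambda>x. (indicator hyp_space x * hyp_factor x ^ DIM('a)) *\<^sub>R F x) = (\<lambda>x. w x * F x)"
  proof
    fix x show "(indicator hyp_space x * hyp_factor x ^ DIM('a)) *\<^sub>R F x = w x * F x"
      using F(2)[of x] K(2) by (cases "x \<in> K") (auto simp: w_def indicator_def)
  qed
  finally show "(LINT x|hyp_volume. F x) = (LINT x|lborel. w x * F x)" .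
  show "integrable lborel (\<lambda>x. w x * F x)"
  proof (rule continuous_compact_support_integrable[OF K(1)])
    show "continuous_on K (\<lambda>x. w x * F x)"
      using C_k_on_continuous[OF C_k_on_w[of 0]] K(2) F(1) by (intro continuous_on_mult) (auto intro: continuous_on_subset)
  qed (simp add: F(2))
qed

end

section \<open>The weighted Rellich inequality\<close>

context hyp_pole
begin

lemma r_compose:
  assumes A: "\<And>s. s > 0 \<Longrightarrow> (A has_real_derivative A' s) (at s)"
  shows "x \<in> U \<Longrightarrow> dd Z (\<lambda>y. A (r y)) x = A' (r x) * dd Z r x"
    "continuous_on {0<..} A' \<Longrightarrow> C_k_on (Suc 0) U (\<lambda>y. A (r y))"
proof -
  show "dd Z (\<lambda>y. A (r y)) x = A' (r x) * dd Z r x" if "x \<in> U"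
    by (rule dd_compose[OF diff_r[OF that] A[OF r_pos[OF that]]])
  show "C_k_on (Suc 0) U (\<lambda>y. A (r y))" if "continuous_on {0<..} A'"
    by (rule C_1_on_compose[OF open_U C_k_on_r _ open_greaterThan A that]) (use r_pos in auto)
qed

lemma radial_weight_integral:
  assumes K: "compact K" "K \<subseteq> U" and k: "C_k_on (Suc 0) U k" "\<And>y. y \<notin> K \<Longrightarrow> k y = 0"
    and A: "\<And>s. s > 0 \<Longrightarrow> (A has_real_derivative A' s) (at s)" "continuous_on {0<..} A'"
  shows "integrable lborel (\<lambda>x. w x * (A' (r x) * k x + A (r x) * R k x + (real DIM('a) - 1) * (C x / sh x) * (A (r x) * k x)))"
    "(LINT x|lborel. w x * (A' (r x) * k x + A (r x) * R k x + (real DIM('a) - 1) * (C x / sh x) * (A (r x) * k x))) = 0"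
proof -
  have g: "C_k_on (Suc 0) U (\<lambda>y. A (r y) * k y)"
    by (intro C_k_on_mult open_U k r_compose(2)[OF A])
  have eq: "w x * (R (\<lambda>y. A (r y) * k y) x + (real DIM('a) - 1) * (C x / sh x) * (A (r x) * k x))
    = w x * (A' (r x) * k x + A (r x) * R k x + (real DIM('a) - 1) * (C x / sh x) * (A (r x) * k x))" for x
  proof (cases "x \<in> K")
    case True
    then have x: "x \<in> U" using K by auto
    have "R (\<lambda>y. A (r y) * k y) x = A (r x) * R k x + R (\<lambda>y. A (r y)) x * k x"
      by (intro dd_mult C_k_on_differentiable[OF r_compose(2)[OF A] x] C_k_on_differentiable[OF k(1) x])
    also have "R (\<lambda>y. A (r y)) x = A' (r x)"
      using r_compose(1)[OF A(1) x, of RF] R_r[OF x] by simp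
    finally show ?thesis by simp
  next
    case False
    note cl = compact_imp_closed[OF K(1)]
    have "R (\<lambda>y. A (r y) * k y) x = 0" "R k x = 0"
      using False k(2) by (auto intro!: dd_outside[OF cl])
    then show ?thesis using False k(2) by simp
  qed
  show "integrable lborel (\<lambda>x. w x * (A' (r x) * k x + A (r x) * R k x + (real DIM('a) - 1) * (C x / sh x) * (A (r x) * k x)))"
    "(LINT x|lborel. w x * (A' (r x) * k x + A (r x) * R k x + (real DIM('a) - 1) * (C x / sh x) * (A (r x) * k x))) = 0"
    using radial_integral[OF K g] k(2) unfolding eq by simp_all
qed

text \<open>Radial weights pass through the angular fields because \<open>G j r\<close> vanishes, so
  no derivative of \<open>A\<close> occurs.\<close>

lemma tangential_weight_integral:
  assumes K: "compact K" "K \<subseteq> U"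
    and k: "\<And>j. j \<in> Basis \<Longrightarrow> C_k_on (Suc 0) U (k j)" "\<And>j y. y \<notin> K \<Longrightarrow> k j y = 0"
    and A: "\<And>s. s > 0 \<Longrightarrow> (A has_real_derivative A' s) (at s)" "continuous_on {0<..} A'"
  shows "integrable lborel (\<lambda>x. w x * (A (r x) * (\<Sum>j\<in>Basis. G j (k j) x - (real DIM('a) - 1) * th j x * k j x)))"
    "(LINT x|lborel. w x * (A (r x) * (\<Sum>j\<in>Basis. G j (k j) x - (real DIM('a) - 1) * th j x * k j x))) = 0"
proof -
  define D where "D j x = w x * (G j (\<lambda>y. A (r y) * k j y) x - (real DIM('a) - 1) * th j x * (A (r x) * k j x))" for j x
  have g: "C_k_on (Suc 0) U (\<lambda>y. A (r y) * k j y)" if "j \<in> Basis" for j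
    by (intro C_k_on_mult open_U k that r_compose(2)[OF A])
  have D: "integrable lborel (D j)" "(LINT x|lborel. D j x) = 0" if "j \<in> Basis" for j
    using tangential_integral[OF K g[OF that], of j] k(2) by (auto simp: D_def[abs_def])
  have eq: "(\<Sum>j\<in>Basis. D j x) = w x * (A (r x) * (\<Sum>j\<in>Basis. G j (k j) x - (real DIM('a) - 1) * th j x * k j x))" for x
    unfolding sum_distrib_left
  proof (rule sum.cong[OF refl])
    fix j :: 'a assume j: "j \<in> Basis"
    show "D j x = w x * (A (r x) * (G j (k j) x - (real DIM('a) - 1) * th j x * k j x))"
    proof (cases "x \<in> K")
      case True
      then have x: "x \<in> U" using K by auto
      have "G j (\<lambda>y. A (r y) * k j y) x = A (r x) * G j (k j) x + G j (\<lambda>y. A (r y)) x * k j x"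
        by (intro dd_mult C_k_on_differentiable[OF r_compose(2)[OF A] x] C_k_on_differentiable[OF k(1)[OF j] x])
      also have "G j (\<lambda>y. A (r y)) x = 0"
        using r_compose(1)[OF A(1) x, of "GF j"] G_r[OF x] by simp
      finally show ?thesis by (simp add: D_def algebra_simps)
    next
      case False
      note cl = compact_imp_closed[OF K(1)]
      have "G j (\<lambda>y. A (r y) * k j y) x = 0" "G j (k j) x = 0"
        using False k(2) by (auto intro!: dd_outside[OF cl])
      then show ?thesis using False k(2) by (simp add: D_def)
    qed
  qed
  show "integrable lborel (\<lambda>x. w x * (A (r x) * (\<Sum>j\<in>Basis. G j (k j) x - (real DIM('a) - 1) * th j x * k j x)))"
    unfolding eq[symmetric] by (rule Bochner_Integration.integrable_sum[OF D(1)])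
  show "(LINT x|lborel. w x * (A (r x) * (\<Sum>j\<in>Basis. G j (k j) x - (real DIM('a) - 1) * th j x * k j x))) = 0"
    unfolding eq[symmetric] by (subst Bochner_Integration.integral_sum[OF D(1)]) (auto simp: D(2))
qed

end

subsection \<open>Pointwise identities\<close>

text \<open>On the sphere \<open>M\<close> plays the role of the matrix \<open>G\<^sub>i v\<^sub>j\<close> with \<open>v\<close> a gradient; up to the rank one
  correction \<open>v\<^sub>i \<theta>\<^sub>j\<close> it is the Hessian, a symmetric form on the \<open>(N - 1)\<close>-dimensional tangent space.\<close>

lemma tangential_trace_ineq:
  fixes M :: "'a::euclidean_space \<Rightarrow> 'a \<Rightarrow> real"
  assumes \<theta>: "(\<Sum>i\<in>Basis. \<theta> i * \<theta> i) = 1" and v: "(\<Sum>i\<in>Basis. \<theta> i * v i) = 0"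
    and sym: "\<And>i j. i \<in> Basis \<Longrightarrow> j \<in> Basis \<Longrightarrow> M i j - M j i = \<theta> i * v j - \<theta> j * v i"
    and tan: "\<And>j. j \<in> Basis \<Longrightarrow> (\<Sum>i\<in>Basis. \<theta> i * M i j) = 0"
    and N: "DIM('a) > 1"
  shows "(\<Sum>i\<in>Basis. M i i)\<^sup>2 \<le> (real DIM('a) - 1) * (\<Sum>i\<in>Basis. \<Sum>j\<in>Basis. M i j * M j i)"
proof -
  define H where "H i j = M i j + v i * \<theta> j" for i j
  \<comment> \<open>The projection onto the tangent space, in the role of the identity matrix: its
    product with \<open>H\<close> is the trace \<open>L\<close>, and its square norm is the
    dimension \<open>n\<close>.\<close>
  define P where "P i j = (if i = j then 1 else 0) - \<theta> i * \<theta> j" for i j :: 'a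
  define L where "L = (\<Sum>i\<in>Basis. M i i)"
  define n where "n = real DIM('a) - 1"
  have n: "n > 0" using N by (simp add: n_def)
  have Hs: "H i j = H j i" if "i \<in> Basis" "j \<in> Basis" for i j
    using sym[OF that] by (simp add: H_def algebra_simps)
  have tH: "(\<Sum>i\<in>Basis. \<theta> i * H i j) = 0" if "j \<in> Basis" for j
  proof -
    have "(\<Sum>i\<in>Basis. \<theta> i * H i j) = (\<Sum>i\<in>Basis. \<theta> i * M i j) + (\<Sum>i\<in>Basis. \<theta> i * v i) * \<theta> j"
      by (simp add: H_def algebra_simps sum.distrib sum_distrib_left)
    then show ?thesis by (simp add: v tan[OF that])
  qed
  have HH: "(\<Sum>i\<in>Basis. \<Sum>j\<in>Basis. H i j * H i j) = (\<Sum>i\<in>Basis. \<Sum>j\<in>Basis. M i j * M j i)"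
  proof -
    have "(\<Sum>i\<in>Basis. \<Sum>j\<in>Basis. H i j * H i j) = (\<Sum>i\<in>Basis. \<Sum>j\<in>Basis. H i j * H j i)"
      by (intro sum.cong refl) (simp add: Hs)
    also have "\<dots> = (\<Sum>i\<in>Basis. \<Sum>j\<in>Basis. M i j * M j i + v j * (\<theta> i * M i j) + v i * (\<theta> j * H j i))"
      by (intro sum.cong refl) (simp add: H_def algebra_simps)
    also have "\<dots> = (\<Sum>i\<in>Basis. \<Sum>j\<in>Basis. M i j * M j i)
        + (\<Sum>j\<in>Basis. v j * (\<Sum>i\<in>Basis. \<theta> i * M i j)) + (\<Sum>i\<in>Basis. v i * (\<Sum>j\<in>Basis. \<theta> j * H j i))"
      unfolding sum.distrib sum_distrib_left by (subst sum.swap[of "\<lambda>i j. v j * (\<theta> i * M i j)"]) simp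
    also have "\<dots> = (\<Sum>i\<in>Basis. \<Sum>j\<in>Basis. M i j * M j i)"
      by (simp add: tan tH)
    finally show ?thesis .
  qed
  have HP: "(\<Sum>i\<in>Basis. \<Sum>j\<in>Basis. H i j * P i j) = L"
  proof -
    have "(\<Sum>i\<in>Basis. \<Sum>j\<in>Basis. H i j * P i j)
      = (\<Sum>i\<in>Basis. \<Sum>j\<in>Basis. (if i = j then H i j else 0) - \<theta> j * (\<theta> i * H i j))"
      by (intro sum.cong refl) (simp add: P_def algebra_simps)
    also have "\<dots> = (\<Sum>i\<in>Basis. H i i) - (\<Sum>j\<in>Basis. \<theta> j * (\<Sum>i\<in>Basis. \<theta> i * H i j))"
      unfolding sum_subtractf sum_distrib_left by (subst sum.swap[of "\<lambda>i j. \<theta> j * (\<theta> i * H i j)"]) simp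
    also have "\<dots> = (\<Sum>i\<in>Basis. H i i)" by (simp add: tH)
    also have "\<dots> = (\<Sum>i\<in>Basis. M i i) + (\<Sum>i\<in>Basis. \<theta> i * v i)"
      by (simp add: H_def sum.distrib mult.commute)
    finally show ?thesis by (simp add: v L_def)
  qed
  have PP: "(\<Sum>i\<in>Basis. \<Sum>j\<in>Basis. P i j * P i j) = n"
  proof -
    have "(\<Sum>i\<in>Basis. \<Sum>j\<in>Basis. P i j * P i j)
      = (\<Sum>i\<in>Basis. \<Sum>j\<in>Basis. (if i = j then 1 - 2 * (\<theta> i * \<theta> i) else 0) + (\<theta> i * \<theta> i) * (\<theta> j * \<theta> j))"
      by (intro sum.cong refl) (auto simp: P_def algebra_simps)
    also have "\<dots> = real DIM('a) - 2 + 1"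
      by (simp add: sum.distrib sum_subtractf sum_distrib_left[symmetric] sum_distrib_right[symmetric] \<theta>)
    finally show ?thesis by (simp add: n_def)
  qed
  \<comment> \<open>The squared norm of the trace-free part of \<open>H\<close>, scaled by
    \<open>n\<close> to avoid a quotient.\<close>
  have "0 \<le> (\<Sum>i\<in>Basis. \<Sum>j\<in>Basis. (n * H i j - L * P i j)\<^sup>2)"
    by (intro sum_nonneg) simp
  also have "\<dots> = (\<Sum>i\<in>Basis. \<Sum>j\<in>Basis. n\<^sup>2 * (H i j * H i j) - 2 * n * L * (H i j * P i j) + L\<^sup>2 * (P i j * P i j))"
    by (intro sum.cong refl) (simp add: power2_eq_square algebra_simps)
  also have "\<dots> = n\<^sup>2 * (\<Sum>i\<in>Basis. \<Sum>j\<in>Basis. M i j * M j i) - 2 * n * L * L + L\<^sup>2 * n"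
    by (simp add: sum.distrib sum_subtractf sum_distrib_left[symmetric] HH HP PP)
  finally have "n * L\<^sup>2 \<le> n * (n * (\<Sum>i\<in>Basis. \<Sum>j\<in>Basis. M i j * M j i))"
    by (simp add: power2_eq_square algebra_simps)
  then show ?thesis using n by (simp add: L_def n_def)
qed

text \<open>With \<open>c = coth r\<close>, \<open>t = 1 / sinh\<^sup>2 r\<close>, \<open>m = 1 / r\<close> and \<open>\<phi> = f' / f\<close>: the difference of the two
  integrands is the sum of the divergences (the lines of the right-hand side up to the one with
  \<open>T - L\<^sup>2\<close>) and of three nonnegative terms.\<close>

lemma rellich_pointwise:
  fixes V V1 V2 W \<phi> c t m n p q L Q Q1 X S T :: real
  assumes c: "c * c = 1 + t" and n: "n > 1"
  shows "V * (q + n * c * p + L * t)\<^sup>2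
      - (W * (p\<^sup>2 + Q * t) + n * ((V * t - V1 * c) * (p\<^sup>2 + Q * t))
         - n * (V * \<phi> * (c - m) * (p\<^sup>2 + Q * t)) + V * ((q - \<phi> * p)\<^sup>2 + Q1 * t))
    = n * ((V1 * c - V * t) * p\<^sup>2 + V * c * (2 * p * q) + n * c * (V * c * p\<^sup>2))
      + 2 * (V * t * (S + q * L))
      + 2 * n * (V * c * t * (X + p * L))
      - 2 * ((V1 * t - 2 * V * c * t) * X + V * t * (Q1 + S) + n * c * (V * t * X))
      + ((V2 - 4 * V1 * c + 2 * V * t + 4 * V * c * c) * t * Q + (V1 * t - 2 * V * c * t) * (2 * X)
          + n * c * ((V1 * t - 2 * V * c * t) * Q))
      + ((- W - n * m * (V * \<phi>) - V * \<phi> * \<phi>) * p\<^sup>2 + V * \<phi> * (2 * p * q) + n * c * (V * \<phi> * p\<^sup>2))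
      + ((- W - n * m * (V * \<phi>) - V * \<phi> * \<phi> - 2 * c * (V * \<phi>)) * t * Q + V * \<phi> * t * (2 * X)
          + n * c * (V * \<phi> * t * Q))
      + ((V1 * c - V * t - 2 * V * c * c) * t * Q + V * c * t * (2 * X) + n * c * (V * c * t * Q))
      + n / (n - 1) * (V * t * t * (L\<^sup>2 - T - (n - 1) * Q))
      + (V * t * (Q1 - 2 * (c + \<phi>) * X + (c + \<phi>)\<^sup>2 * Q)
         + V * t * t * ((n * T - L\<^sup>2) / (n - 1))
         + ((n - 4) * (V * t) + 3 * (V1 * c) - V2 + (n - 3) * V) * (Q * t))"
proof -
  define k where "k = 1 / (n - 1)"
  have k: "n / (n - 1) = 1 + k" "(n * T - L\<^sup>2) / (n - 1) = (n * T - L\<^sup>2) * k" "n * k = 1 + k"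
    using n by (simp_all add: k_def field_simps)
  \<comment> \<open>The coefficients n/(n-1) and 1/(n-1) are the only ones for which the Hessian
    term \<open>T\<close> drops out and L^2 keeps coefficient one. The remainder L^2 - n Q reflects
    the first eigenvalue n of the sphere.\<close>
  have "(1 + k) * (L\<^sup>2 - T - (n - 1) * Q) + (n * T - L\<^sup>2) * k
     = L\<^sup>2 - (n - 1) * Q - (n * k - k) * Q + T * (n * k - 1 - k)"
    by (simp add: algebra_simps)
  also have "\<dots> = L\<^sup>2 - n * Q" unfolding k by simp (simp add: algebra_simps)
  finally have "V * t * t * ((1 + k) * (L\<^sup>2 - T - (n - 1) * Q) + (n * T - L\<^sup>2) * k) = V * t * t * (L\<^sup>2 - n * Q)" by simp
  then have e: "n / (n - 1) * (V * t * t * (L\<^sup>2 - T - (n - 1) * Q)) + V * t * t * ((n * T - L\<^sup>2) / (n - 1))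
     = V * t * t * (L\<^sup>2 - n * Q)" unfolding k by (simp add: algebra_simps)
  \<comment> \<open>After \<open>t\<close> is eliminated, the claim is a polynomial
    identity.\<close>
  have t: "t = c * c - 1" using c by simp
  show ?thesis
    using e unfolding t by (simp add: power2_eq_square algebra_simps)
qed


subsection \<open>The integrated inequality\<close>

definition ct :: "real \<Rightarrow> real" where "ct s = cosh s / sinh s"
definition tt :: "real \<Rightarrow> real" where "tt s = 1 / (sinh s)\<^sup>2"

lemma ct_has_derivative:
  assumes "s > 0" shows "(ct has_real_derivative - tt s) (at s)"
proof -
  have "(ct has_real_derivative (sinh s * sinh s - cosh s * cosh s) / (sinh s * sinh s)) (at s)"
    unfolding ct_def[abs_def] using assms by (auto intro!: derivative_eq_intros)
  moreover have "sinh s * sinh s - cosh s * cosh s = - 1"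
    using cosh_square_eq[of s] by (simp add: power2_eq_square)
  ultimately show ?thesis by (simp add: tt_def power2_eq_square)
qed

lemma tt_has_derivative: "s > 0 \<Longrightarrow> (tt has_real_derivative - 2 * ct s * tt s) (at s)"
  unfolding tt_def[abs_def] ct_def
  by (auto intro!: derivative_eq_intros simp: field_simps power2_eq_square power3_eq_cube)

lemma continuous_on_ct [continuous_intros]: "continuous_on {0<..} ct"
  using DERIV_isCont[OF ct_has_derivative] by (auto intro!: continuous_at_imp_continuous_on)

lemma continuous_on_tt [continuous_intros]: "continuous_on {0<..} tt"
  using DERIV_isCont[OF tt_has_derivative] by (auto intro!: continuous_at_imp_continuous_on)

text \<open>\<open>Vf\<close> is the Bessel equation with r^(N-1) divided out, which leaves the term
  (N-1)/r. \<open>V2\<close> is a pointwise derivative without continuity.\<close>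

locale hyp_rellich = hyp_pole x0 for x0 :: "'a::euclidean_space" +
  fixes V V1 V2 W f f1 :: "real \<Rightarrow> real" and u :: "'a \<Rightarrow> real" and K :: "'a set"
  assumes V: "\<And>s. s > 0 \<Longrightarrow> (V has_real_derivative V1 s) (at s)"
    and V1: "\<And>s. s > 0 \<Longrightarrow> (V1 has_real_derivative V2 s) (at s)"
    and f: "\<And>s. s > 0 \<Longrightarrow> (f has_real_derivative f1 s) (at s)"
    and Vf: "\<And>s. s > 0 \<Longrightarrow> ((\<lambda>s. V s * f1 s) has_real_derivative
        - (W s * f s) - (real DIM('a) - 1) / s * (V s * f1 s)) (at s)"
    and f1: "continuous_on {0<..} f1" and W: "continuous_on {0<..} W"
    and f_pos: "\<And>s. s > 0 \<Longrightarrow> f s > 0" and V_nonneg: "\<And>s. s > 0 \<Longrightarrow> V s \<ge> 0"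
    and cond: "\<And>s. s > 0 \<Longrightarrow> (real DIM('a) - 5) * (V s * tt s) + 3 * (V1 s * ct s) - V2 s
        + (real DIM('a) - 4) * V s \<ge> 0"
    and dim: "DIM('a) > 2"
    and K: "compact K" "K \<subseteq> hyp_space - {x0}"
    and u: "\<And>k. C_k_on k (hyp_space - {x0}) u" and u0: "\<And>x. x \<notin> K \<Longrightarrow> u x = 0"
begin

section \<open>Derivatives of \<open>u\<close> in the polar frame\<close>

definition "n = real DIM('a) - 1"
definition "p = R u"
definition "q = R p"
definition "v = (\<lambda>j. G j u)"
text \<open>\<open>L\<close> is the spherical Laplacian, \<open>Q\<close> the squared spherical
  gradient, \<open>X\<close> half the radial derivative of \<open>Q\<close>, \<open>Q1\<close> the
  squared spherical gradient of u_r, and \<open>T\<close> the trace of the squared spherical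
  Hessian.\<close>

definition "L = (\<lambda>x. \<Sum>j\<in>Basis. G j (v j) x)"
definition "Q = (\<lambda>x. \<Sum>j\<in>Basis. v j x * v j x)"
definition "X = (\<lambda>x. \<Sum>j\<in>Basis. v j x * R (v j) x)"
definition "Q1 = (\<lambda>x. \<Sum>j\<in>Basis. R (v j) x * R (v j) x)"
definition "S = (\<lambda>x. \<Sum>j\<in>Basis. v j x * G j q x)"
definition "T = (\<lambda>x. \<Sum>i\<in>Basis. \<Sum>j\<in>Basis. G i (v j) x * G j (v i) x)"
text \<open>The field of the Bochner argument: \<open>L\<close> times the gradient, minus the
  derivative of the gradient field along itself.\<close>

definition "Y = (\<lambda>i x. v i x * L x - (\<Sum>j\<in>Basis. v j x * G j (v i) x))"
definition "c x = C x / sh x"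
definition "t x = 1 / (sh x)\<^sup>2"

lemma n: "n > 1" using dim by (simp add: n_def)

lemma Cp: "C_k_on k U p" unfolding p_def by (intro C_k_on_R u)
lemma Cq: "C_k_on k U q" unfolding q_def by (intro C_k_on_R Cp)
lemma Cv: "C_k_on k U (v j)" unfolding v_def by (intro C_k_on_G u)
lemma CL: "C_k_on k U L" unfolding L_def by (intro C_k_on_sum open_U C_k_on_G Cv)
lemma CQ: "C_k_on k U Q" unfolding Q_def by (intro C_k_on_sum open_U C_k_on_mult Cv)
lemma CX: "C_k_on k U X" unfolding X_def by (intro C_k_on_sum open_U C_k_on_mult Cv C_k_on_R)
lemma CQ1: "C_k_on k U Q1" unfolding Q1_def by (intro C_k_on_sum open_U C_k_on_mult Cv C_k_on_R)
lemma CY: "C_k_on k U (Y j)"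
  unfolding Y_def by (intro C_k_on_sum open_U C_k_on_mult C_k_on_diff Cv CL C_k_on_G)

lemmas cl = compact_imp_closed[OF K(1)]

lemma p0: "x \<notin> K \<Longrightarrow> p x = 0" unfolding p_def by (rule dd_outside[OF cl u0])
lemma q0: "x \<notin> K \<Longrightarrow> q x = 0" unfolding q_def by (rule dd_outside[OF cl p0])
lemma v0: "x \<notin> K \<Longrightarrow> v j x = 0" unfolding v_def by (rule dd_outside[OF cl u0])
lemma L0: "x \<notin> K \<Longrightarrow> L x = 0" unfolding L_def by (intro sum.neutral ballI dd_outside[OF cl v0])
lemma Q0: "x \<notin> K \<Longrightarrow> Q x = 0" by (simp add: Q_def v0)
lemma Q10: "x \<notin> K \<Longrightarrow> Q1 x = 0" by (simp add: Q1_def dd_outside[OF cl v0])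
lemma X0: "x \<notin> K \<Longrightarrow> X x = 0" by (simp add: X_def v0)
lemma Y0: "x \<notin> K \<Longrightarrow> Y j x = 0" by (simp add: Y_def v0)

lemma diffs: assumes "x \<in> U"
  shows "p differentiable (at x)" "q differentiable (at x)" "v j differentiable (at x)" "L differentiable (at x)"
    "R (v j) differentiable (at x)" "G i (v j) differentiable (at x)"
  using C_k_on_differentiable[OF Cp assms] C_k_on_differentiable[OF Cq assms] C_k_on_differentiable[OF Cv assms]
    C_k_on_differentiable[OF CL assms] C_k_on_differentiable[OF C_k_on_R[OF Cv] assms]
    C_k_on_differentiable[OF C_k_on_G[OF Cv] assms] by blast+

lemma R_v: "x \<in> U \<Longrightarrow> R (v j) x = G j p x"
  unfolding v_def p_def by (rule commute_R_G[OF _ u])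

lemma R_R_v: "x \<in> U \<Longrightarrow> R (R (v j)) x = G j q x"
  using dd_cong[OF open_U _ R_v[where j=j], where x=x and A=RF] commute_R_G[OF _ Cp, where x=x and j=j]
  by (simp add: q_def)

lemma sum_th_v: "x \<in> U \<Longrightarrow> (\<Sum>j\<in>Basis. th j x * v j x) = 0"
  unfolding v_def by (rule sum_th_G)

lemma G_v_commute:
  "x \<in> U \<Longrightarrow> i \<in> Basis \<Longrightarrow> j \<in> Basis \<Longrightarrow> G i (v j) x - G j (v i) x = th i x * v j x - th j x * v i x"
  unfolding v_def by (rule commutator_G_G[OF _ u])

lemma R_p2: "x \<in> U \<Longrightarrow> R (\<lambda>y. p y * p y) x = 2 * p x * q x"
  by (simp add: dd_mult diffs q_def)

lemma R_Q: "x \<in> U \<Longrightarrow> R Q x = 2 * X x"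
  unfolding Q_def X_def
  by (subst dd_sum) (auto simp: dd_mult diffs sum_distrib_left intro!: differentiable_mult sum.cong)

lemma R_X: "x \<in> U \<Longrightarrow> R X x = Q1 x + S x"
  unfolding X_def Q1_def S_def
  by (subst dd_sum) (auto simp: dd_mult diffs R_R_v sum.distrib intro!: differentiable_mult)

lemma div_q_v: "x \<in> U \<Longrightarrow> (\<Sum>j\<in>Basis. G j (\<lambda>y. q y * v j y) x - n * th j x * (q x * v j x)) = S x + q x * L x"
proof -
  assume x: "x \<in> U"
  have "(\<Sum>j\<in>Basis. G j (\<lambda>y. q y * v j y) x - n * th j x * (q x * v j x))
    = (\<Sum>j\<in>Basis. q x * G j (v j) x + v j x * G j q x - (n * q x) * (th j x * v j x))"
    using x by (intro sum.cong refl) (simp add: dd_mult diffs mult_ac)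
  then show ?thesis
    by (simp add: sum.distrib sum_subtractf sum_distrib_left[symmetric] sum_th_v[OF x] S_def L_def)
qed

lemma div_p_v: "x \<in> U \<Longrightarrow> (\<Sum>j\<in>Basis. G j (\<lambda>y. p y * v j y) x - n * th j x * (p x * v j x)) = X x + p x * L x"
proof -
  assume x: "x \<in> U"
  have "(\<Sum>j\<in>Basis. G j (\<lambda>y. p y * v j y) x - n * th j x * (p x * v j x))
    = (\<Sum>j\<in>Basis. p x * G j (v j) x + v j x * R (v j) x - (n * p x) * (th j x * v j x))"
    using x by (intro sum.cong refl) (simp add: dd_mult diffs R_v mult_ac)
  then show ?thesis
    by (simp add: sum.distrib sum_subtractf sum_distrib_left[symmetric] sum_th_v[OF x] X_def L_def)
qed

text \<open>The matrix is tangential in the direction of differentiation. In the other index it has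
  the normal component \<open>- v i x\<close>, the second fundamental form of the sphere, which the
  commutator produces here.\<close>

lemma sum_th_G_v:
  assumes x: "x \<in> U" and i: "i \<in> Basis"
  shows "(\<Sum>j\<in>Basis. th j x * G j (v i) x) = 0" "(\<Sum>j\<in>Basis. th j x * G i (v j) x) = - v i x"
proof -
  show 0: "(\<Sum>j\<in>Basis. th j x * G j (v i) x) = 0" by (rule sum_th_G[OF x])
  have "(\<Sum>j\<in>Basis. th j x * G i (v j) x)
     = (\<Sum>j\<in>Basis. th j x * G j (v i) x + th i x * (th j x * v j x) - v i x * (th j x * th j x))"
  proof (intro sum.cong refl)
    fix j :: 'a assume "j \<in> Basis"
    from G_v_commute[OF x i this] have e: "G i (v j) x = G j (v i) x + th i x * v j x - th j x * v i x" by simp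
    show "th j x * G i (v j) x = th j x * G j (v i) x + th i x * (th j x * v j x) - v i x * (th j x * th j x)"
      unfolding e by (simp add: algebra_simps)
  qed
  also have "\<dots> = - v i x"
    by (simp add: sum.distrib sum_subtractf sum_distrib_left[symmetric] 0 sum_th_v[OF x] sum_th_sq[OF x])
  finally show "(\<Sum>j\<in>Basis. th j x * G i (v j) x) = - v i x" .
qed

text \<open>The Bochner formula on the unit sphere; the curvature term is the contribution of the commutators.\<close>

lemma div_Y:
  assumes x: "x \<in> U"
  shows "(\<Sum>i\<in>Basis. G i (Y i) x - n * th i x * Y i x) = (L x)\<^sup>2 - T x - (n - 1) * Q x"
proof -
  have GY: "G i (Y i) x = (v i x * G i L x + G i (v i) x * L x)
      - (\<Sum>j\<in>Basis. v j x * G i (G j (v i)) x + G i (v j) x * G j (v i) x)" for i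
  proof -
    have d: "(\<lambda>y. v j y * G j (v i) y) differentiable (at x)" for j
      by (intro differentiable_mult diffs x)
    have "G i (Y i) x = G i (\<lambda>y. v i y * L y) x - G i (\<lambda>y. \<Sum>j\<in>Basis. v j y * G j (v i) y) x"
      unfolding Y_def by (intro dd_diff differentiable_mult differentiable_sum diffs x) (simp_all add: d)
    also have "G i (\<lambda>y. \<Sum>j\<in>Basis. v j y * G j (v i) y) x = (\<Sum>j\<in>Basis. G i (\<lambda>y. v j y * G j (v i) y) x)"
      by (rule dd_sum[OF d])
    finally show ?thesis
      by (simp only: dd_mult[OF diffs(3)[OF x] diffs(4)[OF x]] dd_mult[OF diffs(3)[OF x] diffs(6)[OF x]])
  qed
  have GL: "G i L x = (\<Sum>j\<in>Basis. G i (G j (v j)) x)" for i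
    unfolding L_def by (rule dd_sum) (rule diffs[OF x])
  have sw: "(\<Sum>i\<in>Basis. v i x * G i L x) = (\<Sum>i\<in>Basis. \<Sum>j\<in>Basis. v j x * G j (G i (v i)) x)"
    unfolding GL sum_distrib_left by (rule sum.swap)
  \<comment> \<open>Exchanging the two outer derivatives costs first-order terms, which add up to
    \<open>- Q x\<close>: one part of the curvature.\<close>
  have "(\<Sum>i\<in>Basis. \<Sum>j\<in>Basis. v j x * G i (G j (v i)) x)
     = (\<Sum>i\<in>Basis. \<Sum>j\<in>Basis. v j x * G j (G i (v i)) x + v j x * (th i x * G j (v i) x) - (th j x * v j x) * G i (v i) x)"
  proof (intro sum.cong refl)
    fix i j :: 'a assume "i \<in> Basis" "j \<in> Basis"
    from commutator_G_G[OF x Cv this, of i]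
    have e: "G i (G j (v i)) x = G j (G i (v i)) x + th i x * G j (v i) x - th j x * G i (v i) x" by simp
    show "v j x * G i (G j (v i)) x
      = v j x * G j (G i (v i)) x + v j x * (th i x * G j (v i) x) - (th j x * v j x) * G i (v i) x"
      unfolding e by (simp add: algebra_simps)
  qed
  also have "\<dots> = (\<Sum>i\<in>Basis. v i x * G i L x) + (\<Sum>j\<in>Basis. v j x * (\<Sum>i\<in>Basis. th i x * G j (v i) x))
     - (\<Sum>j\<in>Basis. th j x * v j x) * (\<Sum>i\<in>Basis. G i (v i) x)"
  proof -
    have "(\<Sum>i\<in>Basis. \<Sum>j\<in>Basis. v j x * (th i x * G j (v i) x)) = (\<Sum>j\<in>Basis. v j x * (\<Sum>i\<in>Basis. th i x * G j (v i) x))"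
      unfolding sum_distrib_left by (rule sum.swap)
    moreover have "(\<Sum>i\<in>Basis. \<Sum>j\<in>Basis. (th j x * v j x) * G i (v i) x)
      = (\<Sum>j\<in>Basis. th j x * v j x) * (\<Sum>i\<in>Basis. G i (v i) x)"
      by (subst sum.swap) (simp add: sum_product)
    ultimately show ?thesis by (simp only: sw sum.distrib sum_subtractf)
  qed
  also have "\<dots> = (\<Sum>i\<in>Basis. v i x * G i L x) - Q x"
    by (simp add: sum_th_v[OF x] sum_th_G_v(2)[OF x] Q_def sum_negf)
  finally have e: "(\<Sum>i\<in>Basis. \<Sum>j\<in>Basis. v j x * G i (G j (v i)) x) = (\<Sum>i\<in>Basis. v i x * G i L x) - Q x" .
  have "(\<Sum>i\<in>Basis. G i (Y i) x) = (\<Sum>i\<in>Basis. v i x * G i L x) + (\<Sum>i\<in>Basis. G i (v i) x) * L x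
     - (\<Sum>i\<in>Basis. \<Sum>j\<in>Basis. v j x * G i (G j (v i)) x) - T x"
    unfolding GY T_def by (simp add: sum.distrib sum_subtractf sum_distrib_right)
  also have "\<dots> = L x * L x + Q x - T x" unfolding e by (simp add: L_def)
  finally have 1: "(\<Sum>i\<in>Basis. G i (Y i) x) = L x * L x + Q x - T x" .
  \<comment> \<open>\<open>Y\<close> is not tangential: the derivative of the gradient field along
    itself has a normal part of size -Q. The resulting -n Q and the Q found above combine to the
    Ricci constant n - 1.\<close>
  have "(\<Sum>i\<in>Basis. th i x * Y i x)
     = (\<Sum>i\<in>Basis. L x * (th i x * v i x)) - (\<Sum>i\<in>Basis. \<Sum>j\<in>Basis. v j x * (th i x * G j (v i) x))"
    by (simp add: Y_def algebra_simps sum_subtractf sum_distrib_left)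
  also have "\<dots> = L x * (\<Sum>i\<in>Basis. th i x * v i x) - (\<Sum>j\<in>Basis. v j x * (\<Sum>i\<in>Basis. th i x * G j (v i) x))"
    unfolding sum_distrib_left by (subst (2) sum.swap) simp
  also have "\<dots> = Q x"
    by (simp add: sum_th_v[OF x] sum_th_G_v(2)[OF x] Q_def sum_negf)
  finally have 2: "(\<Sum>i\<in>Basis. th i x * Y i x) = Q x" .
  have "(\<Sum>i\<in>Basis. G i (Y i) x - n * th i x * Y i x) = (\<Sum>i\<in>Basis. G i (Y i) x) - n * (\<Sum>i\<in>Basis. th i x * Y i x)"
    by (simp add: sum_subtractf sum_distrib_left mult.assoc)
  then show ?thesis unfolding 1 2 by (simp add: power2_eq_square algebra_simps)
qed

lemma trace_ineq: "x \<in> U \<Longrightarrow> (L x)\<^sup>2 \<le> n * T x"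
  unfolding L_def T_def n_def
  by (rule tangential_trace_ineq[of "\<lambda>i. th i x" "\<lambda>i. v i x"])
    (use sum_th_sq[of x] sum_th_v[of x] G_v_commute[of x] sum_th_G_v(1)[of x] dim in auto)


text \<open>\<open>rd\<close> and \<open>td\<close> are divergences of fields with a radial weight
  \<open>A\<close>, along \<open>RF\<close> and along the \<open>GF j\<close>. The derivative is a
  separate argument so that \<open>a2''\<close>, which contains \<open>V2\<close>, fits the same
  form.\<close>

definition "rd A A' k x = A' (r x) * k x + A (r x) * R k x + n * c x * (A (r x) * k x)"
definition "td A k x = A (r x) * (\<Sum>j\<in>Basis. G j (k j) x - n * th j x * k j x)"

lemma rd_outside: "(\<And>y. y \<notin> K \<Longrightarrow> k y = 0) \<Longrightarrow> x \<notin> K \<Longrightarrow> rd A A' k x = 0"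
  using dd_outside[OF cl, of k] by (simp add: rd_def)

lemma td_outside: "(\<And>j y. y \<notin> K \<Longrightarrow> k j y = 0) \<Longrightarrow> x \<notin> K \<Longrightarrow> td A k x = 0"
  using dd_outside[OF cl, of "k _"] by (simp add: td_def)

lemmas rd_integral = radial_weight_integral[OF K, folded n_def c_def, folded rd_def]
lemmas td_integral = tangential_weight_integral[OF K, folded n_def, folded td_def]

section \<open>Radial weights of the divergences\<close>

definition "E s = V s * f1 s / f s"
definition "E' s = - W s - n / s * E s - E s * (f1 s / f s)"
definition "a1 s = V s * ct s"
definition "a1' s = V1 s * ct s - V s * tt s"
definition "a2 s = V s * tt s"
definition "a2' s = V1 s * tt s - 2 * V s * ct s * tt s"
definition "a3 s = V s * ct s * tt s"
definition "a3' s = V1 s * ct s * tt s - V s * tt s * tt s - 2 * V s * ct s * ct s * tt s"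
text \<open>The weight \<open>a2\<close> is differentiated twice because the term with
  \<open>S\<close> is integrated by parts twice in r: S = R X - Q1, and X is half of R Q.\<close>

definition "a2'' s = V2 s * tt s - 4 * V1 s * ct s * tt s + V s * (2 * tt s * tt s + 4 * ct s * ct s * tt s)"
definition "a7 s = E s * tt s"
definition "a7' s = E' s * tt s - 2 * E s * ct s * tt s"
definition "a9 s = V s * tt s * tt s"
definition "a9' s = V1 s * tt s * tt s - 4 * V s * tt s * ct s * tt s"

text \<open>The quotient rule turns the linear Bessel equation into the Riccati equation.\<close>

lemma E: "s > 0 \<Longrightarrow> (E has_real_derivative E' s) (at s)"
proof -
  assume s: "s > 0"
  have "(E has_real_derivative ((- (W s * f s) - n / s * (V s * f1 s)) * f s - V s * f1 s * f1 s) / (f s * f s)) (at s)"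
    unfolding E_def[abs_def] n_def by (rule DERIV_divide[OF Vf[OF s] f[OF s]]) (use f_pos[OF s] in simp)
  moreover have "((- (W s * f s) - n / s * (V s * f1 s)) * f s - V s * f1 s * f1 s) / (f s * f s) = E' s"
    using f_pos[OF s] s by (simp add: E'_def E_def field_simps)
  ultimately show ?thesis by simp
qed

lemma weights:
  assumes "s > 0"
  shows "(a1 has_real_derivative a1' s) (at s)" "(a2 has_real_derivative a2' s) (at s)"
    "(a3 has_real_derivative a3' s) (at s)" "(a2' has_real_derivative a2'' s) (at s)"
    "(a7 has_real_derivative a7' s) (at s)" "(a9 has_real_derivative a9' s) (at s)"
  unfolding a1_def[abs_def] a1'_def a2_def[abs_def] a2'_def[abs_def] a3_def[abs_def] a3'_def a2''_def
    a7_def[abs_def] a7'_def a9_def[abs_def] a9'_def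
  using assms
  by (auto intro!: derivative_eq_intros V V1 E ct_has_derivative tt_has_derivative simp: algebra_simps)

lemma cV: "continuous_on {0<..} V" and cV1: "continuous_on {0<..} V1"
  and cf: "continuous_on {0<..} f" and cE: "continuous_on {0<..} E"
  using DERIV_isCont[OF V] DERIV_isCont[OF V1] DERIV_isCont[OF f] DERIV_isCont[OF E]
  by (auto intro!: continuous_at_imp_continuous_on)

lemma cphi: "continuous_on {0<..} (\<lambda>s. f1 s / f s)"
  using f_pos by (intro continuous_on_divide f1 cf) force

lemma cE': "continuous_on {0<..} E'"
  unfolding E'_def by (intro continuous_intros W cE cphi) auto

lemma weights_continuous:
  "continuous_on {0<..} a1'" "continuous_on {0<..} a2'" "continuous_on {0<..} a3'"
  "continuous_on {0<..} a7'" "continuous_on {0<..} a9'"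
  unfolding a1'_def a2'_def a3'_def a7'_def a9'_def
  by (intro continuous_intros cV cV1 cE cE')+

lemma Q_nonneg: "Q x \<ge> 0" unfolding Q_def by (intro sum_nonneg) simp

text \<open>Solved for \<open>V2\<close>, the hypothesis \<open>cond\<close> bounds
  \<open>a2''\<close> by the continuous function \<open>B\<close>, and \<open>Q\<close> is
  nonnegative. Only the sign of the integral results, and it is the favourable one.\<close>

lemma one_sided:
  "integrable lborel (\<lambda>x. w x * rd a2' a2'' Q x)" "0 \<le> (LINT x|lborel. w x * rd a2' a2'' Q x)"
proof -
  define B where "B s = ((real DIM('a) - 5) * (V s * tt s) + 3 * (V1 s * ct s) + (real DIM('a) - 4) * V s) * tt s
     - 4 * V1 s * ct s * tt s + V s * (2 * tt s * tt s + 4 * ct s * ct s * tt s)" for s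
  have "a2'' s \<le> B s" if "s > 0" for s
  proof -
    have "V2 s * tt s \<le> ((real DIM('a) - 5) * (V s * tt s) + 3 * (V1 s * ct s) + (real DIM('a) - 4) * V s) * tt s"
      by (rule mult_right_mono) (use cond[OF that] in \<open>auto simp: tt_def\<close>)
    then show ?thesis by (simp add: a2''_def B_def)
  qed
  moreover have "continuous_on {0<..} B"
    unfolding B_def by (intro continuous_intros cV cV1)
  ultimately show "integrable lborel (\<lambda>x. w x * rd a2' a2'' Q x)" "0 \<le> (LINT x|lborel. w x * rd a2' a2'' Q x)"
    using radial_integral_one_sided[OF K CQ Q0 Q_nonneg weights(4), of B]
    unfolding rd_def n_def c_def by blast+
qed

lemma ct_r: "x \<in> U \<Longrightarrow> ct (r x) = c x" by (simp add: ct_def c_def cosh_r sinh_r)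
lemma tt_r: "x \<in> U \<Longrightarrow> tt (r x) = t x" by (simp add: tt_def t_def sinh_r)

lemma c_sq: "x \<in> U \<Longrightarrow> c x * c x = 1 + t x"
  using sh_pos[of x] sh_sq[of x] by (simp add: c_def t_def field_simps power2_eq_square)

section \<open>The integrands and their pointwise comparison\<close>

definition "\<phi> x = f1 (r x) / f (r x)"
definition "gs x = (p x)\<^sup>2 + Q x * t x"
text \<open>\<open>F0\<close> belongs to the left-hand side, \<open>F1\<close> to \<open>F4\<close>
  to the right-hand side in its order, without the factors \<open>n\<close>.\<close>

definition "F0 x = V (r x) * (q x + n * c x * p x + L x * t x)\<^sup>2"
definition "F1 x = W (r x) * gs x"
definition "F2 x = (V (r x) * t x - V1 (r x) * c x) * gs x"
definition "F3 x = V (r x) * \<phi> x * (c x - 1 / r x) * gs x"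
definition "F4 x = V (r x) * ((q x - \<phi> x * p x)\<^sup>2 + Q1 x * t x)"

text \<open>The divergences with \<open>a1\<close>, \<open>a2\<close> and \<open>a3\<close> first
  treat the mixed products p q, q L and p L; the next two treat \<open>S\<close> and
  \<open>X\<close>. \<open>E\<close> and \<open>a7\<close> insert the Bessel equation for
  \<open>p\<close> and for v_j / sinh r, \<open>a3\<close> with \<open>Q\<close> completes the
  square in the latter case, and \<open>a9\<close> carries the Bochner formula.\<close>

definition "D x = n * rd a1 a1' (\<lambda>y. p y * p y) x + 2 * td a2 (\<lambda>j y. q y * v j y) x
    + 2 * n * td a3 (\<lambda>j y. p y * v j y) x - 2 * rd a2 a2' X x + rd a2' a2'' Q x
    + rd E E' (\<lambda>y. p y * p y) x + rd a7 a7' Q x + rd a3 a3' Q x + n / (n - 1) * td a9 Y x"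

lemma D_le:
  assumes x: "x \<in> U"
  shows "D x \<le> F0 x - (F1 x + n * F2 x - n * F3 x + F4 x)"
proof -
  have r0: "r x > 0" by (rule r_pos[OF x])
  have t0: "t x \<ge> 0" by (simp add: t_def)
  have V0: "V (r x) \<ge> 0" by (rule V_nonneg[OF r0])
  \<comment> \<open>For z = v_j / sinh r, R z - (f'/f) z is the quotient of R v_j - (c + f'/f) v_j
    by sinh r; the \<open>c\<close> comes from differentiating 1/sinh r.\<close>
  have sq: "Q1 x - 2 * (c x + \<phi> x) * X x + (c x + \<phi> x)\<^sup>2 * Q x \<ge> 0"
  proof -
    have "Q1 x - 2 * (c x + \<phi> x) * X x + (c x + \<phi> x)\<^sup>2 * Q x = (\<Sum>j\<in>Basis. (R (v j) x - (c x + \<phi> x) * v j x)\<^sup>2)"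
      unfolding Q1_def X_def Q_def sum_distrib_left sum_subtractf[symmetric] sum.distrib[symmetric]
      by (intro sum.cong refl) (simp add: power2_eq_square algebra_simps)
    also have "\<dots> \<ge> 0" by (intro sum_nonneg) simp
    finally show ?thesis .
  qed
  have V0': "V (r x) * t x * (Q1 x - 2 * (c x + \<phi> x) * X x + (c x + \<phi> x)\<^sup>2 * Q x)
         + V (r x) * t x * t x * ((n * T x - (L x)\<^sup>2) / (n - 1))
         + ((n - 4) * (V (r x) * t x) + 3 * (V1 (r x) * c x) - V2 (r x) + (n - 3) * V (r x)) * (Q x * t x) \<ge> 0"
  proof (intro add_nonneg_nonneg)
    show "0 \<le> V (r x) * t x * (Q1 x - 2 * (c x + \<phi> x) * X x + (c x + \<phi> x)\<^sup>2 * Q x)"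
      using V0 t0 sq by simp
    show "0 \<le> V (r x) * t x * t x * ((n * T x - (L x)\<^sup>2) / (n - 1))"
      using V0 t0 trace_ineq[OF x] n by simp
    show "0 \<le> ((n - 4) * (V (r x) * t x) + 3 * (V1 (r x) * c x) - V2 (r x) + (n - 3) * V (r x)) * (Q x * t x)"
      using cond[OF r0] t0 Q_nonneg[of x] by (intro mult_nonneg_nonneg) (simp_all add: ct_r[OF x] tt_r[OF x] n_def)
  qed
  have "F0 x - (F1 x + n * F2 x - n * F3 x + F4 x) = D x + (V (r x) * t x * (Q1 x - 2 * (c x + \<phi> x) * X x + (c x + \<phi> x)\<^sup>2 * Q x)
         + V (r x) * t x * t x * ((n * T x - (L x)\<^sup>2) / (n - 1))
         + ((n - 4) * (V (r x) * t x) + 3 * (V1 (r x) * c x) - V2 (r x) + (n - 3) * V (r x)) * (Q x * t x))"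
  proof -
    have E: "E (r x) = V (r x) * \<phi> x" by (simp add: E_def \<phi>_def)
    have E': "E' (r x) = - W (r x) - n * (1 / r x) * (V (r x) * \<phi> x) - V (r x) * \<phi> x * \<phi> x"
      by (simp add: E'_def E) (simp add: \<phi>_def)
    have d: "rd a1 a1' (\<lambda>y. p y * p y) x = (V1 (r x) * c x - V (r x) * t x) * (p x)\<^sup>2 + V (r x) * c x * (2 * p x * q x) + n * c x * (V (r x) * c x * (p x)\<^sup>2)"
      "td a2 (\<lambda>j y. q y * v j y) x = V (r x) * t x * (S x + q x * L x)"
      "td a3 (\<lambda>j y. p y * v j y) x = V (r x) * c x * t x * (X x + p x * L x)"
      "rd a2 a2' X x = (V1 (r x) * t x - 2 * V (r x) * c x * t x) * X x + V (r x) * t x * (Q1 x + S x) + n * c x * (V (r x) * t x * X x)"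
      "rd a2' a2'' Q x = (V2 (r x) - 4 * V1 (r x) * c x + 2 * V (r x) * t x + 4 * V (r x) * c x * c x) * t x * Q x
          + (V1 (r x) * t x - 2 * V (r x) * c x * t x) * (2 * X x) + n * c x * ((V1 (r x) * t x - 2 * V (r x) * c x * t x) * Q x)"
      "rd E E' (\<lambda>y. p y * p y) x = (- W (r x) - n * (1 / r x) * (V (r x) * \<phi> x) - V (r x) * \<phi> x * \<phi> x) * (p x)\<^sup>2
          + V (r x) * \<phi> x * (2 * p x * q x) + n * c x * (V (r x) * \<phi> x * (p x)\<^sup>2)"
      "rd a7 a7' Q x = (- W (r x) - n * (1 / r x) * (V (r x) * \<phi> x) - V (r x) * \<phi> x * \<phi> x - 2 * c x * (V (r x) * \<phi> x)) * t x * Q x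
          + V (r x) * \<phi> x * t x * (2 * X x) + n * c x * (V (r x) * \<phi> x * t x * Q x)"
      "rd a3 a3' Q x = (V1 (r x) * c x - V (r x) * t x - 2 * V (r x) * c x * c x) * t x * Q x + V (r x) * c x * t x * (2 * X x)
          + n * c x * (V (r x) * c x * t x * Q x)"
      "td a9 Y x = V (r x) * t x * t x * ((L x)\<^sup>2 - T x - (n - 1) * Q x)"
      by (simp_all only: rd_def td_def R_p2[OF x] R_Q[OF x] R_X[OF x] div_q_v[OF x] div_p_v[OF x] div_Y[OF x]
          a1_def a1'_def a2_def a2'_def a3_def a3'_def a2''_def a7_def a7'_def a9_def E E' ct_r[OF x] tt_r[OF x])
       (simp_all add: power2_eq_square algebra_simps)
    show ?thesis
      unfolding D_def d
      using rellich_pointwise[OF c_sq[OF x] n, of "V (r x)" "q x" "p x" "L x" "W (r x)" "Q x" "V1 (r x)" "\<phi> x" "1 / r x"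
          "Q1 x" "S x" "X x" "V2 (r x)" "T x"]
      by (simp only: F0_def F1_def F2_def F3_def F4_def gs_def)
  qed
  then show ?thesis using V0' by linarith
qed

lemma D_outside: "x \<notin> K \<Longrightarrow> D x = 0"
  unfolding D_def by (simp add: rd_outside td_outside p0 q0 v0 X0 Q0 Y0)

lemma F_outside:
  assumes "x \<notin> K"
  shows "gs x = 0" "F0 x = 0" "F1 x = 0" "F2 x = 0" "F3 x = 0" "F4 x = 0"
  using assms by (simp_all add: gs_def F0_def F1_def F2_def F3_def F4_def p0 q0 L0 Q0 Q10)

text \<open>Eight of the nine divergences integrate to zero; the one with \<open>V2\<close> has
  coefficient 1 and a nonnegative integral.\<close>

lemma D_integral: "integrable lborel (\<lambda>x. w x * D x)" "0 \<le> (LINT x|lborel. w x * D x)"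
proof -
  have k: "C_k_on (Suc 0) U (\<lambda>y. p y * p y)" "C_k_on (Suc 0) U (\<lambda>y. q y * v j y)" "C_k_on (Suc 0) U (\<lambda>y. p y * v j y)" for j
    by (intro C_k_on_mult open_U Cp Cq Cv)+
  have i1: "integrable lborel (\<lambda>x. w x * rd a1 a1' (\<lambda>y. p y * p y) x)" "(LINT x|lborel. w x * rd a1 a1' (\<lambda>y. p y * p y) x) = 0"
    by (rule rd_integral[OF k(1) _ weights(1) weights_continuous(1)]; (simp add: p0 q0 v0)?)+
  have i2: "integrable lborel (\<lambda>x. w x * td a2 (\<lambda>j y. q y * v j y) x)" "(LINT x|lborel. w x * td a2 (\<lambda>j y. q y * v j y) x) = 0"
    by (rule td_integral[OF k(2) _ weights(2) weights_continuous(2)]; (simp add: p0 q0 v0)?)+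
  have i3: "integrable lborel (\<lambda>x. w x * td a3 (\<lambda>j y. p y * v j y) x)" "(LINT x|lborel. w x * td a3 (\<lambda>j y. p y * v j y) x) = 0"
    by (rule td_integral[OF k(3) _ weights(3) weights_continuous(3)]; (simp add: p0 q0 v0)?)+
  have i4: "integrable lborel (\<lambda>x. w x * rd a2 a2' X x)" "(LINT x|lborel. w x * rd a2 a2' X x) = 0"
    by (rule rd_integral[OF CX X0 weights(2) weights_continuous(2)]; (simp add: p0 q0 v0)?)+
  have i5: "integrable lborel (\<lambda>x. w x * rd E E' (\<lambda>y. p y * p y) x)" "(LINT x|lborel. w x * rd E E' (\<lambda>y. p y * p y) x) = 0"
    by (rule rd_integral[OF k(1) _ E cE']; (simp add: p0 q0 v0)?)+
  have i6: "integrable lborel (\<lambda>x. w x * rd a7 a7' Q x)" "(LINT x|lborel. w x * rd a7 a7' Q x) = 0"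
    by (rule rd_integral[OF CQ Q0 weights(5) weights_continuous(4)]; (simp add: p0 q0 v0)?)+
  have i7: "integrable lborel (\<lambda>x. w x * rd a3 a3' Q x)" "(LINT x|lborel. w x * rd a3 a3' Q x) = 0"
    by (rule rd_integral[OF CQ Q0 weights(3) weights_continuous(3)]; (simp add: p0 q0 v0)?)+
  have i8: "integrable lborel (\<lambda>x. w x * td a9 Y x)" "(LINT x|lborel. w x * td a9 Y x) = 0"
    by (rule td_integral[OF CY Y0 weights(6) weights_continuous(5)]; (simp add: p0 q0 v0)?)+
  have e: "(\<lambda>x. w x * D x) = (\<lambda>x. n * (w x * rd a1 a1' (\<lambda>y. p y * p y) x) + 2 * (w x * td a2 (\<lambda>j y. q y * v j y) x)
    + 2 * n * (w x * td a3 (\<lambda>j y. p y * v j y) x) - 2 * (w x * rd a2 a2' X x) + w x * rd a2' a2'' Q x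
    + w x * rd E E' (\<lambda>y. p y * p y) x + w x * rd a7 a7' Q x + w x * rd a3 a3' Q x + n / (n - 1) * (w x * td a9 Y x))"
    by (simp add: fun_eq_iff D_def algebra_simps)
  show "integrable lborel (\<lambda>x. w x * D x)" "0 \<le> (LINT x|lborel. w x * D x)"
    unfolding e using i1 i2 i3 i4 i5 i6 i7 i8 one_sided by simp_all
qed

section \<open>Integration of the pointwise inequality\<close>

lemma continuous_compose_r:
  assumes "continuous_on {0<..} A" shows "continuous_on K (\<lambda>x. A (r x))"
proof (rule continuous_on_compose2[OF assms])
  show "continuous_on K r"
    using C_k_on_continuous[OF C_k_on_r[of 0]] K(2) by (rule continuous_on_subset)
  show "r ` K \<subseteq> {0<..}" using K(2) r_pos by auto
qed

lemma continuous_on_K: "C_k_on k U g \<Longrightarrow> continuous_on K g"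
  using C_k_on_continuous K(2) continuous_on_subset by blast

lemma continuous_F:
  "continuous_on K gs" "continuous_on K F0" "continuous_on K F1" "continuous_on K F2"
  "continuous_on K F3" "continuous_on K F4"
proof -
  have s0: "sh x \<noteq> 0" if "x \<in> K" for x using sh_pos[of x] that K(2) by force
  have r0: "r x \<noteq> 0" if "x \<in> K" for x using r_pos[of x] that K(2) by force
  note b = continuous_on_K[OF C_k_on_C[of 0]] continuous_on_K[OF C_k_on_sh[of 0]] continuous_on_K[OF Cp[of 0]]
    continuous_on_K[OF Cq[of 0]] continuous_on_K[OF CL[of 0]] continuous_on_K[OF CQ[of 0]]
    continuous_on_K[OF CQ1[of 0]] continuous_on_K[OF C_k_on_r[of 0]]
    continuous_compose_r[OF cV] continuous_compose_r[OF cV1] continuous_compose_r[OF W]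
  have c: "continuous_on K c" unfolding c_def[abs_def] by (intro continuous_intros b) (use s0 in auto)
  have t: "continuous_on K t" unfolding t_def[abs_def] by (intro continuous_intros b) (use s0 in auto)
  have ph: "continuous_on K \<phi>" unfolding \<phi>_def by (rule continuous_compose_r[OF cphi])
  show gs: "continuous_on K gs" unfolding gs_def by (intro continuous_intros b t)
  show "continuous_on K F0" unfolding F0_def by (intro continuous_intros b t c)
  show "continuous_on K F1" unfolding F1_def by (intro continuous_intros b gs)
  show "continuous_on K F2" unfolding F2_def by (intro continuous_intros b gs t c)
  show "continuous_on K F3" unfolding F3_def by (intro continuous_intros b gs c ph) (use r0 in auto)
  show "continuous_on K F4" unfolding F4_def by (intro continuous_intros b t ph)
qed

theorem rellich_integrated:
  "(LINT x|hyp_volume. F0 x) \<ge> (LINT x|hyp_volume. F1 x) + n * (LINT x|hyp_volume. F2 x)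
     - n * (LINT x|hyp_volume. F3 x) + (LINT x|hyp_volume. F4 x)"
proof -
  have h0: "(LINT x|hyp_volume. F0 x) = (LINT x|lborel. w x * F0 x)" "integrable lborel (\<lambda>x. w x * F0 x)"
    by (rule hyp_volume_integral[OF K continuous_F(2) F_outside(2)]; assumption)+
  have h1: "(LINT x|hyp_volume. F1 x) = (LINT x|lborel. w x * F1 x)" "integrable lborel (\<lambda>x. w x * F1 x)"
    by (rule hyp_volume_integral[OF K continuous_F(3) F_outside(3)]; assumption)+
  have h2: "(LINT x|hyp_volume. F2 x) = (LINT x|lborel. w x * F2 x)" "integrable lborel (\<lambda>x. w x * F2 x)"
    by (rule hyp_volume_integral[OF K continuous_F(4) F_outside(4)]; assumption)+
  have h3: "(LINT x|hyp_volume. F3 x) = (LINT x|lborel. w x * F3 x)" "integrable lborel (\<lambda>x. w x * F3 x)"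
    by (rule hyp_volume_integral[OF K continuous_F(5) F_outside(5)]; assumption)+
  have h4: "(LINT x|hyp_volume. F4 x) = (LINT x|lborel. w x * F4 x)" "integrable lborel (\<lambda>x. w x * F4 x)"
    by (rule hyp_volume_integral[OF K continuous_F(6) F_outside(6)]; assumption)+
  have "0 \<le> (LINT x|lborel. w x * D x)" by (rule D_integral)
  also have "\<dots> \<le> (LINT x|lborel. w x * F0 x - (w x * F1 x + n * (w x * F2 x) - n * (w x * F3 x) + w x * F4 x))"
  proof (rule integral_mono)
    show "integrable lborel (\<lambda>x. w x * F0 x - (w x * F1 x + n * (w x * F2 x) - n * (w x * F3 x) + w x * F4 x))"
      using h0(2) h1(2) h2(2) h3(2) h4(2) by simp
    fix x :: 'a
    show "w x * D x \<le> w x * F0 x - (w x * F1 x + n * (w x * F2 x) - n * (w x * F3 x) + w x * F4 x)"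
    proof (cases "x \<in> K")
      case True
      then have x: "x \<in> U" using K(2) by auto
      have "w x * D x \<le> w x * (F0 x - (F1 x + n * F2 x - n * F3 x + F4 x))"
        using w_pos[OF x] D_le[OF x] by (intro mult_left_mono) auto
      then show ?thesis by (simp add: algebra_simps)
    next
      case False
      then show ?thesis by (simp add: D_outside F_outside)
    qed
  qed (rule D_integral)
  also have "\<dots> = (LINT x|hyp_volume. F0 x) - ((LINT x|hyp_volume. F1 x) + n * (LINT x|hyp_volume. F2 x)
     - n * (LINT x|hyp_volume. F3 x) + (LINT x|hyp_volume. F4 x))"
    unfolding h0(1) h1(1) h2(1) h3(1) h4(1) using h0(2) h1(2) h2(2) h3(2) h4(2) by simp
  finally show ?thesis by simp
qed

subsection \<open>Translation to the Riemannian quantities\<close>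

lemma hyp_norm_grad_sq:
  assumes x: "x \<in> U"
  shows "(hyp_norm x (hyp_grad h x))\<^sup>2 = (R h x)\<^sup>2 + (\<Sum>j\<in>Basis. G j h x * G j h x) * t x"
proof -
  have "(hyp_norm x (hyp_grad h x))\<^sup>2 = hyp_inner x (hyp_grad h x) (hyp_grad h x)"
    by (simp add: hyp_norm_def hyp_inner_def)
  then show ?thesis
    unfolding hyp_inner_grad[OF U_hyp[OF x]] hyp_gg_frame[OF x] by (simp add: t_def power2_eq_square)
qed

lemma hyp_grad_outside:
  assumes "\<And>y. y \<notin> K \<Longrightarrow> h y = 0" "x \<notin> K" shows "hyp_grad h x = 0"
  using partial_deriv_outside[OF cl assms] by (simp add: hyp_grad_def)

text \<open>Holds at every point, since off \<open>K\<close> both sides vanish; the integrands can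
  thus be rewritten without an almost-everywhere argument.\<close>

lemma gs_eq: "gs x = (hyp_norm x (hyp_grad u x))\<^sup>2"
proof (cases "x \<in> K")
  case True
  then have "x \<in> U" using K(2) by auto
  then show ?thesis by (simp only: hyp_norm_grad_sq gs_def) (simp add: p_def Q_def v_def)
next
  case False
  then show ?thesis by (simp add: F_outside hyp_grad_outside[OF u0] hyp_norm_def hyp_inner_def)
qed

lemma F0_eq: "F0 x = V (r x) * (hyp_laplacian u x)\<^sup>2"
proof (cases "x \<in> K")
  case True
  then have "x \<in> U" using K(2) by auto
  then show ?thesis
    by (simp only: laplacian_polar[OF _ u]) (simp add: F0_def p_def q_def L_def v_def c_def t_def n_def)
next
  case False
  have "partial_deriv i (\<lambda>y. hyp_factor y ^ DIM('a) * (hyp_grad u y \<bullet> i)) x = 0" for i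
    by (rule partial_deriv_outside[OF cl _ False]) (simp add: hyp_grad_outside[OF u0])
  then show ?thesis using False by (simp add: F_outside hyp_laplacian_def hyp_div_def)
qed

lemma F2_eq: "F2 x = (V (r x) / (sinh (r x))\<^sup>2 - V1 (r x) * cosh (r x) / sinh (r x)) * (hyp_norm x (hyp_grad u x))\<^sup>2"
proof (cases "x \<in> K")
  case True
  then have "x \<in> U" using K(2) by auto
  then show ?thesis unfolding gs_eq[symmetric] F2_def by (simp only: cosh_r sinh_r) (simp add: c_def t_def)
next
  case False
  then show ?thesis unfolding gs_eq[symmetric] by (simp add: F_outside)
qed

lemma F3_eq: "F3 x = V (r x) * (f1 (r x) / f (r x)) * (cosh (r x) / sinh (r x) - 1 / r x) * (hyp_norm x (hyp_grad u x))\<^sup>2"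
proof (cases "x \<in> K")
  case True
  then have "x \<in> U" using K(2) by auto
  then show ?thesis unfolding gs_eq[symmetric] F3_def by (simp only: cosh_r sinh_r) (simp add: c_def \<phi>_def)
next
  case False
  then show ?thesis unfolding gs_eq[symmetric] by (simp add: F_outside)
qed

lemma hyp_radial_deriv_eq: "x \<in> U \<Longrightarrow> hyp_radial_deriv x0 u x = p x"
  unfolding hyp_radial_deriv_def p_def RF_def dd_hyp_grad r_def[abs_def]
  by (rule hyp_inner_grad) simp

text \<open>The \<open>G j\<close> annihilate radial functions, so in the gradient of the quotient
  only the radial derivative sees f'. The remaining factor 1/f^2 cancels.\<close>

lemma F4_eq: "F4 x = V (r x) * (f (r x))\<^sup>2 * (hyp_norm x (hyp_grad (\<lambda>y. hyp_radial_deriv x0 u y / f (r y)) x))\<^sup>2"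
proof (cases "x \<in> K")
  case True
  then have x: "x \<in> U" using K(2) by auto
  let ?g = "\<lambda>y. hyp_radial_deriv x0 u y / f (r y)"
  have A: "((\<lambda>s. 1 / f s) has_real_derivative - f1 s / (f s)\<^sup>2) (at s)" if "s > 0" for s
    using f_pos[OF that] f[OF that] by (auto intro!: derivative_eq_intros simp: power2_eq_square)
  have cA: "continuous_on {0<..} (\<lambda>s. - f1 s / (f s)\<^sup>2)"
    using f_pos by (intro continuous_intros f1 cf) force
  have dd_g: "dd Z ?g x = dd Z p x / f (r x) - p x * f1 (r x) / (f (r x))\<^sup>2 * dd Z r x" for Z
  proof -
    have "dd Z ?g x = dd Z (\<lambda>y. p y * (1 / f (r y))) x"
      by (rule dd_cong[OF open_U x]) (simp only: hyp_radial_deriv_eq, simp)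
    also have "\<dots> = p x * dd Z (\<lambda>y. 1 / f (r y)) x + dd Z p x * (1 / f (r x))"
      by (rule dd_mult[OF diffs(1)[OF x] C_k_on_differentiable[OF r_compose(2)[OF A cA] x]])
    also have "dd Z (\<lambda>y. 1 / f (r y)) x = - f1 (r x) / (f (r x))\<^sup>2 * dd Z r x"
      by (rule r_compose(1)[OF A x])
    finally show ?thesis by (simp add: algebra_simps)
  qed
  have fp: "f (r x) > 0" by (rule f_pos[OF r_pos[OF x]])
  have "R ?g x = (q x - \<phi> x * p x) / f (r x)"
    unfolding dd_g R_r[OF x] \<phi>_def q_def using fp by (simp add: field_simps power2_eq_square)
  moreover have "G j ?g x = R (v j) x / f (r x)" for j
    unfolding dd_g G_r[OF x] R_v[OF x] by simp
  ultimately have "(hyp_norm x (hyp_grad ?g x))\<^sup>2 = ((q x - \<phi> x * p x) / f (r x))\<^sup>2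
       + (\<Sum>j\<in>Basis. R (v j) x / f (r x) * (R (v j) x / f (r x))) * t x"
    by (simp only: hyp_norm_grad_sq[OF x])
  also have "\<dots> = ((q x - \<phi> x * p x)\<^sup>2 + Q1 x * t x) / (f (r x))\<^sup>2"
    by (simp add: Q1_def power_divide add_divide_distrib sum_divide_distrib[symmetric] power2_eq_square[symmetric])
  finally show ?thesis using fp by (simp add: F4_def)
next
  case False
  \<comment> \<open>Off \<open>K\<close> the numerator is zero, so the quotient is zero whatever
    value \<open>f (r y)\<close> has, also at the pole and outside the ball.\<close>
  have "hyp_grad (\<lambda>y. hyp_radial_deriv x0 u y / f (r y)) x = 0"
    by (rule hyp_grad_outside[OF _ False])
      (simp add: hyp_radial_deriv_def hyp_grad_outside[OF u0] hyp_inner_def)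
  then show ?thesis using False by (simp add: F_outside hyp_norm_def hyp_inner_def)
qed

end

section \<open>Bessel pairs with polynomial weight\<close>

lemma C1_differentiable_on_realD:
  fixes g :: "real \<Rightarrow> real"
  assumes "g C1_differentiable_on {0<..}"
  shows "s > 0 \<Longrightarrow> (g has_real_derivative deriv g s) (at s)" "continuous_on {0<..} (deriv g)"
proof -
  obtain D where D: "\<And>s. s > 0 \<Longrightarrow> (g has_real_derivative D s) (at s)" "continuous_on {0<..} D"
    using assms by (auto simp: C1_differentiable_on_def has_real_derivative_iff_has_vector_derivative)
  have e: "deriv g s = D s" if "s > 0" for s by (rule DERIV_imp_deriv[OF D(1)[OF that]])
  show "s > 0 \<Longrightarrow> (g has_real_derivative deriv g s) (at s)"
    using D(1) by (simp add: e)
  show "continuous_on {0<..} (deriv g)"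
    by (rule continuous_on_eq[OF D(2)]) (simp add: e)
qed

text \<open>A Bessel pair gives regularity of weighted functions; for s > 0 the weight can be
  divided out at the cost of the term with \<open>real m / s\<close>.\<close>

lemma power_weight_quotient_derivative:
  fixes g :: "real \<Rightarrow> real"
  assumes "((\<lambda>s. s ^ m * g s) has_real_derivative D) (at s)" "s > 0"
  shows "(g has_real_derivative D / s ^ m - real m / s * g s) (at s)"
proof -
  have "((\<lambda>z. (z ^ m * g z) / z ^ m) has_real_derivative
      (D * s ^ m - s ^ m * g s * (real m * s ^ (m - Suc 0))) / (s ^ m * s ^ m)) (at s)"
    by (rule DERIV_divide[OF assms(1) DERIV_pow]) (use assms(2) in simp)
  also have "(D * s ^ m - s ^ m * g s * (real m * s ^ (m - Suc 0))) / (s ^ m * s ^ m) = D / s ^ m - real m / s * g s"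
    using assms(2) by (cases m) (auto simp: field_simps)
  finally have "((\<lambda>z. (z ^ m * g z) / z ^ m) has_real_derivative D / s ^ m - real m / s * g s) (at s)" .
  moreover have "(z ^ m * g z) / z ^ m = g z" if "z \<in> {0<..}" for z using that by simp
  ultimately show ?thesis
    using has_field_derivative_transform_within_open[of _ _ s "{0<..}" g] assms(2) by auto
qed

theorem theorem3p2:
  fixes V W f :: "real \<Rightarrow> real"
    and x0 :: "'a::euclidean_space"
    and u :: "'a \<Rightarrow> real"
  defines "N \<equiv> DIM('a)"
  defines "r \<equiv> (\<lambda>x. hyp_dist x x0)"
  assumes dim: "N \<ge> 5"
    and pole: "x0 \<in> hyp_space"
    and pair: "bessel_pair (\<lambda>s. s ^ (N - 1) * V s) (\<lambda>s. s ^ (N - 1) * W s)"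
    and sol: "positive_solution (\<lambda>s. s ^ (N - 1) * V s) (\<lambda>s. s ^ (N - 1) * W s) f"
    and V_nonneg: "\<And>s. s > 0 \<Longrightarrow> V s \<ge> 0"
    and V_twice_diff: "deriv V differentiable_on {0<..}"
    and V_cond: "\<And>s. s > 0 \<Longrightarrow>
          (real N - 5) * (V s / (sinh s)\<^sup>2) + 3 * (deriv V s * cosh s / sinh s)
            - deriv (deriv V) s + (real N - 4) * V s \<ge> 0"
    and u: "u \<in> test_functions (hyp_space - {x0})"
  shows "(LINT x|hyp_volume. V (r x) * (hyp_laplacian u x)\<^sup>2)
     \<ge> (LINT x|hyp_volume. W (r x) * (hyp_norm x (hyp_grad u x))\<^sup>2)
       + (real N - 1) *
         (LINT x|hyp_volume. (V (r x) / (sinh (r x))\<^sup>2 - deriv V (r x) * cosh (r x) / sinh (r x))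
                              * (hyp_norm x (hyp_grad u x))\<^sup>2)
       - (real N - 1) *
         (LINT x|hyp_volume. V (r x) * (deriv f (r x) / f (r x))
                              * (cosh (r x) / sinh (r x) - 1 / r x)
                              * (hyp_norm x (hyp_grad u x))\<^sup>2)
       + (LINT x|hyp_volume. V (r x) * (f (r x))\<^sup>2
                              * (hyp_norm x (hyp_grad (\<lambda>y. hyp_radial_deriv x0 u y / f (r y)) x))\<^sup>2)"
proof -
  define m where "m = N - 1"
  have m: "real m = real DIM('a) - 1" using dim by (simp add: m_def N_def of_nat_diff)
  define K where "K = closure {x. u x \<noteq> 0}"
  \<comment> \<open>Differentiability of \<open>V\<close> is inherited from its weighted version,
    which is C^1 as part of the Bessel pair.\<close>
  have V: "(V has_real_derivative deriv V s) (at s)" if "s > 0" for s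
  proof -
    have "(\<lambda>s. s ^ m * V s) C1_differentiable_on {0<..}"
      using pair by (simp add: bessel_pair_def m_def)
    from power_weight_quotient_derivative[OF C1_differentiable_on_realD(1)[OF this that] that] show ?thesis
      using DERIV_imp_deriv by fastforce
  qed
  have V': "(deriv V has_real_derivative deriv (deriv V) s) (at s)" if "s > 0" for s
    using V_twice_diff that
    by (simp add: differentiable_on_eq_differentiable_at DERIV_deriv_iff_real_differentiable)
  have f: "f C1_differentiable_on {0<..}" and f_pos: "\<And>s. s > 0 \<Longrightarrow> f s > 0"
    and f_ode: "\<And>s. s > 0 \<Longrightarrow> ((\<lambda>s. s ^ m * V s * deriv f s) has_real_derivative - (s ^ m * W s * f s)) (at s)"
    using sol by (auto simp: positive_solution_def m_def)
  \<comment> \<open>Dividing the equation by \<open>s ^ m\<close> creates the term (N-1)/s, the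
    source of 1/r in the inequality.\<close>
  have Vf: "((\<lambda>s. V s * deriv f s) has_real_derivative - (W s * f s) - (real DIM('a) - 1) / s * (V s * deriv f s)) (at s)"
    if "s > 0" for s
  proof -
    have "((\<lambda>s. s ^ m * (V s * deriv f s)) has_real_derivative - (s ^ m * W s * f s)) (at s)"
      using f_ode[OF that] by (simp add: mult.assoc)
    from power_weight_quotient_derivative[OF this that] show ?thesis
      using that by (simp add: m)
  qed
  have W: "continuous_on {0<..} W"
  proof -
    have "(\<lambda>s. s ^ m * W s) C1_differentiable_on {0<..}"
      using pair by (simp add: bessel_pair_def m_def)
    then have "continuous_on {0<..} (\<lambda>s. s ^ m * W s / s ^ m)"
      by (intro continuous_intros C1_differentiable_imp_continuous_on) auto
    then show ?thesis by (rule continuous_on_eq) simp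
  qed
  interpret H: hyp_rellich x0 V "deriv V" "deriv (deriv V)" W f "deriv f" u K
  proof
    show "(f has_real_derivative deriv f s) (at s)" if "s > 0" for s
      by (rule C1_differentiable_on_realD(1)[OF f that])
    show "continuous_on {0<..} (deriv f)"
      by (rule C1_differentiable_on_realD(2)[OF f])
    show "(real DIM('a) - 5) * (V s * tt s) + 3 * (deriv V s * ct s) - deriv (deriv V) s + (real DIM('a) - 4) * V s \<ge> 0"
      if "s > 0" for s
      using V_cond[OF that] by (simp add: N_def tt_def ct_def)
    show "compact K" "K \<subseteq> hyp_space - {x0}" "C_k_on k (hyp_space - {x0}) u" for k
      using u by (auto simp: test_functions_def smooth_on_def K_def)
    show "u x = 0" if "x \<notin> K" for x
      using that closure_subset[of "{x. u x \<noteq> 0}"] by (auto simp: K_def)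
  qed (use pole V V' Vf W f_pos V_nonneg dim in \<open>auto simp: N_def\<close>)
  have r: "H.r = r" by (simp add: fun_eq_iff H.r_def r_def)
  show ?thesis
    using H.rellich_integrated
    unfolding H.F0_eq H.F2_eq H.F3_eq H.F4_eq H.F1_def H.gs_eq r H.n_def N_def .
qed

end
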